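(* Let $\underline{\mathcal C}$ be a $G$-$A$-coring with left dual graded ring $R$. The square of functors formed by $F_3:\mathcal M^{G,\underline{\mathcal C}}\to\mathcal M^G_R$, $F_4:\mathcal M^{\underline{\mathcal C}}\to\mathcal M_R$, and the adjoint pairs $(F_1,G_1)$ between $\mathcal M^{G,\underline{\mathcal C}}$ and $\mathcal M^{\underline{\mathcal C}}$ and $(F_5,G_5)$ between $\mathcal M^G_R$ and $\mathcal M_R$ commutes: $F_5\circ F_3=F_4\circ F_1$ as functors $\mathcal M^{G,\underline{\mathcal C}}\to\mathcal M_R$, and $F_3\circ G_1=G_5\circ F_4$ as functors $\mathcal M^{\underline{\mathcal C}}\to\mathcal M^G_R$.
   Context: $G$ is a group with unit $e$, $A$ is a ring with unit. A $G$-$A$-coring (group coring) $\underline{\mathcal C}$ is a family $(\mathcal C_\alpha)_{\alpha\in G}$ of $A$-bimodules with $A$-bimodule maps $\Delta_{\alpha,\beta}:\mathcal C_{\alpha\beta}\to\mathcal C_\alpha\otimes_A\mathcal C_\beta$, written $\Delta_{\alpha,\beta}(c)=c_{(1,\alpha)}\otimes_Ac_{(2,\beta)}$, and $\varepsilon:\mathcal C_e\to A$ such that, for all $\alpha,\beta,\gamma\in G$, $(\Delta_{\alpha,\beta}\otimes_A\mathcal C_\gamma)\circ\Delta_{\alpha\beta,\gamma}=(\mathcal C_\alpha\otimes_A\Delta_{\beta,\gamma})\circ\Delta_{\alpha,\beta\gamma}$ and $(\mathcal C_\alpha\otimes_A\varepsilon)\circ\Delta_{\alpha,e}=\mathcal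 C_\alpha=(\varepsilon\otimes_A\mathcal C_\alpha)\circ\Delta_{e,\alpha}$ (an object also denotes its identity map). A right $\underline{\mathcal C}$-comodule is a right $A$-module $M$ with right $A$-linear maps $\rho_\alpha:M\to M\otimes_A\mathcal C_\alpha$, $\rho_\alpha(m)=m_{[0]}\otimes_Am_{[1,\alpha]}$, such that $(M\otimes_A\Delta_{\alpha,\beta})\circ\rho_{\alpha\beta}=(\rho_\alpha\otimes_A\mathcal C_\beta)\circ\rho_\beta$ and $(M\otimes_A\varepsilon)\circ\rho_e=M$; morphisms are right $A$-linear maps commuting with all $\rho_\alpha$. The category is $\mathcal M^{\underline{\mathcal C}}$. A right $G$-$\underline{\mathcal C}$-comodule is a family $\underline M=(M_\alpha)_{\alpha\in G}$ of right $A$-modules with right $A$-linear maps $\rho_{\alpha,\beta}:M_{\alpha\beta}\to M_\alpha\otimes_A\mathcal C_\beta$, $\rho_{\alpha,\beta}(m)=m_{[0,\alpha]}\otimes_Am_{[1,\beta]}$, such that $(M_\alpha\otimes_A\Delta_{\beta,\gamma})\circ\rho_{\alpha,\beta\gamma}=(\rho_{\alpha,\beta}\otimes_A\mathcal C_\gamma)\circ\rho_{\alpha\beta,\gamma}$ and $(M_\alpha\otimes_A\varepsilon)\circ\rho_{\alpha,e}=M_\alpha$; morphisms are families of right $A$-linear maps $f_\alpha$ with $(f_\alpha\otimes_A\mathcal C_\beta)\circ\rho_{\alpha,\beta}=\rho_{\alpha,\beta}\circ f_{\alpha\beta}$. The category is $\mathcal M^{G,\underline{\mathcal C}}$. The left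 dual graded ring is $R=\bigoplus_{\alpha\in G}R_\alpha$, $R_\alpha={}_A\mathrm{Hom}(\mathcal C_{\alpha^{-1}},A)$ (left $A$-linear maps), with $(a\cdot f\cdot b)(c)=f(ca)b$, multiplication $(f\#g)(c)=g(c_{(1,\beta^{-1})}f(c_{(2,\alpha^{-1})}))$ for $f\in R_\alpha$, $g\in R_\beta$, $c\in\mathcal C_{(\alpha\beta)^{-1}}$, and unit $\varepsilon$. $\mathcal M_R$ and $\mathcal M_R^G$ are the categories of right $R$-modules and $G$-graded right $R$-modules. For a module $M$, $\mu_\alpha(M)=\{\mu_\alpha(m)\mid m\in M\}$ is an isomorphic copy of $M$ indexed by $\alpha\in G$. Functors: - $F_1(\underline M)=\bigoplus_\alpha M_\alpha$ with $\rho_\alpha=\bigoplus_\beta\rho_{\beta\alpha^{-1},\alpha}$; $G_1(M)=(\mu_\alpha(M))_\alpha$ with $\rho_{\alpha,\beta}(\mu_{\alpha\beta}(m))=\mu_\alpha(m_{[0]})\otimes_Am_{[1,\beta]}$. - $F_3(\underline M)=\bigoplus_\alpha M_\alpha$ with $m\cdot f=m_{[0,\alpha\beta]}f(m_{[1,\beta^{-1}]})$ for $m\in M_\alpha$, $f\in R_\beta$. - $F_4(M)=M$ with $m\cdot f=m_{[0]}f(m_{[1,\beta^{-1}]})$ for $f\in R_\beta$. - $F_5$ forgets the grading; $G_5(M)=\bigoplus_\alpha\mu_\alpha(M)$ with $\mu_\alpha(m)r=\mu_{\alpha\beta}(mr)$ for $r\in R_\beta$. All functors act in the obvious way on morphisms.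 *)

theory Defs
  imports "HOL-Algebra.Free_Abelian_Groups" "HOL-Algebra.Module"
begin

section \<open>Modules and bimodules over a not necessarily commutative ring\<close>

text \<open>
  The library's locale \<open>module\<close> is restricted to commutative rings.  As there, the multiplicative
  fields inherited from \<open>ring\<close> carry no meaning for a module.
\<close>

record ('a, 'm) rmod = "'m ring" +
  ract :: "'m \<Rightarrow> 'a \<Rightarrow> 'm" (infixl \<open>\<triangleleft>\<index>\<close> 70)

record ('a, 'm) bimod = "('a, 'm) rmod" +
  lact :: "'a \<Rightarrow> 'm \<Rightarrow> 'm" (infixr \<open>\<triangleright>\<index>\<close> 70)

locale right_module = R?: ring R + M?: abelian_group M
  for R :: "('a, 'x) ring_scheme" (structure) and M :: "('a, 'm, 'y) rmod_scheme" (structure) +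
  assumes ract_closed:
      "\<lbrakk>x \<in> carrier M; a \<in> carrier R\<rbrakk> \<Longrightarrow> x \<triangleleft>\<^bsub>M\<^esub> a \<in> carrier M"
    and ract_add_left:
      "\<lbrakk>x \<in> carrier M; y \<in> carrier M; a \<in> carrier R\<rbrakk> \<Longrightarrow>
       (x \<oplus>\<^bsub>M\<^esub> y) \<triangleleft>\<^bsub>M\<^esub> a = x \<triangleleft>\<^bsub>M\<^esub> a \<oplus>\<^bsub>M\<^esub> y \<triangleleft>\<^bsub>M\<^esub> a"
    and ract_add_right:
      "\<lbrakk>x \<in> carrier M; a \<in> carrier R; b \<in> carrier R\<rbrakk> \<Longrightarrow>
       x \<triangleleft>\<^bsub>M\<^esub> (a \<oplus>\<^bsub>R\<^esub> b) = x \<triangleleft>\<^bsub>M\<^esub> a \<oplus>\<^bsub>M\<^esub> x \<triangleleft>\<^bsub>M\<^esub> b"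
    and ract_mult:
      "\<lbrakk>x \<in> carrier M; a \<in> carrier R; b \<in> carrier R\<rbrakk> \<Longrightarrow>
       x \<triangleleft>\<^bsub>M\<^esub> (a \<otimes>\<^bsub>R\<^esub> b) = (x \<triangleleft>\<^bsub>M\<^esub> a) \<triangleleft>\<^bsub>M\<^esub> b"
    and ract_one:
      "x \<in> carrier M \<Longrightarrow> x \<triangleleft>\<^bsub>M\<^esub> \<one>\<^bsub>R\<^esub> = x"

locale bimodule = right_module R M
  for R :: "('a, 'x) ring_scheme" (structure) and M :: "('a, 'm, 'y) bimod_scheme" (structure) +
  assumes lact_closed:
      "\<lbrakk>a \<in> carrier R; x \<in> carrier M\<rbrakk> \<Longrightarrow> a \<triangleright>\<^bsub>M\<^esub> x \<in> carrier M"
    and lact_add_right: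
      "\<lbrakk>a \<in> carrier R; x \<in> carrier M; y \<in> carrier M\<rbrakk> \<Longrightarrow>
       a \<triangleright>\<^bsub>M\<^esub> (x \<oplus>\<^bsub>M\<^esub> y) = (a \<triangleright>\<^bsub>M\<^esub> x) \<oplus>\<^bsub>M\<^esub> (a \<triangleright>\<^bsub>M\<^esub> y)"
    and lact_add_left:
      "\<lbrakk>a \<in> carrier R; b \<in> carrier R; x \<in> carrier M\<rbrakk> \<Longrightarrow>
       (a \<oplus>\<^bsub>R\<^esub> b) \<triangleright>\<^bsub>M\<^esub> x = (a \<triangleright>\<^bsub>M\<^esub> x) \<oplus>\<^bsub>M\<^esub> (b \<triangleright>\<^bsub>M\<^esub> x)"
    and lact_mult:
      "\<lbrakk>a \<in> carrier R; b \<in> carrier R; x \<in> carrier M\<rbrakk> \<Longrightarrow>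
       (a \<otimes>\<^bsub>R\<^esub> b) \<triangleright>\<^bsub>M\<^esub> x = a \<triangleright>\<^bsub>M\<^esub> (b \<triangleright>\<^bsub>M\<^esub> x)"
    and lact_one:
      "x \<in> carrier M \<Longrightarrow> \<one>\<^bsub>R\<^esub> \<triangleright>\<^bsub>M\<^esub> x = x"
    and lact_ract:
      "\<lbrakk>a \<in> carrier R; x \<in> carrier M; b \<in> carrier R\<rbrakk> \<Longrightarrow>
       (a \<triangleright>\<^bsub>M\<^esub> x) \<triangleleft>\<^bsub>M\<^esub> b = a \<triangleright>\<^bsub>M\<^esub> (x \<triangleleft>\<^bsub>M\<^esub> b)"

text \<open>Homomorphisms are not required to be extensional here; the morphisms of the categories below are.\<close>

definition rhom :: "('a, 'x) ring_scheme \<Rightarrow> ('a, 'm, 'y) rmod_scheme \<Rightarrow> ('a, 'n, 'z) rmod_scheme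
    \<Rightarrow> ('m \<Rightarrow> 'n) set" where
  "rhom A M N = {f \<in> carrier M \<rightarrow> carrier N.
     (\<forall>x\<in>carrier M. \<forall>y\<in>carrier M. f (x \<oplus>\<^bsub>M\<^esub> y) = f x \<oplus>\<^bsub>N\<^esub> f y) \<and>
     (\<forall>x\<in>carrier M. \<forall>a\<in>carrier A. f (x \<triangleleft>\<^bsub>M\<^esub> a) = f x \<triangleleft>\<^bsub>N\<^esub> a)}"

definition lhom :: "('a, 'x) ring_scheme \<Rightarrow> ('a, 'm, 'y) bimod_scheme \<Rightarrow> ('a, 'n, 'z) bimod_scheme
    \<Rightarrow> ('m \<Rightarrow> 'n) set" where
  "lhom A M N = {f \<in> carrier M \<rightarrow> carrier N.
     (\<forall>x\<in>carrier M. \<forall>y\<in>carrier M. f (x \<oplus>\<^bsub>M\<^esub> y) = f x \<oplus>\<^bsub>N\<^esub> f y) \<and>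
     (\<forall>a\<in>carrier A. \<forall>x\<in>carrier M. f (a \<triangleright>\<^bsub>M\<^esub> x) = a \<triangleright>\<^bsub>N\<^esub> f x)}"

definition add_ring :: "('m, 'x) monoid_scheme \<Rightarrow> 'm ring" where
  "add_ring H = \<lparr>carrier = carrier H, monoid.mult = undefined, one = undefined,
     zero = \<one>\<^bsub>H\<^esub>, add = monoid.mult H\<rparr>"

definition with_ract :: "('m, 'x) ring_scheme \<Rightarrow> ('m \<Rightarrow> 'a \<Rightarrow> 'm) \<Rightarrow> ('a, 'm) rmod" where
  "with_ract B act = \<lparr>carrier = carrier B, monoid.mult = undefined, one = undefined,
     zero = \<zero>\<^bsub>B\<^esub>, add = add B, ract = act\<rparr>"

definition regular :: "('a, 'x) ring_scheme \<Rightarrow> ('a, 'a) bimod" where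
  "regular A = rmod.extend (with_ract A (monoid.mult A)) (bimod.fields (monoid.mult A))"


section \<open>Tensor products\<close>

type_synonym ('m, 'n) tens = "('m \<times> 'n \<Rightarrow>\<^sub>0 int) set"

definition tensor_relators :: "('a, 'x) ring_scheme \<Rightarrow> ('a, 'm, 'y) rmod_scheme \<Rightarrow>
    ('a, 'n, 'z) bimod_scheme \<Rightarrow> ('m \<times> 'n \<Rightarrow>\<^sub>0 int) set" where
  "tensor_relators A M N =
     {frag_of (x \<oplus>\<^bsub>M\<^esub> y, n) - frag_of (x, n) - frag_of (y, n) | x y n.
        x \<in> carrier M \<and> y \<in> carrier M \<and> n \<in> carrier N} \<union>
     {frag_of (x, n \<oplus>\<^bsub>N\<^esub> p) - frag_of (x, n) - frag_of (x, p) | x n p.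
        x \<in> carrier M \<and> n \<in> carrier N \<and> p \<in> carrier N} \<union>
     {frag_of (x \<triangleleft>\<^bsub>M\<^esub> a, n) - frag_of (x, a \<triangleright>\<^bsub>N\<^esub> n) | x a n.
        x \<in> carrier M \<and> a \<in> carrier A \<and> n \<in> carrier N}"

definition tensor_kernel :: "('a, 'x) ring_scheme \<Rightarrow> ('a, 'm, 'y) rmod_scheme \<Rightarrow>
    ('a, 'n, 'z) bimod_scheme \<Rightarrow> ('m \<times> 'n \<Rightarrow>\<^sub>0 int) set" where
  "tensor_kernel A M N =
     generate (free_Abelian_group (carrier M \<times> carrier N)) (tensor_relators A M N)"

definition tensor_group :: "('a, 'x) ring_scheme \<Rightarrow> ('a, 'm, 'y) rmod_scheme \<Rightarrow>
    ('a, 'n, 'z) bimod_scheme \<Rightarrow> ('m, 'n) tens ring" where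
  "tensor_group A M N =
     add_ring (free_Abelian_group (carrier M \<times> carrier N) Mod tensor_kernel A M N)"

definition ptens :: "('a, 'x) ring_scheme \<Rightarrow> ('a, 'm, 'y) rmod_scheme \<Rightarrow>
    ('a, 'n, 'z) bimod_scheme \<Rightarrow> 'm \<Rightarrow> 'n \<Rightarrow> ('m, 'n) tens" where
  "ptens A M N m n =
     tensor_kernel A M N #>\<^bsub>free_Abelian_group (carrier M \<times> carrier N)\<^esub> frag_of (m, n)"

text \<open>
  \<open>tlift H b\<close> is the additive map from the tensor product to \<open>H\<close> with \<open>m \<otimes> n \<mapsto> b m n\<close>: evaluate
  any representative of the coset.  It is meaningful for biadditive balanced \<open>b\<close>.
\<close>

definition tlift :: "('h, 'x) ring_scheme \<Rightarrow> ('m \<Rightarrow> 'n \<Rightarrow> 'h) \<Rightarrow> ('m, 'n) tens \<Rightarrow> 'h" where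
  "tlift H b X =
     the_elem ((\<lambda>c. \<Oplus>\<^bsub>H\<^esub>p\<in>Poly_Mapping.keys c. [Poly_Mapping.lookup c p] \<cdot>\<^bsub>H\<^esub> b (fst p) (snd p)) ` X)"

text \<open>\<open>M \<otimes>\<^sub>A N\<close> as a right module for a right module \<open>M\<close>, and as a bimodule for a bimodule \<open>M\<close>.\<close>

definition tensor :: "('a, 'x) ring_scheme \<Rightarrow> ('a, 'm, 'y) rmod_scheme \<Rightarrow>
    ('a, 'n, 'z) bimod_scheme \<Rightarrow> ('a, ('m, 'n) tens) rmod" where
  "tensor A M N = with_ract (tensor_group A M N)
     (\<lambda>t a. tlift (tensor_group A M N) (\<lambda>m n. ptens A M N m (n \<triangleleft>\<^bsub>N\<^esub> a)) t)"

definition btensor :: "('a, 'x) ring_scheme \<Rightarrow> ('a, 'm, 'y) bimod_scheme \<Rightarrow>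
    ('a, 'n, 'z) bimod_scheme \<Rightarrow> ('a, ('m, 'n) tens) bimod" where
  "btensor A M N = rmod.extend (tensor A M N) (bimod.fields
     (\<lambda>a t. tlift (tensor_group A M N) (\<lambda>m n. ptens A M N (a \<triangleright>\<^bsub>M\<^esub> m) n) t))"

text \<open>\<open>tmap A M' N' f g\<close> is \<open>f \<otimes>\<^sub>A g\<close> with codomain \<open>M' \<otimes>\<^sub>A N'\<close>.\<close>

definition tmap :: "('a, 'x) ring_scheme \<Rightarrow> ('a, 'm2, 'y) rmod_scheme \<Rightarrow> ('a, 'n2, 'z) bimod_scheme \<Rightarrow>
    ('m \<Rightarrow> 'm2) \<Rightarrow> ('n \<Rightarrow> 'n2) \<Rightarrow> ('m, 'n) tens \<Rightarrow> ('m2, 'n2) tens" where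
  "tmap A M' N' f g = tlift (tensor_group A M' N') (\<lambda>m n. ptens A M' N' (f m) (g n))"

text \<open>The canonical maps \<open>(M \<otimes> N) \<otimes> P \<rightarrow> M \<otimes> (N \<otimes> P)\<close>, \<open>M \<otimes> A \<rightarrow> M\<close> and \<open>A \<otimes> M \<rightarrow> M\<close>.\<close>

definition tassoc :: "('a, 'x) ring_scheme \<Rightarrow> ('a, 'm, 'y) rmod_scheme \<Rightarrow> ('a, 'n, 'z) bimod_scheme \<Rightarrow>
    ('a, 'p, 'w) bimod_scheme \<Rightarrow> (('m, 'n) tens, 'p) tens \<Rightarrow> ('m, ('n, 'p) tens) tens" where
  "tassoc A M N P =
     (let T = tensor_group A M (btensor A N P)
      in tlift T (\<lambda>t p. tlift T (\<lambda>m n. ptens A M (btensor A N P) m (ptens A N P n p)) t))"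

definition runit :: "('a, 'm, 'y) rmod_scheme \<Rightarrow> ('m, 'a) tens \<Rightarrow> 'm" where
  "runit M = tlift M (\<lambda>m a. m \<triangleleft>\<^bsub>M\<^esub> a)"

definition lunit :: "('a, 'm, 'y) bimod_scheme \<Rightarrow> ('a, 'm) tens \<Rightarrow> 'm" where
  "lunit M = tlift M (\<lambda>a m. a \<triangleright>\<^bsub>M\<^esub> m)"


section \<open>Direct sums\<close>

definition dsum :: "'i set \<Rightarrow> ('i \<Rightarrow> ('m, 'x) ring_scheme) \<Rightarrow> ('i \<Rightarrow> 'm) ring" where
  "dsum I M = add_ring (sum_group I (\<lambda>i. add_monoid (M i)))"

definition dsum_mod :: "'i set \<Rightarrow> ('i \<Rightarrow> ('a, 'm, 'x) rmod_scheme) \<Rightarrow> ('a, 'i \<Rightarrow> 'm) rmod" where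
  "dsum_mod I M = with_ract (dsum I M) (\<lambda>x a. \<lambda>i\<in>I. x i \<triangleleft>\<^bsub>M i\<^esub> a)"

definition dsupp :: "'i set \<Rightarrow> ('i \<Rightarrow> ('m, 'x) ring_scheme) \<Rightarrow> ('i \<Rightarrow> 'm) \<Rightarrow> 'i set" where
  "dsupp I M x = {i \<in> I. x i \<noteq> \<zero>\<^bsub>M i\<^esub>}"

definition dinj :: "'i set \<Rightarrow> ('i \<Rightarrow> ('m, 'x) ring_scheme) \<Rightarrow> 'i \<Rightarrow> 'm \<Rightarrow> 'i \<Rightarrow> 'm" where
  "dinj I M i m = (\<lambda>j\<in>I. if j = i then m else \<zero>\<^bsub>M j\<^esub>)"

definition dpart :: "'i set \<Rightarrow> ('i \<Rightarrow> ('m, 'x) ring_scheme) \<Rightarrow> 'i \<Rightarrow> ('i \<Rightarrow> 'm) set" where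
  "dpart I M i = {x \<in> carrier (dsum I M). dsupp I M x \<subseteq> {i}}"

text \<open>
  The biadditive map \<open>\<Oplus>M\<^sub>\<alpha> \<times> \<Oplus>N\<^sub>\<beta> \<rightarrow> \<Oplus>P\<^sub>\<gamma>\<close> that extends a family of biadditive maps
  \<open>op \<alpha> \<beta> : M\<^sub>\<alpha> \<times> N\<^sub>\<beta> \<rightarrow> P\<^sub>\<alpha>\<^sub>\<beta>\<close>; products and actions are given on homogeneous elements only.
\<close>

definition dext :: "('g, 'x) monoid_scheme \<Rightarrow> ('g \<Rightarrow> ('m, 'y) ring_scheme) \<Rightarrow>
    ('g \<Rightarrow> ('n, 'z) ring_scheme) \<Rightarrow> ('g \<Rightarrow> ('p, 'w) ring_scheme) \<Rightarrow>
    ('g \<Rightarrow> 'g \<Rightarrow> 'm \<Rightarrow> 'n \<Rightarrow> 'p) \<Rightarrow> ('g \<Rightarrow> 'm) \<Rightarrow> ('g \<Rightarrow> 'n) \<Rightarrow> 'g \<Rightarrow> 'p" where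
  "dext G M N P op x y =
     (\<Oplus>\<^bsub>dsum (carrier G) P\<^esub>q\<in>dsupp (carrier G) M x \<times> dsupp (carrier G) N y.
        dinj (carrier G) P (fst q \<otimes>\<^bsub>G\<^esub> snd q) (op (fst q) (snd q) (x (fst q)) (y (snd q))))"


section \<open>Group corings and their comodules\<close>

record ('g, 'a, 'c) coring =
  cmod :: "'g \<Rightarrow> ('a, 'c) bimod"
  comult :: "'g \<Rightarrow> 'g \<Rightarrow> 'c \<Rightarrow> ('c, 'c) tens"
  counit :: "'c \<Rightarrow> 'a"

locale group_coring = G: group G + A: ring A
  for G :: "('g, 'x) monoid_scheme" and A :: "('a, 'y) ring_scheme"
    and C :: "('g, 'a, 'c) coring" +
  assumes cmod_bimodule:
      "\<alpha> \<in> carrier G \<Longrightarrow> bimodule A (cmod C \<alpha>)"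
    and comult_hom:
      "\<lbrakk>\<alpha> \<in> carrier G; \<beta> \<in> carrier G\<rbrakk> \<Longrightarrow>
       comult C \<alpha> \<beta> \<in> rhom A (cmod C (\<alpha> \<otimes>\<^bsub>G\<^esub> \<beta>)) (btensor A (cmod C \<alpha>) (cmod C \<beta>))
                   \<inter> lhom A (cmod C (\<alpha> \<otimes>\<^bsub>G\<^esub> \<beta>)) (btensor A (cmod C \<alpha>) (cmod C \<beta>))"
    and counit_hom:
      "counit C \<in> rhom A (cmod C \<one>\<^bsub>G\<^esub>) (regular A) \<inter> lhom A (cmod C \<one>\<^bsub>G\<^esub>) (regular A)"
    and coassoc:
      "\<lbrakk>\<alpha> \<in> carrier G; \<beta> \<in> carrier G; \<gamma> \<in> carrier G; c \<in> carrier (cmod C (\<alpha> \<otimes>\<^bsub>G\<^esub> \<beta> \<otimes>\<^bsub>G\<^esub> \<gamma>))\<rbrakk> \<Longrightarrow>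
       tassoc A (cmod C \<alpha>) (cmod C \<beta>) (cmod C \<gamma>)
         (tmap A (btensor A (cmod C \<alpha>) (cmod C \<beta>)) (cmod C \<gamma>) (comult C \<alpha> \<beta>) (\<lambda>z. z)
           (comult C (\<alpha> \<otimes>\<^bsub>G\<^esub> \<beta>) \<gamma> c)) =
       tmap A (cmod C \<alpha>) (btensor A (cmod C \<beta>) (cmod C \<gamma>)) (\<lambda>z. z) (comult C \<beta> \<gamma>)
         (comult C \<alpha> (\<beta> \<otimes>\<^bsub>G\<^esub> \<gamma>) c)"
    and counit_right:
      "\<lbrakk>\<alpha> \<in> carrier G; c \<in> carrier (cmod C \<alpha>)\<rbrakk> \<Longrightarrow>
       runit (cmod C \<alpha>) (tmap A (cmod C \<alpha>) (regular A) (\<lambda>z. z) (counit C) (comult C \<alpha> \<one>\<^bsub>G\<^esub> c)) = c"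
    and counit_left:
      "\<lbrakk>\<alpha> \<in> carrier G; c \<in> carrier (cmod C \<alpha>)\<rbrakk> \<Longrightarrow>
       lunit (cmod C \<alpha>) (tmap A (regular A) (cmod C \<alpha>) (counit C) (\<lambda>z. z) (comult C \<one>\<^bsub>G\<^esub> \<alpha> c)) = c"

record ('g, 'a, 'm, 'c) comod = "('a, 'm) rmod" +
  coact :: "'g \<Rightarrow> 'm \<Rightarrow> ('m, 'c) tens"

locale comodule = group_coring G A C + right_module A M
  for G :: "('g, 'x) monoid_scheme" and A :: "('a, 'y) ring_scheme"
    and C :: "('g, 'a, 'c) coring" and M :: "('g, 'a, 'm, 'c) comod" +
  assumes coact_hom:
      "\<alpha> \<in> carrier G \<Longrightarrow> coact M \<alpha> \<in> rhom A M (tensor A M (cmod C \<alpha>))"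
    and coact_coassoc:
      "\<lbrakk>\<alpha> \<in> carrier G; \<beta> \<in> carrier G; m \<in> carrier M\<rbrakk> \<Longrightarrow>
       tmap A M (btensor A (cmod C \<alpha>) (cmod C \<beta>)) (\<lambda>z. z) (comult C \<alpha> \<beta>) (coact M (\<alpha> \<otimes>\<^bsub>G\<^esub> \<beta>) m) =
       tassoc A M (cmod C \<alpha>) (cmod C \<beta>)
         (tmap A (tensor A M (cmod C \<alpha>)) (cmod C \<beta>) (coact M \<alpha>) (\<lambda>z. z) (coact M \<beta> m))"
    and coact_counit:
      "m \<in> carrier M \<Longrightarrow>
       runit M (tmap A M (regular A) (\<lambda>z. z) (counit C) (coact M \<one>\<^bsub>G\<^esub> m)) = m"

record ('g, 'a, 'm, 'c) gcomod =
  gmod :: "'g \<Rightarrow> ('a, 'm) rmod"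
  gcoact :: "'g \<Rightarrow> 'g \<Rightarrow> 'm \<Rightarrow> ('m, 'c) tens"

locale gcomodule = group_coring G A C
  for G :: "('g, 'x) monoid_scheme" and A :: "('a, 'y) ring_scheme"
    and C :: "('g, 'a, 'c) coring" and M :: "('g, 'a, 'm, 'c) gcomod" +
  assumes gmod_module:
      "\<alpha> \<in> carrier G \<Longrightarrow> right_module A (gmod M \<alpha>)"
    and gcoact_hom:
      "\<lbrakk>\<alpha> \<in> carrier G; \<beta> \<in> carrier G\<rbrakk> \<Longrightarrow>
       gcoact M \<alpha> \<beta> \<in> rhom A (gmod M (\<alpha> \<otimes>\<^bsub>G\<^esub> \<beta>)) (tensor A (gmod M \<alpha>) (cmod C \<beta>))"
    and gcoact_coassoc:
      "\<lbrakk>\<alpha> \<in> carrier G; \<beta> \<in> carrier G; \<gamma> \<in> carrier G; m \<in> carrier (gmod M (\<alpha> \<otimes>\<^bsub>G\<^esub> \<beta> \<otimes>\<^bsub>G\<^esub> \<gamma>))\<rbrakk> \<Longrightarrow>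
       tmap A (gmod M \<alpha>) (btensor A (cmod C \<beta>) (cmod C \<gamma>)) (\<lambda>z. z) (comult C \<beta> \<gamma>)
         (gcoact M \<alpha> (\<beta> \<otimes>\<^bsub>G\<^esub> \<gamma>) m) =
       tassoc A (gmod M \<alpha>) (cmod C \<beta>) (cmod C \<gamma>)
         (tmap A (tensor A (gmod M \<alpha>) (cmod C \<beta>)) (cmod C \<gamma>) (gcoact M \<alpha> \<beta>) (\<lambda>z. z)
           (gcoact M (\<alpha> \<otimes>\<^bsub>G\<^esub> \<beta>) \<gamma> m))"
    and gcoact_counit:
      "\<lbrakk>\<alpha> \<in> carrier G; m \<in> carrier (gmod M \<alpha>)\<rbrakk> \<Longrightarrow>
       runit (gmod M \<alpha>) (tmap A (gmod M \<alpha>) (regular A) (\<lambda>z. z) (counit C) (gcoact M \<alpha> \<one>\<^bsub>G\<^esub> m)) = m"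


section \<open>The left dual graded ring\<close>

text \<open>The additive group \<open>R\<^sub>\<alpha>\<close> of left linear maps from \<open>C\<close> in degree \<open>\<alpha>\<inverse>\<close> to \<open>A\<close>.\<close>

definition dual_comp :: "('g, 'x) monoid_scheme \<Rightarrow> ('a, 'y) ring_scheme \<Rightarrow> ('g, 'a, 'c) coring \<Rightarrow>
    'g \<Rightarrow> ('c \<Rightarrow> 'a) ring" where
  "dual_comp G A C \<alpha> =
     (let D = cmod C (inv\<^bsub>G\<^esub> \<alpha>)
      in \<lparr>carrier = lhom A D (regular A) \<inter> extensional (carrier D),
          monoid.mult = undefined, one = undefined,
          zero = (\<lambda>c\<in>carrier D. \<zero>\<^bsub>A\<^esub>),
          add = (\<lambda>f g. \<lambda>c\<in>carrier D. f c \<oplus>\<^bsub>A\<^esub> g c)\<rparr>)"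

definition dual_mult :: "('g, 'x) monoid_scheme \<Rightarrow> ('a, 'y) ring_scheme \<Rightarrow> ('g, 'a, 'c) coring \<Rightarrow>
    'g \<Rightarrow> 'g \<Rightarrow> ('c \<Rightarrow> 'a) \<Rightarrow> ('c \<Rightarrow> 'a) \<Rightarrow> 'c \<Rightarrow> 'a" where
  "dual_mult G A C \<alpha> \<beta> f g =
     (\<lambda>c\<in>carrier (cmod C (inv\<^bsub>G\<^esub> (\<alpha> \<otimes>\<^bsub>G\<^esub> \<beta>))).
        tlift A (\<lambda>c1 c2. g (c1 \<triangleleft>\<^bsub>cmod C (inv\<^bsub>G\<^esub> \<beta>)\<^esub> f c2)) (comult C (inv\<^bsub>G\<^esub> \<beta>) (inv\<^bsub>G\<^esub> \<alpha>) c))"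

definition dual_ring :: "('g, 'x) monoid_scheme \<Rightarrow> ('a, 'y) ring_scheme \<Rightarrow> ('g, 'a, 'c) coring \<Rightarrow>
    ('g \<Rightarrow> 'c \<Rightarrow> 'a) ring" where
  "dual_ring G A C =
     (let Q = dual_comp G A C; S = dsum (carrier G) Q
      in \<lparr>carrier = carrier S,
          monoid.mult = dext G Q Q Q (dual_mult G A C),
          one = dinj (carrier G) Q \<one>\<^bsub>G\<^esub> (restrict (counit C) (carrier (cmod C \<one>\<^bsub>G\<^esub>))),
          zero = \<zero>\<^bsub>S\<^esub>, add = add S\<rparr>)"

definition dual_part :: "('g, 'x) monoid_scheme \<Rightarrow> ('a, 'y) ring_scheme \<Rightarrow> ('g, 'a, 'c) coring \<Rightarrow>
    'g \<Rightarrow> ('g \<Rightarrow> 'c \<Rightarrow> 'a) set" where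
  "dual_part G A C = dpart (carrier G) (dual_comp G A C)"

record ('g, 'r, 'm) grmod = "('r, 'm) rmod" +
  grade :: "'g \<Rightarrow> 'm set"

text \<open>Here \<open>RR\<close> is the family of homogeneous components of the graded ring \<open>R\<close>.\<close>

locale graded_right_module = G: group G + right_module R M
  for G :: "('g, 'x) monoid_scheme" and R :: "('r, 'y) ring_scheme" and RR :: "'g \<Rightarrow> 'r set"
    and M :: "('g, 'r, 'm) grmod" +
  assumes grade_subgroup:
      "\<alpha> \<in> carrier G \<Longrightarrow> subgroup (grade M \<alpha>) (add_monoid M)"
    and grade_direct_sum:
      "x \<in> carrier M \<Longrightarrow>
       \<exists>!y. y \<in> (\<Pi>\<^sub>E \<alpha>\<in>carrier G. grade M \<alpha>) \<and> finite {\<alpha> \<in> carrier G. y \<alpha> \<noteq> \<zero>\<^bsub>M\<^esub>} \<and>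
            x = (\<Oplus>\<^bsub>M\<^esub>\<alpha>\<in>{\<alpha> \<in> carrier G. y \<alpha> \<noteq> \<zero>\<^bsub>M\<^esub>}. y \<alpha>)"
    and grade_ract:
      "\<lbrakk>\<alpha> \<in> carrier G; \<beta> \<in> carrier G; m \<in> grade M \<alpha>; r \<in> RR \<beta>\<rbrakk> \<Longrightarrow>
       m \<triangleleft>\<^bsub>M\<^esub> r \<in> grade M (\<alpha> \<otimes>\<^bsub>G\<^esub> \<beta>)"


section \<open>Categories and functors\<close>

record ('o, 'h) cat =
  Ob :: "'o set"
  Hom :: "'o \<Rightarrow> 'o \<Rightarrow> 'h set"
  Ident :: "'o \<Rightarrow> 'h"
  Comp :: "'o \<Rightarrow> 'o \<Rightarrow> 'o \<Rightarrow> 'h \<Rightarrow> 'h \<Rightarrow> 'h"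

text \<open>\<open>Comp K X Y Z g f\<close> is \<open>g \<circ> f\<close> for \<open>f : X \<rightarrow> Y\<close> and \<open>g : Y \<rightarrow> Z\<close>.\<close>

locale category =
  fixes K :: "('o, 'h) cat"
  assumes Ident_Hom:
      "X \<in> Ob K \<Longrightarrow> Ident K X \<in> Hom K X X"
    and Comp_Hom:
      "\<lbrakk>X \<in> Ob K; Y \<in> Ob K; Z \<in> Ob K; f \<in> Hom K X Y; g \<in> Hom K Y Z\<rbrakk> \<Longrightarrow>
       Comp K X Y Z g f \<in> Hom K X Z"
    and Comp_Ident_right:
      "\<lbrakk>X \<in> Ob K; Y \<in> Ob K; f \<in> Hom K X Y\<rbrakk> \<Longrightarrow> Comp K X X Y f (Ident K X) = f"
    and Comp_Ident_left:
      "\<lbrakk>X \<in> Ob K; Y \<in> Ob K; f \<in> Hom K X Y\<rbrakk> \<Longrightarrow> Comp K X Y Y (Ident K Y) f = f"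
    and Comp_assoc:
      "\<lbrakk>W \<in> Ob K; X \<in> Ob K; Y \<in> Ob K; Z \<in> Ob K; f \<in> Hom K W X; g \<in> Hom K X Y; h \<in> Hom K Y Z\<rbrakk> \<Longrightarrow>
       Comp K W Y Z h (Comp K W X Y g f) = Comp K W X Z (Comp K X Y Z h g) f"

record ('o1, 'h1, 'o2, 'h2) ftor =
  fob :: "'o1 \<Rightarrow> 'o2"
  far :: "'o1 \<Rightarrow> 'o1 \<Rightarrow> 'h1 \<Rightarrow> 'h2"

locale is_functor = K: category K + L: category L
  for K :: "('o1, 'h1) cat" and L :: "('o2, 'h2) cat" +
  fixes F :: "('o1, 'h1, 'o2, 'h2) ftor"
  assumes fob_Ob:
      "X \<in> Ob K \<Longrightarrow> fob F X \<in> Ob L"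
    and far_Hom:
      "\<lbrakk>X \<in> Ob K; Y \<in> Ob K; f \<in> Hom K X Y\<rbrakk> \<Longrightarrow> far F X Y f \<in> Hom L (fob F X) (fob F Y)"
    and far_Ident:
      "X \<in> Ob K \<Longrightarrow> far F X X (Ident K X) = Ident L (fob F X)"
    and far_Comp:
      "\<lbrakk>X \<in> Ob K; Y \<in> Ob K; Z \<in> Ob K; f \<in> Hom K X Y; g \<in> Hom K Y Z\<rbrakk> \<Longrightarrow>
       far F X Z (Comp K X Y Z g f) =
       Comp L (fob F X) (fob F Y) (fob F Z) (far F Y Z g) (far F X Y f)"

definition fcomp :: "('o2, 'h2, 'o3, 'h3) ftor \<Rightarrow> ('o1, 'h1, 'o2, 'h2) ftor \<Rightarrow>
    ('o1, 'h1, 'o3, 'h3) ftor" (infixl \<open>\<circ>\<^sub>F\<close> 55) where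
  "F' \<circ>\<^sub>F F = \<lparr>fob = (\<lambda>X. fob F' (fob F X)),
     far = (\<lambda>X Y f. far F' (fob F X) (fob F Y) (far F X Y f))\<rparr>"

definition functors_equal :: "('o1, 'h1) cat \<Rightarrow> ('o2, 'h2) cat \<Rightarrow> ('o1, 'h1, 'o2, 'h2) ftor \<Rightarrow>
    ('o1, 'h1, 'o2, 'h2) ftor \<Rightarrow> bool" where
  "functors_equal K L F F' \<longleftrightarrow> is_functor K L F \<and> is_functor K L F' \<and>
     (\<forall>X\<in>Ob K. fob F X = fob F' X) \<and>
     (\<forall>X\<in>Ob K. \<forall>Y\<in>Ob K. \<forall>f\<in>Hom K X Y. far F X Y f = far F' X Y f)"


section \<open>The four categories\<close>

text \<open>
  The objects of each category have carriers (or families of carriers) inside one arbitrary type; the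
  functors below change this type, for example from \<open>'m\<close> to \<open>'g \<Rightarrow> 'm\<close>.
\<close>

definition comod_cat :: "('g, 'x) monoid_scheme \<Rightarrow> ('a, 'y) ring_scheme \<Rightarrow> ('g, 'a, 'c) coring \<Rightarrow>
    (('g, 'a, 'm, 'c) comod, 'm \<Rightarrow> 'm) cat" where
  "comod_cat G A C = \<lparr>
     Ob = {M. comodule G A C M},
     Hom = (\<lambda>M N. {f \<in> rhom A M N \<inter> extensional (carrier M).
        \<forall>\<alpha>\<in>carrier G. \<forall>m\<in>carrier M.
          coact N \<alpha> (f m) = tmap A N (cmod C \<alpha>) f (\<lambda>z. z) (coact M \<alpha> m)}),
     Ident = (\<lambda>M. \<lambda>m\<in>carrier M. m),
     Comp = (\<lambda>L M N g f. compose (carrier L) g f)\<rparr>"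

definition gcomod_cat :: "('g, 'x) monoid_scheme \<Rightarrow> ('a, 'y) ring_scheme \<Rightarrow> ('g, 'a, 'c) coring \<Rightarrow>
    (('g, 'a, 'm, 'c) gcomod, 'g \<Rightarrow> 'm \<Rightarrow> 'm) cat" where
  "gcomod_cat G A C = \<lparr>
     Ob = {M. gcomodule G A C M},
     Hom = (\<lambda>M N. {f \<in> (\<Pi>\<^sub>E \<alpha>\<in>carrier G.
            rhom A (gmod M \<alpha>) (gmod N \<alpha>) \<inter> extensional (carrier (gmod M \<alpha>))).
        \<forall>\<alpha>\<in>carrier G. \<forall>\<beta>\<in>carrier G. \<forall>m\<in>carrier (gmod M (\<alpha> \<otimes>\<^bsub>G\<^esub> \<beta>)).
          tmap A (gmod N \<alpha>) (cmod C \<beta>) (f \<alpha>) (\<lambda>z. z) (gcoact M \<alpha> \<beta> m) =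
          gcoact N \<alpha> \<beta> (f (\<alpha> \<otimes>\<^bsub>G\<^esub> \<beta>) m)}),
     Ident = (\<lambda>M. \<lambda>\<alpha>\<in>carrier G. \<lambda>m\<in>carrier (gmod M \<alpha>). m),
     Comp = (\<lambda>L M N g f. \<lambda>\<alpha>\<in>carrier G. compose (carrier (gmod L \<alpha>)) (g \<alpha>) (f \<alpha>))\<rparr>"

definition rmod_cat :: "('r, 'y) ring_scheme \<Rightarrow> (('r, 'm) rmod, 'm \<Rightarrow> 'm) cat" where
  "rmod_cat R = \<lparr>
     Ob = {M. right_module R M},
     Hom = (\<lambda>M N. rhom R M N \<inter> extensional (carrier M)),
     Ident = (\<lambda>M. \<lambda>m\<in>carrier M. m),
     Comp = (\<lambda>L M N g f. compose (carrier L) g f)\<rparr>"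

definition grmod_cat :: "('g, 'x) monoid_scheme \<Rightarrow> ('r, 'y) ring_scheme \<Rightarrow> ('g \<Rightarrow> 'r set) \<Rightarrow>
    (('g, 'r, 'm) grmod, 'm \<Rightarrow> 'm) cat" where
  "grmod_cat G R RR = \<lparr>
     Ob = {M. graded_right_module G R RR M},
     Hom = (\<lambda>M N. {f \<in> rhom R M N \<inter> extensional (carrier M).
        \<forall>\<alpha>\<in>carrier G. f ` grade M \<alpha> \<subseteq> grade N \<alpha>}),
     Ident = (\<lambda>M. \<lambda>m\<in>carrier M. m),
     Comp = (\<lambda>L M N g f. compose (carrier L) g f)\<rparr>"


section \<open>The six functors\<close>

text \<open>
  On objects the functors are compared by equality of records, so the \<open>R\<close>-actions they construct are
  restricted to the carriers.
\<close>

text \<open>The copy \<open>\<mu>\<^sub>\<alpha>(M)\<close> is \<open>{\<alpha>} \<times> M\<close>, with \<open>\<mu>\<^sub>\<alpha>(m) = (\<alpha>, m)\<close>.\<close>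

definition mu :: "'g \<Rightarrow> ('a, 'm, 'x) rmod_scheme \<Rightarrow> ('a, 'g \<times> 'm) rmod" where
  "mu \<alpha> M = \<lparr>carrier = Pair \<alpha> ` carrier M, monoid.mult = undefined, one = undefined,
     zero = (\<alpha>, \<zero>\<^bsub>M\<^esub>), add = (\<lambda>x y. (\<alpha>, snd x \<oplus>\<^bsub>M\<^esub> snd y)),
     ract = (\<lambda>x a. (\<alpha>, snd x \<triangleleft>\<^bsub>M\<^esub> a))\<rparr>"

definition dsum_map :: "'i set \<Rightarrow> ('i \<Rightarrow> ('m, 'x) ring_scheme) \<Rightarrow> ('i \<Rightarrow> 'm \<Rightarrow> 'n) \<Rightarrow>
    ('i \<Rightarrow> 'm) \<Rightarrow> 'i \<Rightarrow> 'n" where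
  "dsum_map I M f = (\<lambda>x\<in>carrier (dsum I M). \<lambda>i\<in>I. f i (x i))"

text \<open>\<open>contract M f\<close> sends \<open>m \<otimes> c\<close> to \<open>m f(c)\<close>.\<close>

definition contract :: "('a, 'm, 'x) rmod_scheme \<Rightarrow> ('c \<Rightarrow> 'a) \<Rightarrow> ('m, 'c) tens \<Rightarrow> 'm" where
  "contract M f = tlift M (\<lambda>m c. m \<triangleleft>\<^bsub>M\<^esub> f c)"

definition F1 :: "('g, 'x) monoid_scheme \<Rightarrow> ('a, 'y) ring_scheme \<Rightarrow> ('g, 'a, 'c) coring \<Rightarrow>
    (('g, 'a, 'm, 'c) gcomod, 'g \<Rightarrow> 'm \<Rightarrow> 'm,
     ('g, 'a, 'g \<Rightarrow> 'm, 'c) comod, ('g \<Rightarrow> 'm) \<Rightarrow> 'g \<Rightarrow> 'm) ftor" where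
  "F1 G A C = \<lparr>
     fob = (\<lambda>M. let S = dsum_mod (carrier G) (gmod M) in
       rmod.extend S (comod.fields (\<lambda>\<alpha> x.
         \<Oplus>\<^bsub>tensor_group A S (cmod C \<alpha>)\<^esub>\<beta>\<in>dsupp (carrier G) (gmod M) x.
           tmap A S (cmod C \<alpha>) (dinj (carrier G) (gmod M) (\<beta> \<otimes>\<^bsub>G\<^esub> inv\<^bsub>G\<^esub> \<alpha>)) (\<lambda>z. z)
             (gcoact M (\<beta> \<otimes>\<^bsub>G\<^esub> inv\<^bsub>G\<^esub> \<alpha>) \<alpha> (x \<beta>))))),
     far = (\<lambda>M N f. dsum_map (carrier G) (gmod M) f)\<rparr>"

definition G1 :: "('g, 'x) monoid_scheme \<Rightarrow> ('a, 'y) ring_scheme \<Rightarrow> ('g, 'a, 'c) coring \<Rightarrow>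
    (('g, 'a, 'm, 'c) comod, 'm \<Rightarrow> 'm,
     ('g, 'a, 'g \<times> 'm, 'c) gcomod, 'g \<Rightarrow> 'g \<times> 'm \<Rightarrow> 'g \<times> 'm) ftor" where
  "G1 G A C = \<lparr>
     fob = (\<lambda>M. \<lparr>gmod = (\<lambda>\<alpha>. mu \<alpha> (rmod.truncate M)),
       gcoact = (\<lambda>\<alpha> \<beta> x. tmap A (mu \<alpha> M) (cmod C \<beta>) (Pair \<alpha>) (\<lambda>z. z) (coact M \<beta> (snd x)))\<rparr>),
     far = (\<lambda>M N f. \<lambda>\<alpha>\<in>carrier G. \<lambda>x\<in>carrier (mu \<alpha> M). (\<alpha>, f (snd x)))\<rparr>"

definition F3 :: "('g, 'x) monoid_scheme \<Rightarrow> ('a, 'y) ring_scheme \<Rightarrow> ('g, 'a, 'c) coring \<Rightarrow>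
    (('g, 'a, 'm, 'c) gcomod, 'g \<Rightarrow> 'm \<Rightarrow> 'm,
     ('g, 'g \<Rightarrow> 'c \<Rightarrow> 'a, 'g \<Rightarrow> 'm) grmod, ('g \<Rightarrow> 'm) \<Rightarrow> 'g \<Rightarrow> 'm) ftor" where
  "F3 G A C = \<lparr>
     fob = (\<lambda>M. let S = dsum (carrier G) (gmod M) in
       rmod.extend
         (with_ract S (\<lambda>x\<in>carrier S. \<lambda>r\<in>carrier (dual_ring G A C).
           dext G (gmod M) (dual_comp G A C) (gmod M)
             (\<lambda>\<alpha> \<beta> m f. contract (gmod M (\<alpha> \<otimes>\<^bsub>G\<^esub> \<beta>)) f (gcoact M (\<alpha> \<otimes>\<^bsub>G\<^esub> \<beta>) (inv\<^bsub>G\<^esub> \<beta>) m)) x r))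
         (grmod.fields (dpart (carrier G) (gmod M)))),
     far = (\<lambda>M N f. dsum_map (carrier G) (gmod M) f)\<rparr>"

definition F4 :: "('g, 'x) monoid_scheme \<Rightarrow> ('a, 'y) ring_scheme \<Rightarrow> ('g, 'a, 'c) coring \<Rightarrow>
    (('g, 'a, 'm, 'c) comod, 'm \<Rightarrow> 'm, ('g \<Rightarrow> 'c \<Rightarrow> 'a, 'm) rmod, 'm \<Rightarrow> 'm) ftor" where
  "F4 G A C = \<lparr>
     fob = (\<lambda>M. with_ract M (\<lambda>m\<in>carrier M. \<lambda>r\<in>carrier (dual_ring G A C).
       \<Oplus>\<^bsub>M\<^esub>\<beta>\<in>dsupp (carrier G) (dual_comp G A C) r. contract M (r \<beta>) (coact M (inv\<^bsub>G\<^esub> \<beta>) m))),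
     far = (\<lambda>M N f. f)\<rparr>"

definition F5 :: "(('g, 'r, 'm) grmod, 'm \<Rightarrow> 'm, ('r, 'm) rmod, 'm \<Rightarrow> 'm) ftor" where
  "F5 = \<lparr>fob = (\<lambda>M. rmod.truncate M), far = (\<lambda>M N f. f)\<rparr>"

definition G5 :: "('g, 'x) monoid_scheme \<Rightarrow> ('a, 'y) ring_scheme \<Rightarrow> ('g, 'a, 'c) coring \<Rightarrow>
    (('g \<Rightarrow> 'c \<Rightarrow> 'a, 'm) rmod, 'm \<Rightarrow> 'm,
     ('g, 'g \<Rightarrow> 'c \<Rightarrow> 'a, 'g \<Rightarrow> 'g \<times> 'm) grmod,
     ('g \<Rightarrow> 'g \<times> 'm) \<Rightarrow> 'g \<Rightarrow> 'g \<times> 'm) ftor" where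
  "G5 G A C = \<lparr>
     fob = (\<lambda>M. let N = (\<lambda>\<alpha>. mu \<alpha> M); S = dsum (carrier G) N in
       rmod.extend
         (with_ract S (\<lambda>x\<in>carrier S. \<lambda>r\<in>carrier (dual_ring G A C).
           dext G N (dual_comp G A C) N
             (\<lambda>\<alpha> \<beta> m f. (\<alpha> \<otimes>\<^bsub>G\<^esub> \<beta>, snd m \<triangleleft>\<^bsub>M\<^esub> dinj (carrier G) (dual_comp G A C) \<beta> f)) x r))
         (grmod.fields (dpart (carrier G) N))),
     far = (\<lambda>M N f. dsum_map (carrier G) (\<lambda>\<alpha>. mu \<alpha> M) (\<lambda>\<alpha> x. (\<alpha>, f (snd x))))\<rparr>"

end

theory Submission
  imports Defs
begin

text \<open>
  All the structures involved are additive, so every identity needs to be checked on generators only: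
  on pure tensors, and on homogeneous elements of direct sums (\<open>tensor_eqI\<close>, \<open>dsum_eqI\<close>).  On such
  elements the square commutes by inspection.  For \<open>m\<close> in \<open>M\<^sub>\<alpha>\<close> and \<open>f\<close> in \<open>R\<^sub>\<beta>\<close>, both composites
  \<open>F5 \<circ>\<^sub>F F3\<close> and \<open>F4 \<circ>\<^sub>F F1\<close> send \<open>(m, f)\<close> to \<open>m\<^sub>0 f(m\<^sub>1)\<close>, placed in the summand of degree
  \<open>\<alpha>\<beta>\<close>: the coaction of \<open>F1\<close> is the coaction of the graded comodule followed by the inclusion of a
  summand, and an \<open>A\<close>-linear map commutes with the contraction \<open>m \<otimes> c \<mapsto> m f(c)\<close>
  (\<open>contract_tmap\<close>).  The other square is the same computation with the map \<open>\<mu>\<^sub>\<alpha>\<close> instead of the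
  inclusion.  On morphisms the composites are given by the same formula.

  The substance of the proof is that the six constructions are functors between these categories, and
  above all that \<open>R\<close> is a ring which acts on comodules.  The mixed associativity
  \<open>(m \<cdot> f) \<cdot> g = m \<cdot> (f # g)\<close> is coassociativity of the coaction with \<open>f\<close> and \<open>g\<close> contracted into
  the two tensor factors (\<open>contract_contract\<close>).  Associativity of \<open>R\<close> is an instance: the coring is a
  comodule over itself, and \<open>f # g\<close> is the map \<open>c \<mapsto> g(c \<cdot> f)\<close> (\<open>dual_mult_eq\<close>).  Products and
  actions on direct sums inherit associativity from their homogeneous components (\<open>dext_assoc\<close>).

  For \<open>F1\<close> and \<open>G1\<close> the new coactions arise from the given ones along \<open>A\<close>-linear maps \<open>j\<close>, the
  inclusions of the summands and the maps \<open>\<mu>\<^sub>\<alpha>\<close>; coassociativity and counitality are carried along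
  by naturality of the associator and of contraction (\<open>coassoc_transport\<close>, \<open>counit_transport\<close>).
\<close>

section \<open>Additive maps\<close>

text \<open>
  Tensor products and direct sums are handled as abelian groups first; linearity, over \<open>A\<close> or over
  the dual ring, is added where it is needed.
\<close>

definition ahom :: "('m, 'x) ring_scheme \<Rightarrow> ('n, 'y) ring_scheme \<Rightarrow> ('m \<Rightarrow> 'n) set" where
  "ahom M N = {f \<in> carrier M \<rightarrow> carrier N.
     \<forall>x\<in>carrier M. \<forall>y\<in>carrier M. f (x \<oplus>\<^bsub>M\<^esub> y) = f x \<oplus>\<^bsub>N\<^esub> f y}"

lemma ahomI:
  assumes "\<And>x. x \<in> carrier M \<Longrightarrow> f x \<in> carrier N"
    and "\<And>x y. \<lbrakk>x \<in> carrier M; y \<in> carrier M\<rbrakk> \<Longrightarrow> f (x \<oplus>\<^bsub>M\<^esub> y) = f x \<oplus>\<^bsub>N\<^esub> f y"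
  shows "f \<in> ahom M N"
  using assms by (auto simp: ahom_def)

lemma ahom_closed: "\<lbrakk>f \<in> ahom M N; x \<in> carrier M\<rbrakk> \<Longrightarrow> f x \<in> carrier N"
  by (auto simp: ahom_def)

lemma ahom_add:
  "\<lbrakk>f \<in> ahom M N; x \<in> carrier M; y \<in> carrier M\<rbrakk> \<Longrightarrow> f (x \<oplus>\<^bsub>M\<^esub> y) = f x \<oplus>\<^bsub>N\<^esub> f y"
  by (auto simp: ahom_def)

lemma ahom_cong:
  "\<lbrakk>f \<in> ahom M N; \<And>x. x \<in> carrier M \<Longrightarrow> f x = g x; abelian_group M\<rbrakk> \<Longrightarrow> g \<in> ahom M N"
  by (rule ahomI) (metis ahom_closed ahom_add abelian_groupE(1))+

lemma ahom_comp: "\<lbrakk>g \<in> ahom M N; f \<in> ahom L M\<rbrakk> \<Longrightarrow> (\<lambda>x. g (f x)) \<in> ahom L N"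
  by (auto simp: ahom_def Pi_def)

lemma ahom_id: "(\<lambda>x. x) \<in> ahom M M"
  by (auto simp: ahom_def)

lemma ahom_zero:
  assumes "abelian_group M" "abelian_group N" "f \<in> ahom M N"
  shows "f \<zero>\<^bsub>M\<^esub> = \<zero>\<^bsub>N\<^esub>"
proof -
  interpret M: abelian_group M by fact
  interpret N: abelian_group N by fact
  have "f \<zero>\<^bsub>M\<^esub> \<oplus>\<^bsub>N\<^esub> f \<zero>\<^bsub>M\<^esub> = f \<zero>\<^bsub>M\<^esub> \<oplus>\<^bsub>N\<^esub> \<zero>\<^bsub>N\<^esub>"
    using ahom_add[OF assms(3), of "\<zero>\<^bsub>M\<^esub>" "\<zero>\<^bsub>M\<^esub>"] ahom_closed[OF assms(3)] by simp
  then show ?thesis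
    using ahom_closed[OF assms(3)] by simp
qed

lemma ahom_neg:
  assumes "abelian_group M" "abelian_group N" "f \<in> ahom M N" "x \<in> carrier M"
  shows "f (\<ominus>\<^bsub>M\<^esub> x) = \<ominus>\<^bsub>N\<^esub> f x"
proof -
  interpret M: abelian_group M by fact
  interpret N: abelian_group N by fact
  have "f (\<ominus>\<^bsub>M\<^esub> x) \<oplus>\<^bsub>N\<^esub> f x = \<zero>\<^bsub>N\<^esub>"
    using ahom_add[OF assms(3), of "\<ominus>\<^bsub>M\<^esub> x" x] assms(4) ahom_zero[OF assms(1-3)]
    by (simp add: M.l_neg)
  then show ?thesis
    using N.minus_equality ahom_closed[OF assms(3)] assms(4) M.a_inv_closed by metis
qed

lemma ahom_finsum:
  assumes "abelian_group M" "abelian_group N" "h \<in> ahom M N" "f \<in> I \<rightarrow> carrier M"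
  shows "h (\<Oplus>\<^bsub>M\<^esub>i\<in>I. f i) = (\<Oplus>\<^bsub>N\<^esub>i\<in>I. h (f i))"
proof -
  interpret M: abelian_group M by fact
  interpret N: abelian_group N by fact
  show ?thesis
    using assms(4)
  proof (induction I rule: infinite_finite_induct)
    case (insert i I)
    then have "f \<in> I \<rightarrow> carrier M" "f i \<in> carrier M" "(\<lambda>i. h (f i)) \<in> I \<rightarrow> carrier N" "h (f i) \<in> carrier N"
      using ahom_closed[OF assms(3)] by (auto simp: Pi_def)
    then show ?case
      using insert ahom_add[OF assms(3)] by (simp add: M.finsum_closed)
  qed (simp_all add: ahom_zero[OF assms(1-3)])
qed

lemma rhom_ahom: "f \<in> rhom A M N \<Longrightarrow> f \<in> ahom M N"
  by (auto simp: rhom_def ahom_def)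

lemma rhom_ract: "\<lbrakk>f \<in> rhom A M N; x \<in> carrier M; a \<in> carrier A\<rbrakk> \<Longrightarrow> f (x \<triangleleft>\<^bsub>M\<^esub> a) = f x \<triangleleft>\<^bsub>N\<^esub> a"
  by (auto simp: rhom_def)

lemma rhomI:
  assumes "f \<in> ahom M N"
    and "\<And>x a. \<lbrakk>x \<in> carrier M; a \<in> carrier A\<rbrakk> \<Longrightarrow> f (x \<triangleleft>\<^bsub>M\<^esub> a) = f x \<triangleleft>\<^bsub>N\<^esub> a"
  shows "f \<in> rhom A M N"
  using assms by (auto simp: rhom_def ahom_def)

lemma rhom_comp: "\<lbrakk>g \<in> rhom A M N; f \<in> rhom A L M\<rbrakk> \<Longrightarrow> (\<lambda>x. g (f x)) \<in> rhom A L N"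
  by (auto simp: rhom_def Pi_def)

lemma rhom_id: "(\<lambda>x. x) \<in> rhom A M M"
  by (auto simp: rhom_def)

lemma lhom_ahom: "f \<in> lhom A M N \<Longrightarrow> f \<in> ahom M N"
  by (auto simp: lhom_def ahom_def)

lemma lhom_lact: "\<lbrakk>f \<in> lhom A M N; x \<in> carrier M; a \<in> carrier A\<rbrakk> \<Longrightarrow> f (a \<triangleright>\<^bsub>M\<^esub> x) = a \<triangleright>\<^bsub>N\<^esub> f x"
  by (auto simp: lhom_def)

lemma lhomI:
  assumes "f \<in> ahom M N"
    and "\<And>x a. \<lbrakk>x \<in> carrier M; a \<in> carrier A\<rbrakk> \<Longrightarrow> f (a \<triangleright>\<^bsub>M\<^esub> x) = a \<triangleright>\<^bsub>N\<^esub> f x"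
  shows "f \<in> lhom A M N"
  using assms by (auto simp: lhom_def ahom_def)

lemma lhom_id: "(\<lambda>x. x) \<in> lhom A M M"
  by (auto simp: lhom_def)

lemma right_module_abelian_group: "right_module A M \<Longrightarrow> abelian_group M"
  by (simp add: right_module_def)

lemma rhom_cong:
  assumes f: "f \<in> rhom A M N" and g: "\<And>x. x \<in> carrier M \<Longrightarrow> f x = g x" and M: "right_module A M"
  shows "g \<in> rhom A M N"
proof (rule rhomI)
  show "g \<in> ahom M N"
    by (rule ahom_cong[OF rhom_ahom[OF f] g right_module_abelian_group[OF M]])
  show "g (x \<triangleleft>\<^bsub>M\<^esub> a) = g x \<triangleleft>\<^bsub>N\<^esub> a" if "x \<in> carrier M" "a \<in> carrier A" for x a
    using rhom_ract[OF f that] g[OF that(1)] g[OF right_module.ract_closed[OF M that]] by simp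
qed

lemma right_module_ring: "right_module A M \<Longrightarrow> ring A"
  by (simp add: right_module_def)

lemma bimodule_right_module: "bimodule A M \<Longrightarrow> right_module A M"
  by (simp add: bimodule_def)

lemma ahom_ract:
  "\<lbrakk>right_module A M; a \<in> carrier A\<rbrakk> \<Longrightarrow> (\<lambda>x. x \<triangleleft>\<^bsub>M\<^esub> a) \<in> ahom M M"
  by (rule ahomI) (simp_all add: right_module.ract_closed right_module.ract_add_left)

lemma ahom_pointwise_add:
  assumes "abelian_group N" "f \<in> ahom M N" "g \<in> ahom M N"
  shows "(\<lambda>x. f x \<oplus>\<^bsub>N\<^esub> g x) \<in> ahom M N"
proof -
  interpret N: abelian_group N by fact
  show ?thesis
    by (rule ahomI)
      (auto simp: ahom_add[OF assms(2)] ahom_add[OF assms(3)] ahom_closed[OF assms(2)]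
        ahom_closed[OF assms(3)] N.a_ac)
qed

definition biadditive :: "('m, 'x) ring_scheme \<Rightarrow> ('n, 'y) ring_scheme \<Rightarrow> ('p, 'z) ring_scheme \<Rightarrow>
    ('m \<Rightarrow> 'n \<Rightarrow> 'p) \<Rightarrow> bool" where
  "biadditive M N P b \<longleftrightarrow>
     (\<forall>n\<in>carrier N. (\<lambda>m. b m n) \<in> ahom M P) \<and> (\<forall>m\<in>carrier M. b m \<in> ahom N P)"

lemma biadditive_left: "\<lbrakk>biadditive M N P b; n \<in> carrier N\<rbrakk> \<Longrightarrow> (\<lambda>m. b m n) \<in> ahom M P"
  by (simp add: biadditive_def)

lemma biadditive_right: "\<lbrakk>biadditive M N P b; m \<in> carrier M\<rbrakk> \<Longrightarrow> b m \<in> ahom N P"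
  by (simp add: biadditive_def)

lemma biadditive_closed:
  "\<lbrakk>biadditive M N P b; m \<in> carrier M; n \<in> carrier N\<rbrakk> \<Longrightarrow> b m n \<in> carrier P"
  by (auto simp: biadditive_def intro: ahom_closed)

lemma biadditive_add_left:
  "\<lbrakk>biadditive M N P b; x \<in> carrier M; y \<in> carrier M; n \<in> carrier N\<rbrakk> \<Longrightarrow>
   b (x \<oplus>\<^bsub>M\<^esub> y) n = b x n \<oplus>\<^bsub>P\<^esub> b y n"
  unfolding biadditive_def by (blast dest: ahom_add)

lemma biadditive_add_right:
  "\<lbrakk>biadditive M N P b; m \<in> carrier M; x \<in> carrier N; y \<in> carrier N\<rbrakk> \<Longrightarrow>
   b m (x \<oplus>\<^bsub>N\<^esub> y) = b m x \<oplus>\<^bsub>P\<^esub> b m y"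
  by (simp add: biadditive_def ahom_add)

lemma add_ring_simps [simp]:
  "carrier (add_ring H) = carrier H" "zero (add_ring H) = \<one>\<^bsub>H\<^esub>" "add (add_ring H) = monoid.mult H"
  by (simp_all add: add_ring_def)

lemma with_ract_simps [simp]:
  "carrier (with_ract B act) = carrier B" "zero (with_ract B act) = zero B"
  "add (with_ract B act) = add B" "ract (with_ract B act) = act"
  by (simp_all add: with_ract_def)

lemma abelian_group_add_ring:
  assumes "comm_group H" shows "abelian_group (add_ring H)"
proof -
  interpret comm_group H by fact
  show ?thesis
    by (rule abelian_groupI) (auto simp: m_assoc intro: m_comm l_inv_ex)
qed

text \<open>
  Modules, comodules and graded modules are records that share their additive fields.  This rule and the
  next move facts along such a change of record.
\<close>

lemma abelian_group_transfer:
  assumes "abelian_group X" "carrier Y = carrier X" "add Y = add X" "zero Y = zero X"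
  shows "abelian_group Y"
  by (rule abelian_groupI; unfold assms(2-4)) (fact abelian_groupE[OF assms(1)])+

lemma finsum_transfer:
  assumes "carrier Y = carrier X" "add Y = add X" "zero Y = zero X"
  shows "finsum Y f I = finsum X f I"
  by (simp add: finsum_def finprod_def assms)

section \<open>Tensor products\<close>

lemma tensor_simps [simp]:
  "carrier (tensor A M N) = carrier (tensor_group A M N)"
  "zero (tensor A M N) = zero (tensor_group A M N)"
  "add (tensor A M N) = add (tensor_group A M N)"
  by (simp_all add: tensor_def)

lemma btensor_simps [simp]:
  "carrier (btensor A M N) = carrier (tensor_group A M N)"
  "zero (btensor A M N) = zero (tensor_group A M N)"
  "add (btensor A M N) = add (tensor_group A M N)"
  "ract (btensor A M N) = ract (tensor A M N)"
  by (simp_all add: btensor_def rmod.defs bimod.defs)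

lemma ahom_tensor_simps [simp]:
  "ahom (tensor A M N) H = ahom (tensor_group A M N) H"
  "ahom H (tensor A M N) = ahom H (tensor_group A M N)"
  "ahom (btensor A M' N) H = ahom (tensor_group A M' N) H"
  "ahom H (btensor A M' N) = ahom H (tensor_group A M' N)"
  by (simp_all add: ahom_def)

text \<open>
  The hypothesis of the universal property of the tensor product.
\<close>

definition balanced :: "('a, 'x) ring_scheme \<Rightarrow> ('a, 'm, 'y) rmod_scheme \<Rightarrow> ('a, 'n, 'z) bimod_scheme \<Rightarrow>
    ('h, 'w) ring_scheme \<Rightarrow> ('m \<Rightarrow> 'n \<Rightarrow> 'h) \<Rightarrow> bool" where
  "balanced A M N H b \<longleftrightarrow> biadditive M N H b \<and>
     (\<forall>m\<in>carrier M. \<forall>a\<in>carrier A. \<forall>n\<in>carrier N. b (m \<triangleleft>\<^bsub>M\<^esub> a) n = b m (a \<triangleright>\<^bsub>N\<^esub> n))"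

lemma balancedI:
  assumes "\<And>n. n \<in> carrier N \<Longrightarrow> (\<lambda>m. b m n) \<in> ahom M H"
    and "\<And>m. m \<in> carrier M \<Longrightarrow> b m \<in> ahom N H"
    and "\<And>m a n. \<lbrakk>m \<in> carrier M; a \<in> carrier A; n \<in> carrier N\<rbrakk> \<Longrightarrow> b (m \<triangleleft>\<^bsub>M\<^esub> a) n = b m (a \<triangleright>\<^bsub>N\<^esub> n)"
  shows "balanced A M N H b"
  using assms by (auto simp: balanced_def biadditive_def)

lemma balanced_biadditive: "balanced A M N H b \<Longrightarrow> biadditive M N H b"
  by (simp add: balanced_def)

text \<open>
  The extension of \<open>b\<close> to the free abelian group, in the form in which \<open>tlift\<close> evaluates a
  representative.
\<close>

definition frag_eval :: "('h, 'w) ring_scheme \<Rightarrow> ('p \<Rightarrow> 'h) \<Rightarrow> ('p \<Rightarrow>\<^sub>0 int) \<Rightarrow> 'h" where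
  "frag_eval H b c = (\<Oplus>\<^bsub>H\<^esub>p\<in>Poly_Mapping.keys c. [Poly_Mapping.lookup c p] \<cdot>\<^bsub>H\<^esub> b p)"

context abelian_group
begin

text \<open>
  Sums over different supports can be compared only over a common finite index set.
\<close>

lemma frag_eval_superset:
  assumes "finite S" "Poly_Mapping.keys c \<subseteq> S" "b \<in> S \<rightarrow> carrier G"
  shows "frag_eval G b c = (\<Oplus>p\<in>S. [Poly_Mapping.lookup c p] \<cdot> b p)"
  unfolding frag_eval_def
proof (rule add.finprod_mono_neutral_cong_left)
  show "(\<lambda>p. [Poly_Mapping.lookup c p] \<cdot> b p) \<in> S \<rightarrow> carrier G"
    using assms by (auto intro: add.int_pow_closed)
  show "[Poly_Mapping.lookup c p] \<cdot> b p = \<zero>" if "p \<in> S - Poly_Mapping.keys c" for p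
    using that by (simp add: in_keys_iff add_pow_def)
qed (use assms in auto)

lemma frag_eval_frag_of:
  "b p \<in> carrier G \<Longrightarrow> frag_eval G b (frag_of p) = b p"
  by (simp add: frag_eval_def)

lemma frag_eval_hom:
  assumes b: "b \<in> S \<rightarrow> carrier G"
  shows "frag_eval G b \<in> hom (free_Abelian_group S) (add_monoid G)"
proof (rule homI)
  fix c assume "c \<in> carrier (free_Abelian_group S)"
  then show "frag_eval G b c \<in> carrier (add_monoid G)"
    using b by (auto simp: frag_eval_def Pi_def intro!: finsum_closed add.int_pow_closed)
next
  fix c d assume cd: "c \<in> carrier (free_Abelian_group S)" "d \<in> carrier (free_Abelian_group S)"
  let ?T = "Poly_Mapping.keys c \<union> Poly_Mapping.keys d"
  have T: "?T \<subseteq> S" using cd by auto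
  have bT: "b \<in> ?T \<rightarrow> carrier G" using b T by auto
  have bC: "\<And>p. p \<in> ?T \<Longrightarrow> b p \<in> carrier G" using bT by auto
  have "frag_eval G b (c + d) = (\<Oplus>p\<in>?T. [Poly_Mapping.lookup (c + d) p] \<cdot> b p)"
    by (rule frag_eval_superset[OF _ _ bT]) (use keys_add[of c d] in auto)
  also have "\<dots> = (\<Oplus>p\<in>?T. [Poly_Mapping.lookup c p] \<cdot> b p \<oplus> [Poly_Mapping.lookup d p] \<cdot> b p)"
    using bC by (intro finsum_cong) (auto simp: lookup_add add.int_pow_mult simp_implies_def Pi_def intro: add.int_pow_closed)
  also have "\<dots> = frag_eval G b c \<oplus> frag_eval G b d"
    using frag_eval_superset[OF _ _ bT, of c] frag_eval_superset[OF _ _ bT, of d] bC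
    by (subst finsum_addf) (auto intro: add.int_pow_closed)
  finally show "frag_eval G b (c \<otimes>\<^bsub>free_Abelian_group S\<^esub> d) = frag_eval G b c \<otimes>\<^bsub>add_monoid G\<^esub> frag_eval G b d"
    by simp
qed

end

locale tensor_pair =
  fixes A :: "('a, 'x) ring_scheme" and M :: "('a, 'm, 'y) rmod_scheme"
    and N :: "('a, 'n, 'z) bimod_scheme"
  assumes left: "right_module A M" and right: "bimodule A N"
begin

abbreviation F where "F \<equiv> free_Abelian_group (carrier M \<times> carrier N)"
abbreviation K where "K \<equiv> tensor_kernel A M N"
abbreviation T where "T \<equiv> tensor_group A M N"

sublocale M: right_module A M by (rule left)
sublocale N: bimodule A N by (rule right)
sublocale F: comm_group F by (rule abelian_free_Abelian_group)

lemma relators_subset: "tensor_relators A M N \<subseteq> carrier F"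
proof -
  have d2: "frag_of p - frag_of q \<in> carrier F"
    if "p \<in> carrier M \<times> carrier N" "q \<in> carrier M \<times> carrier N" for p q
    using that keys_diff[of "frag_of p" "frag_of q"] by auto
  have d3: "frag_of p - frag_of q - frag_of r \<in> carrier F"
    if "p \<in> carrier M \<times> carrier N" "q \<in> carrier M \<times> carrier N" "r \<in> carrier M \<times> carrier N" for p q r
    using d2[OF that(1,2)] that(3) keys_diff[of "frag_of p - frag_of q" "frag_of r"] by auto
  show ?thesis
    unfolding tensor_relators_def
    by (auto simp del: carrier_free_Abelian_group_iff simp: M.ract_closed N.lact_closed intro!: d2 d3)
qed

lemma K_subgroup: "subgroup K F"
  unfolding tensor_kernel_def by (rule F.generate_is_subgroup[OF relators_subset])

lemma K_normal: "K \<lhd> F"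
  by (rule F.subgroup_imp_normal[OF K_subgroup])

lemma abelian_group_T: "abelian_group T"
  unfolding tensor_group_def by (intro abelian_group_add_ring F.abelian_FactGroup K_subgroup)

lemma carrier_T: "carrier T = (\<lambda>c. K #>\<^bsub>F\<^esub> c) ` carrier F"
  by (auto simp: tensor_group_def FactGroup_def RCOSETS_def)

lemma zero_T: "\<zero>\<^bsub>T\<^esub> = K #>\<^bsub>F\<^esub> 0"
  using F.coset_mult_one[OF subgroup.subset[OF K_subgroup]]
  by (simp add: tensor_group_def FactGroup_def)

lemma add_T:
  "\<lbrakk>c \<in> carrier F; d \<in> carrier F\<rbrakk> \<Longrightarrow> (K #>\<^bsub>F\<^esub> c) \<oplus>\<^bsub>T\<^esub> (K #>\<^bsub>F\<^esub> d) = K #>\<^bsub>F\<^esub> (c + d)"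
  using normal.rcos_sum[OF K_normal] by (simp add: tensor_group_def FactGroup_def)

lemma coset_eqI:
  assumes "c \<in> carrier F" "d \<in> carrier F" "c - d \<in> K"
  shows "K #>\<^bsub>F\<^esub> c = K #>\<^bsub>F\<^esub> d"
proof (rule F.repr_independence[symmetric, OF _ _ K_subgroup])
  show "c \<in> K #>\<^bsub>F\<^esub> d"
    unfolding r_coset_def using assms by (force intro!: bexI[of _ "c - d"])
qed (use assms in auto)

lemma ptens_closed: "\<lbrakk>m \<in> carrier M; n \<in> carrier N\<rbrakk> \<Longrightarrow> ptens A M N m n \<in> carrier T"
  by (auto simp: ptens_def carrier_T)

lemma relator_in_K: "r \<in> tensor_relators A M N \<Longrightarrow> r \<in> K"
  unfolding tensor_kernel_def by (rule generate.incl)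

lemma ptens_add_left:
  assumes "x \<in> carrier M" "y \<in> carrier M" "n \<in> carrier N"
  shows "ptens A M N (x \<oplus>\<^bsub>M\<^esub> y) n = ptens A M N x n \<oplus>\<^bsub>T\<^esub> ptens A M N y n"
proof -
  have "frag_of (x \<oplus>\<^bsub>M\<^esub> y, n) - (frag_of (x, n) + frag_of (y, n)) \<in> K"
    using assms by (intro relator_in_K) (auto simp: tensor_relators_def diff_diff_eq)
  then show ?thesis
    using assms keys_add[of "frag_of (x, n)" "frag_of (y, n)"]
    by (simp add: ptens_def add_T) (rule coset_eqI, auto)
qed

lemma ptens_add_right:
  assumes "x \<in> carrier M" "n \<in> carrier N" "p \<in> carrier N"
  shows "ptens A M N x (n \<oplus>\<^bsub>N\<^esub> p) = ptens A M N x n \<oplus>\<^bsub>T\<^esub> ptens A M N x p"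
proof -
  have "frag_of (x, n \<oplus>\<^bsub>N\<^esub> p) - (frag_of (x, n) + frag_of (x, p)) \<in> K"
    using assms by (intro relator_in_K) (auto simp: tensor_relators_def diff_diff_eq)
  then show ?thesis
    using assms keys_add[of "frag_of (x, n)" "frag_of (x, p)"]
    by (simp add: ptens_def add_T) (rule coset_eqI, auto)
qed

lemma ptens_balanced:
  assumes "x \<in> carrier M" "a \<in> carrier A" "n \<in> carrier N"
  shows "ptens A M N (x \<triangleleft>\<^bsub>M\<^esub> a) n = ptens A M N x (a \<triangleright>\<^bsub>N\<^esub> n)"
proof -
  have "frag_of (x \<triangleleft>\<^bsub>M\<^esub> a, n) - frag_of (x, a \<triangleright>\<^bsub>N\<^esub> n) \<in> K"
    using assms by (intro relator_in_K) (auto simp: tensor_relators_def)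
  then show ?thesis
    using assms by (simp add: ptens_def) (rule coset_eqI, auto simp: M.ract_closed N.lact_closed)
qed

lemma balanced_ptens: "balanced A M N T (ptens A M N)"
  by (rule balancedI) (auto intro!: ahomI simp: ptens_closed ptens_add_left ptens_add_right ptens_balanced)

text \<open>
  The free abelian group is generated by its basis under differences, and these reduce to sums because
  \<open>-(m \<otimes> n) = (-m) \<otimes> n\<close>.
\<close>

lemma tensor_induct [consumes 1, case_names zero add ptens]:
  assumes t: "t \<in> carrier T" and zero: "P \<zero>\<^bsub>T\<^esub>"
    and add: "\<And>x y. \<lbrakk>x \<in> carrier T; y \<in> carrier T; P x; P y\<rbrakk> \<Longrightarrow> P (x \<oplus>\<^bsub>T\<^esub> y)"
    and ptens: "\<And>m n. \<lbrakk>m \<in> carrier M; n \<in> carrier N\<rbrakk> \<Longrightarrow> P (ptens A M N m n)"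
  shows "P t"
proof -
  obtain c where c: "c \<in> carrier F" "t = K #>\<^bsub>F\<^esub> c" using t carrier_T by auto
  interpret T: abelian_group T by (rule abelian_group_T)
  \<comment> \<open>The statement for \<open>- c\<close> is what the step for differences uses of its second argument.\<close>
  have "P (K #>\<^bsub>F\<^esub> c) \<and> P (K #>\<^bsub>F\<^esub> (- c))"
    using c(1)[simplified]
  proof (rule free_Abelian_group_induct)
    show "P (K #>\<^bsub>F\<^esub> 0) \<and> P (K #>\<^bsub>F\<^esub> (- 0))"
      using zero by (simp add: zero_T)
  next
    fix x y :: "'m \<times> 'n \<Rightarrow>\<^sub>0 int"
    assume 2: "Poly_Mapping.keys x \<subseteq> carrier M \<times> carrier N" "Poly_Mapping.keys y \<subseteq> carrier M \<times> carrier N"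
      "P (K #>\<^bsub>F\<^esub> x) \<and> P (K #>\<^bsub>F\<^esub> (- x))" "P (K #>\<^bsub>F\<^esub> y) \<and> P (K #>\<^bsub>F\<^esub> (- y))"
    have "P ((K #>\<^bsub>F\<^esub> x) \<oplus>\<^bsub>T\<^esub> (K #>\<^bsub>F\<^esub> (- y)))" "P ((K #>\<^bsub>F\<^esub> (- x)) \<oplus>\<^bsub>T\<^esub> (K #>\<^bsub>F\<^esub> y))"
      using 2 by (auto intro!: add simp: carrier_T)
    then show "P (K #>\<^bsub>F\<^esub> (x - y)) \<and> P (K #>\<^bsub>F\<^esub> (- (x - y)))"
      using 2 by (simp add: add_T)
  next
    fix p assume 3: "p \<in> carrier M \<times> carrier N"
    then obtain m n where p: "p = (m, n)" "m \<in> carrier M" "n \<in> carrier N" by auto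
    have h: "(\<lambda>m. ptens A M N m n) \<in> ahom M T"
      using p balanced_biadditive[OF balanced_ptens] by (simp add: biadditive_left)
    have "\<ominus>\<^bsub>T\<^esub> ptens A M N m n = K #>\<^bsub>F\<^esub> (- frag_of p)"
    proof (rule T.minus_equality)
      show "(K #>\<^bsub>F\<^esub> (- frag_of p)) \<oplus>\<^bsub>T\<^esub> ptens A M N m n = \<zero>\<^bsub>T\<^esub>"
        using 3 p by (simp add: ptens_def add_T zero_T)
    qed (use 3 p in \<open>auto simp: ptens_def carrier_T\<close>)
    then have "K #>\<^bsub>F\<^esub> (- frag_of p) = ptens A M N (\<ominus>\<^bsub>M\<^esub> m) n"
      using ahom_neg[OF M.abelian_group_axioms abelian_group_T h] p by simp
    moreover have "K #>\<^bsub>F\<^esub> frag_of p = ptens A M N m n" by (simp add: p ptens_def)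
    ultimately show "P (K #>\<^bsub>F\<^esub> frag_of p) \<and> P (K #>\<^bsub>F\<^esub> (- frag_of p))"
      using ptens p by simp
  qed
  then show ?thesis using c by simp
qed

text \<open>
  Evaluation kills the three kinds of relators, hence the kernel that they generate, so it is constant
  on cosets and \<open>the_elem\<close> returns its common value.
\<close>

lemma tlift_coset:
  assumes H: "abelian_group H" and b: "balanced A M N H b" and c: "c \<in> carrier F"
  shows "tlift H b (K #>\<^bsub>F\<^esub> c) = frag_eval H (\<lambda>p. b (fst p) (snd p)) c"
proof -
  interpret H: abelian_group H by fact
  let ?b = "\<lambda>p. b (fst p) (snd p)" and ?e = "frag_eval H (\<lambda>p. b (fst p) (snd p))"
  have bC: "?b \<in> carrier M \<times> carrier N \<rightarrow> carrier H"
    using biadditive_closed[OF balanced_biadditive[OF b]] by auto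
  interpret e: group_hom F "add_monoid H" ?e
    by unfold_locales (rule H.frag_eval_hom[OF bC])
  have inv: "?e (u - v) = ?e u \<ominus>\<^bsub>H\<^esub> ?e v" if "u \<in> carrier F" "v \<in> carrier F" for u v
    using that e.hom_mult[of u "- v"] e.hom_inv[of v] by (simp add: a_minus_def a_inv_def)
  have of: "?e (frag_of (m, n)) = b m n" if "m \<in> carrier M" "n \<in> carrier N" for m n
    using that biadditive_closed[OF balanced_biadditive[OF b]] by (subst H.frag_eval_frag_of) auto
  have minus3: "?e (u - v - w) = ?e u \<ominus>\<^bsub>H\<^esub> ?e v \<ominus>\<^bsub>H\<^esub> ?e w"
    if "u \<in> carrier F" "v \<in> carrier F" "w \<in> carrier F" for u v w
    using that inv[of "u - v" w] inv[of u v] keys_diff[of u v] by auto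
  have canc: "(x \<oplus>\<^bsub>H\<^esub> y) \<ominus>\<^bsub>H\<^esub> x \<ominus>\<^bsub>H\<^esub> y = \<zero>\<^bsub>H\<^esub>" if "x \<in> carrier H" "y \<in> carrier H" for x y
    using that H.r_neg[of "x \<oplus>\<^bsub>H\<^esub> y"] by (simp add: a_minus_def H.a_assoc H.minus_add)
  have "K \<subseteq> kernel F (add_monoid H) ?e"
    unfolding tensor_kernel_def
  proof (rule F.generate_subgroup_incl[OF _ e.subgroup_kernel])
    have "?e r = \<zero>\<^bsub>H\<^esub>" if "r \<in> tensor_relators A M N" for r
      using that unfolding tensor_relators_def Un_iff
    proof (elim disjE)
      assume "r \<in> {frag_of (x \<oplus>\<^bsub>M\<^esub> y, n) - frag_of (x, n) - frag_of (y, n) | x y n.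
        x \<in> carrier M \<and> y \<in> carrier M \<and> n \<in> carrier N}"
      then show ?thesis
        by (auto simp: minus3 of biadditive_add_left[OF balanced_biadditive[OF b]] biadditive_add_right[OF balanced_biadditive[OF b]] intro!: canc intro: biadditive_closed[OF balanced_biadditive[OF b]])
    next
      assume "r \<in> {frag_of (x, n \<oplus>\<^bsub>N\<^esub> p) - frag_of (x, n) - frag_of (x, p) | x n p.
        x \<in> carrier M \<and> n \<in> carrier N \<and> p \<in> carrier N}"
      then show ?thesis
        by (auto simp: minus3 of biadditive_add_left[OF balanced_biadditive[OF b]] biadditive_add_right[OF balanced_biadditive[OF b]] intro!: canc intro: biadditive_closed[OF balanced_biadditive[OF b]])
    next
      assume "r \<in> {frag_of (x \<triangleleft>\<^bsub>M\<^esub> a, n) - frag_of (x, a \<triangleright>\<^bsub>N\<^esub> n) | x a n.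
        x \<in> carrier M \<and> a \<in> carrier A \<and> n \<in> carrier N}"
      then show ?thesis
        using b by (auto simp: inv of M.ract_closed N.lact_closed balanced_def a_minus_def H.r_neg
            M.ract_closed N.lact_closed biadditive_closed[OF balanced_biadditive[OF b]])
    qed
    then show "tensor_relators A M N \<subseteq> kernel F (add_monoid H) ?e"
      using relators_subset unfolding kernel_def subset_iff mem_Collect_eq by simp
  qed
  then have K0: "?e k = \<zero>\<^bsub>H\<^esub>" if "k \<in> K" for k
    using that by (auto simp: kernel_def)
  have "?e d = ?e c" if d: "d \<in> K #>\<^bsub>F\<^esub> c" for d
  proof -
    obtain k where k: "k \<in> K" "d = k + c"
      using d by (auto simp: r_coset_def)
    moreover have "k \<in> carrier F" using k subgroup.subset[OF K_subgroup] by blast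
    ultimately show ?thesis
      using e.hom_mult[of k c] e.hom_closed[of c] K0[of k] c by simp
  qed
  moreover have "c \<in> K #>\<^bsub>F\<^esub> c"
    using F.rcos_self[OF c K_subgroup] .
  ultimately have "?e ` (K #>\<^bsub>F\<^esub> c) = {?e c}" by blast
  then show ?thesis
    by (simp add: tlift_def frag_eval_def)
qed

lemma tlift_ptens:
  assumes "abelian_group H" "balanced A M N H b" "m \<in> carrier M" "n \<in> carrier N"
  shows "tlift H b (ptens A M N m n) = b m n"
proof -
  have "b m n \<in> carrier H"
    using biadditive_closed[OF balanced_biadditive[OF assms(2)]] assms by auto
  then show ?thesis
    using tlift_coset[OF assms(1,2), of "frag_of (m, n)"] assms(3,4)
    by (simp add: ptens_def abelian_group.frag_eval_frag_of[OF assms(1)])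
qed

lemma tlift_ahom:
  assumes "abelian_group H" "balanced A M N H b"
  shows "tlift H b \<in> ahom T H"
proof -
  have "(\<lambda>p. b (fst p) (snd p)) \<in> carrier M \<times> carrier N \<rightarrow> carrier H"
    using biadditive_closed[OF balanced_biadditive[OF assms(2)]] assms by auto
  note e = abelian_group.frag_eval_hom[OF assms(1) this]
  show ?thesis
  proof (rule ahomI)
    fix t assume "t \<in> carrier T"
    then show "tlift H b t \<in> carrier H"
      using hom_in_carrier[OF e] tlift_coset[OF assms] by (auto simp: carrier_T)
  next
    fix s t assume "s \<in> carrier T" "t \<in> carrier T"
    then obtain c d where "c \<in> carrier F" "d \<in> carrier F" "s = K #>\<^bsub>F\<^esub> c" "t = K #>\<^bsub>F\<^esub> d"
      by (auto simp: carrier_T)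
    then show "tlift H b (s \<oplus>\<^bsub>T\<^esub> t) = tlift H b s \<oplus>\<^bsub>H\<^esub> tlift H b t"
      using hom_mult[OF e] F.m_closed[of c d] by (simp add: add_T tlift_coset[OF assms])
  qed
qed

text \<open>
  The uniqueness half of the universal property; nearly every identity below is reduced to pure tensors
  by it.
\<close>

lemma tensor_eqI:
  assumes "abelian_group H" "f \<in> ahom T H" "g \<in> ahom T H" "t \<in> carrier T"
    and "\<And>m n. \<lbrakk>m \<in> carrier M; n \<in> carrier N\<rbrakk> \<Longrightarrow> f (ptens A M N m n) = g (ptens A M N m n)"
  shows "f t = g t"
  using assms(4)
  by (induction t rule: tensor_induct)
    (auto simp: ahom_zero[OF abelian_group_T assms(1)] assms(2,3,5) ahom_add[OF assms(2)] ahom_add[OF assms(3)])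

lemma balanced_ract:
  assumes "a \<in> carrier A"
  shows "balanced A M N T (\<lambda>m n. ptens A M N m (n \<triangleleft>\<^bsub>N\<^esub> a))"
  by (rule balancedI)
    (use assms in \<open>auto intro!: ahomI simp: ptens_closed ptens_add_left ptens_add_right ptens_balanced
       N.ract_closed N.ract_add_left N.lact_ract\<close>)

lemma tensor_ract_ahom: "a \<in> carrier A \<Longrightarrow> (\<lambda>t. t \<triangleleft>\<^bsub>tensor A M N\<^esub> a) \<in> ahom T T"
  using tlift_ahom[OF abelian_group_T balanced_ract] by (simp add: tensor_def)

lemma tensor_ract_ptens:
  "\<lbrakk>m \<in> carrier M; n \<in> carrier N; a \<in> carrier A\<rbrakk> \<Longrightarrow>
   ptens A M N m n \<triangleleft>\<^bsub>tensor A M N\<^esub> a = ptens A M N m (n \<triangleleft>\<^bsub>N\<^esub> a)"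
  using tlift_ptens[OF abelian_group_T balanced_ract] by (simp add: tensor_def)

lemma tensor_right_module: "right_module A (tensor A M N)"
proof -
  interpret T: abelian_group T by (rule abelian_group_T)
  interpret tT: abelian_group "tensor A M N"
    by (rule abelian_group_transfer[OF abelian_group_T]) simp_all
  note ag = abelian_group_T and h = tensor_ract_ahom
  have "t \<triangleleft>\<^bsub>tensor A M N\<^esub> (a \<oplus>\<^bsub>A\<^esub> b) = t \<triangleleft>\<^bsub>tensor A M N\<^esub> a \<oplus>\<^bsub>T\<^esub> t \<triangleleft>\<^bsub>tensor A M N\<^esub> b"
    if "t \<in> carrier T" "a \<in> carrier A" "b \<in> carrier A" for t a b
    by (rule tensor_eqI[OF ag h ahom_pointwise_add[OF ag h h]])
      (use that in \<open>auto simp: tensor_ract_ptens N.ract_add_right N.ract_closed ptens_add_right\<close>)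
  moreover have "t \<triangleleft>\<^bsub>tensor A M N\<^esub> (a \<otimes>\<^bsub>A\<^esub> b) = (t \<triangleleft>\<^bsub>tensor A M N\<^esub> a) \<triangleleft>\<^bsub>tensor A M N\<^esub> b"
    if "t \<in> carrier T" "a \<in> carrier A" "b \<in> carrier A" for t a b
    by (rule tensor_eqI[OF ag h ahom_comp[OF h h]])
      (use that in \<open>auto simp: tensor_ract_ptens N.ract_mult N.ract_closed\<close>)
  moreover have "t \<triangleleft>\<^bsub>tensor A M N\<^esub> \<one>\<^bsub>A\<^esub> = t" if "t \<in> carrier T" for t
    by (rule tensor_eqI[OF ag h ahom_id]) (use that in \<open>auto simp: tensor_ract_ptens N.ract_one\<close>)
  ultimately show ?thesis
    using ahom_closed[OF h] ahom_add[OF h]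
    by unfold_locales auto
qed

end

lemma
  fixes M :: "('a, 'm, 'y) bimod_scheme"
  assumes "bimodule A M" "bimodule A N"
  shows btensor_lact_ahom: "\<And>a. a \<in> carrier A \<Longrightarrow> (\<lambda>t. a \<triangleright>\<^bsub>btensor A M N\<^esub> t) \<in> ahom (tensor_group A M N) (tensor_group A M N)"
    and btensor_lact_ptens: "\<And>a m n. \<lbrakk>a \<in> carrier A; m \<in> carrier M; n \<in> carrier N\<rbrakk> \<Longrightarrow>
       a \<triangleright>\<^bsub>btensor A M N\<^esub> ptens A M N m n = ptens A M N (a \<triangleright>\<^bsub>M\<^esub> m) n"
    and btensor_bimodule: "bimodule A (btensor A M N)"
proof -
  interpret M: bimodule A M by fact
  interpret tensor_pair A M N
    by (rule tensor_pair.intro[OF bimodule_right_module[OF assms(1)] assms(2)])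
  interpret T: abelian_group T by (rule abelian_group_T)
  have b: "balanced A M N T (\<lambda>m n. ptens A M N (a \<triangleright>\<^bsub>M\<^esub> m) n)" if "a \<in> carrier A" for a
    by (rule balancedI)
      (use that in \<open>auto intro!: ahomI simp: ptens_closed ptens_add_left ptens_add_right
         M.lact_closed M.ract_closed M.lact_add_right M.lact_ract[symmetric] ptens_balanced\<close>)
  show h: "(\<lambda>t. a \<triangleright>\<^bsub>btensor A M N\<^esub> t) \<in> ahom T T" if "a \<in> carrier A" for a
    using tlift_ahom[OF abelian_group_T b[OF that]] by (simp add: btensor_def rmod.defs bimod.defs)
  show p: "a \<triangleright>\<^bsub>btensor A M N\<^esub> ptens A M N m n = ptens A M N (a \<triangleright>\<^bsub>M\<^esub> m) n"
    if "a \<in> carrier A" "m \<in> carrier M" "n \<in> carrier N" for a m n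
    using tlift_ptens[OF abelian_group_T b[OF that(1)] that(2,3)] by (simp add: btensor_def rmod.defs bimod.defs)
  interpret t: right_module A "tensor A M N" by (rule tensor_right_module)
  interpret bt: abelian_group "btensor A M N"
    by (rule abelian_group_transfer[OF abelian_group_T]) simp_all
  note ag = abelian_group_T and r = tensor_ract_ahom
  have "(a \<oplus>\<^bsub>A\<^esub> b) \<triangleright>\<^bsub>btensor A M N\<^esub> t = (a \<triangleright>\<^bsub>btensor A M N\<^esub> t) \<oplus>\<^bsub>T\<^esub> (b \<triangleright>\<^bsub>btensor A M N\<^esub> t)"
    if "t \<in> carrier T" "a \<in> carrier A" "b \<in> carrier A" for t a b
    by (rule tensor_eqI[OF ag h ahom_pointwise_add[OF ag h h]])
      (use that in \<open>auto simp: p M.lact_add_left M.lact_closed ptens_add_left\<close>)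
  moreover have "(a \<otimes>\<^bsub>A\<^esub> b) \<triangleright>\<^bsub>btensor A M N\<^esub> t = a \<triangleright>\<^bsub>btensor A M N\<^esub> (b \<triangleright>\<^bsub>btensor A M N\<^esub> t)"
    if "t \<in> carrier T" "a \<in> carrier A" "b \<in> carrier A" for t a b
    by (rule tensor_eqI[OF ag h ahom_comp[OF h h]])
      (use that in \<open>auto simp: p M.lact_mult M.lact_closed\<close>)
  moreover have "\<one>\<^bsub>A\<^esub> \<triangleright>\<^bsub>btensor A M N\<^esub> t = t" if "t \<in> carrier T" for t
    by (rule tensor_eqI[OF ag h ahom_id]) (use that in \<open>auto simp: p M.lact_one\<close>)
  moreover have "(a \<triangleright>\<^bsub>btensor A M N\<^esub> t) \<triangleleft>\<^bsub>tensor A M N\<^esub> b = a \<triangleright>\<^bsub>btensor A M N\<^esub> (t \<triangleleft>\<^bsub>tensor A M N\<^esub> b)"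
    if "t \<in> carrier T" "a \<in> carrier A" "b \<in> carrier A" for t a b
    by (rule tensor_eqI[OF ag ahom_comp[OF r h] ahom_comp[OF h r]])
      (use that in \<open>auto simp: p tensor_ract_ptens M.lact_closed N.ract_closed\<close>)
  ultimately show "bimodule A (btensor A M N)"
    using ahom_closed[OF h] ahom_add[OF h] t.ract_closed t.ract_add_left t.ract_add_right t.ract_mult t.ract_one
    by unfold_locales auto
qed

text \<open>
  The tensor product depends on the additive group and the right action of its left factor only.  The
  functors extend and truncate module records, and these rules remove the difference.
\<close>

lemma tensor_group_cong:
  "\<lbrakk>carrier M = carrier M'; add M = add M'; ract M = ract M'\<rbrakk> \<Longrightarrow> tensor_group A M N = tensor_group A M' N"
  by (simp add: tensor_group_def tensor_kernel_def tensor_relators_def)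

lemma ptens_cong:
  "\<lbrakk>carrier M = carrier M'; add M = add M'; ract M = ract M'\<rbrakk> \<Longrightarrow> ptens A M N = ptens A M' N"
  by (simp add: fun_eq_iff ptens_def tensor_kernel_def tensor_relators_def)

lemma tmap_cong:
  "\<lbrakk>carrier M = carrier M'; add M = add M'; ract M = ract M'\<rbrakk> \<Longrightarrow> tmap A M N = tmap A M' N"
  by (simp add: fun_eq_iff tmap_def tensor_group_cong[of M M'] ptens_cong[of M M'])

lemma regular_simps [simp]:
  "carrier (regular A) = carrier A" "zero (regular A) = zero A" "add (regular A) = add A"
  "ract (regular A) = monoid.mult A" "lact (regular A) = monoid.mult A"
  by (simp_all add: regular_def with_ract_def rmod.defs bimod.defs)

lemma regular_bimodule:
  assumes "ring A" shows "bimodule A (regular A)"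
proof -
  interpret A: ring A by fact
  interpret R: abelian_group "regular A"
    by (rule abelian_group_transfer[OF A.abelian_group_axioms]) simp_all
  show ?thesis
    by unfold_locales (auto simp: A.l_distr A.r_distr A.m_assoc)
qed

section \<open>Canonical maps\<close>

lemma tmap_balanced:
  assumes MN: "tensor_pair A M N" and MN': "tensor_pair A M' N'"
    and f: "f \<in> rhom A M M'" and g: "g \<in> lhom A N N'"
  shows "balanced A M N (tensor_group A M' N') (\<lambda>m n. ptens A M' N' (f m) (g n))"
proof -
  interpret MN: tensor_pair A M N by fact
  interpret MN': tensor_pair A M' N' by fact
  note fa = rhom_ahom[OF f] and ga = lhom_ahom[OF g]
  show ?thesis
    by (rule balancedI)
      (auto intro!: ahomI simp: MN'.ptens_closed MN'.ptens_add_left MN'.ptens_add_right MN'.ptens_balanced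
        ahom_add[OF fa] ahom_add[OF ga] ahom_closed[OF fa] ahom_closed[OF ga] rhom_ract[OF f] lhom_lact[OF g])
qed

lemma tmap_ahom:
  assumes "tensor_pair A M N" "tensor_pair A M' N'" "f \<in> rhom A M M'" "g \<in> lhom A N N'"
  shows "tmap A M' N' f g \<in> ahom (tensor_group A M N) (tensor_group A M' N')"
  unfolding tmap_def
  by (rule tensor_pair.tlift_ahom[OF assms(1) tensor_pair.abelian_group_T[OF assms(2)] tmap_balanced[OF assms]])

lemma tmap_ptens:
  assumes "tensor_pair A M N" "tensor_pair A M' N'" "f \<in> rhom A M M'" "g \<in> lhom A N N'"
    "m \<in> carrier M" "n \<in> carrier N"
  shows "tmap A M' N' f g (ptens A M N m n) = ptens A M' N' (f m) (g n)"
  unfolding tmap_def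
  by (rule tensor_pair.tlift_ptens[OF assms(1) tensor_pair.abelian_group_T[OF assms(2)]
        tmap_balanced[OF assms(1-4)] assms(5,6)])

lemma tmap_rhom:
  assumes "tensor_pair A M N" "tensor_pair A M' N'" "f \<in> rhom A M M'" "g \<in> lhom A N N'" "g \<in> rhom A N N'"
  shows "tmap A M' N' f g \<in> rhom A (tensor A M N) (tensor A M' N')"
proof (rule rhomI)
  interpret MN: tensor_pair A M N by fact
  interpret MN': tensor_pair A M' N' by fact
  note h = tmap_ahom[OF assms(1-4)] and p = tmap_ptens[OF assms(1-4)]
  show "tmap A M' N' f g \<in> ahom (tensor A M N) (tensor A M' N')" using h by simp
  note fc = ahom_closed[OF rhom_ahom[OF assms(3)]] and gc = ahom_closed[OF lhom_ahom[OF assms(4)]]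
  fix t a assume t: "t \<in> carrier (tensor A M N)" and a: "a \<in> carrier A"
  show "tmap A M' N' f g (t \<triangleleft>\<^bsub>tensor A M N\<^esub> a) = tmap A M' N' f g t \<triangleleft>\<^bsub>tensor A M' N'\<^esub> a"
    by (rule MN.tensor_eqI[OF MN'.abelian_group_T ahom_comp[OF h MN.tensor_ract_ahom]
          ahom_comp[OF MN'.tensor_ract_ahom h]])
      (use t a in \<open>simp_all add: p MN.tensor_ract_ptens MN'.tensor_ract_ptens MN.N.ract_closed
         rhom_ract[OF assms(5)] fc gc\<close>)
qed

text \<open>
  The map \<open>f \<otimes> g\<close> depends on the values of \<open>f\<close> and \<open>g\<close> on the carriers only, which lets restricted
  functions be replaced by unrestricted ones.
\<close>

lemma tmap_cong_fun:
  assumes "tensor_pair A M N" "tensor_pair A M' N'" "f \<in> rhom A M M'" "g \<in> lhom A N N'"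
    "\<And>m. m \<in> carrier M \<Longrightarrow> f m = f' m" "\<And>n. n \<in> carrier N \<Longrightarrow> g n = g' n"
    "t \<in> carrier (tensor_group A M N)"
  shows "tmap A M' N' f g t = tmap A M' N' f' g' t"
proof -
  interpret MN: tensor_pair A M N by fact
  have f': "f' \<in> rhom A M M'"
    by (rule rhom_cong[OF assms(3,5) MN.left])
  have g': "g' \<in> lhom A N N'"
    using assms(4,6) MN.N.a_closed MN.N.lact_closed by (simp add: lhom_def Pi_def)
  show ?thesis
    by (rule MN.tensor_eqI[OF tensor_pair.abelian_group_T[OF assms(2)] tmap_ahom[OF assms(1-4)]
          tmap_ahom[OF assms(1,2) f' g'] assms(7)])
      (simp add: tmap_ptens[OF assms(1-4)] tmap_ptens[OF assms(1,2) f' g'] assms(5,6))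
qed

lemma tmap_tmap:
  assumes "tensor_pair A L P" "tensor_pair A M Q" "tensor_pair A N R"
    and f: "f \<in> rhom A L M" and g: "g \<in> lhom A P Q" and f': "f' \<in> rhom A M N" and g': "g' \<in> lhom A Q R"
    and t: "t \<in> carrier (tensor_group A L P)"
  shows "tmap A N R f' g' (tmap A M Q f g t) = tmap A N R (\<lambda>x. f' (f x)) (\<lambda>x. g' (g x)) t"
proof -
  have gg: "(\<lambda>x. g' (g x)) \<in> lhom A P R"
    using g g' by (auto simp: lhom_def Pi_def)
  note ff = rhom_comp[OF f' f]
  note p = tmap_ptens[OF assms(1,2) f g] tmap_ptens[OF assms(2,3) f' g'] tmap_ptens[OF assms(1,3) ff gg]
  show ?thesis
    by (rule tensor_pair.tensor_eqI[OF assms(1) tensor_pair.abelian_group_T[OF assms(3)]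
          ahom_comp[OF tmap_ahom[OF assms(2,3) f' g'] tmap_ahom[OF assms(1,2) f g]]
          tmap_ahom[OF assms(1,3) ff gg] t])
      (simp add: p ahom_closed[OF rhom_ahom[OF f]] ahom_closed[OF lhom_ahom[OF g]])
qed

lemma tmap_id:
  assumes "tensor_pair A M N" "t \<in> carrier (tensor_group A M N)"
  shows "tmap A M N (\<lambda>x. x) (\<lambda>x. x) t = t"
  by (rule tensor_pair.tensor_eqI[OF assms(1) tensor_pair.abelian_group_T[OF assms(1)]
        tmap_ahom[OF assms(1,1) rhom_id lhom_id] ahom_id assms(2)])
    (simp add: tmap_ptens[OF assms(1,1) rhom_id lhom_id])

text \<open>
  Left linearity of \<open>f\<close> is what makes \<open>m \<otimes> c \<mapsto> m f(c)\<close> well defined.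
\<close>

lemma balanced_contract:
  assumes "tensor_pair A M N" and f: "f \<in> lhom A N (regular A)"
  shows "balanced A M N M (\<lambda>m c. m \<triangleleft>\<^bsub>M\<^esub> f c)"
proof -
  interpret tensor_pair A M N by fact
  have fc: "\<And>n. n \<in> carrier N \<Longrightarrow> f n \<in> carrier A"
    using ahom_closed[OF lhom_ahom[OF f]] by simp
  have "\<And>a n. \<lbrakk>a \<in> carrier A; n \<in> carrier N\<rbrakk> \<Longrightarrow> f (a \<triangleright>\<^bsub>N\<^esub> n) = a \<otimes>\<^bsub>A\<^esub> f n"
    using lhom_lact[OF f] by simp
  then show ?thesis
    using ahom_add[OF lhom_ahom[OF f]]
    by (intro balancedI) (auto intro!: ahomI simp: fc M.ract_closed M.ract_add_left M.ract_add_right M.ract_mult)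
qed

lemma contract_ahom:
  assumes "tensor_pair A M N" "f \<in> lhom A N (regular A)"
  shows "contract M f \<in> ahom (tensor_group A M N) M"
  unfolding contract_def
  using assms by (intro tensor_pair.tlift_ahom balanced_contract) (auto dest: tensor_pair.left right_module_abelian_group)

lemma contract_ptens:
  assumes "tensor_pair A M N" "f \<in> lhom A N (regular A)" "m \<in> carrier M" "n \<in> carrier N"
  shows "contract M f (ptens A M N m n) = m \<triangleleft>\<^bsub>M\<^esub> f n"
  unfolding contract_def
  using assms by (intro tensor_pair.tlift_ptens balanced_contract) (auto dest: tensor_pair.left right_module_abelian_group)

text \<open>
  The canonical map \<open>M \<otimes> A \<rightarrow> M\<close> is contraction with the identity of \<open>A\<close>.  Therefore counitality of a
  coaction says that contraction with the counit returns \<open>m\<close>.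
\<close>

lemma runit_eq_contract: "runit M = contract M (\<lambda>a. a)"
  by (simp add: runit_def contract_def)

text \<open>
  The associator is defined by a nested use of \<open>tlift\<close>.  The inner map is treated first, for a fixed
  element \<open>p\<close> of the third factor.
\<close>

lemma tassoc_inner:
  assumes "right_module A M" "bimodule A N" "bimodule A P" and p: "p \<in> carrier P"
  defines "T \<equiv> tensor_group A M (btensor A N P)"
  shows "tlift T (\<lambda>m n. ptens A M (btensor A N P) m (ptens A N P n p)) \<in> ahom (tensor_group A M N) T"
    and "\<And>m n. \<lbrakk>m \<in> carrier M; n \<in> carrier N\<rbrakk> \<Longrightarrow>
      tlift T (\<lambda>m n. ptens A M (btensor A N P) m (ptens A N P n p)) (ptens A M N m n) =
      ptens A M (btensor A N P) m (ptens A N P n p)"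
proof -
  interpret MN: tensor_pair A M N by (rule tensor_pair.intro[OF assms(1,2)])
  interpret NP: tensor_pair A N P by (rule tensor_pair.intro[OF bimodule_right_module[OF assms(2)] assms(3)])
  interpret X: tensor_pair A M "btensor A N P"
    by (rule tensor_pair.intro[OF assms(1) btensor_bimodule[OF assms(2,3)]])
  have b: "balanced A M N T (\<lambda>m n. ptens A M (btensor A N P) m (ptens A N P n p))"
    unfolding T_def
    by (rule balancedI)
      (auto intro!: ahomI simp: p X.ptens_closed NP.ptens_closed X.ptens_add_left X.ptens_balanced
        NP.ptens_add_left X.ptens_add_right[simplified] btensor_lact_ptens[OF assms(2,3)])
  note ag = X.abelian_group_T[folded T_def]
  show "tlift T (\<lambda>m n. ptens A M (btensor A N P) m (ptens A N P n p)) \<in> ahom (tensor_group A M N) T"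
    by (rule MN.tlift_ahom[OF ag b])
  show "tlift T (\<lambda>m n. ptens A M (btensor A N P) m (ptens A N P n p)) (ptens A M N m n) =
      ptens A M (btensor A N P) m (ptens A N P n p)" if "m \<in> carrier M" "n \<in> carrier N" for m n
    by (rule MN.tlift_ptens[OF ag b that])
qed

lemma tassoc_balanced:
  assumes "right_module A M" "bimodule A N" "bimodule A P"
  defines "T \<equiv> tensor_group A M (btensor A N P)"
  shows "balanced A (tensor A M N) P T
    (\<lambda>t p. tlift T (\<lambda>m n. ptens A M (btensor A N P) m (ptens A N P n p)) t)"
proof -
  interpret MN: tensor_pair A M N by (rule tensor_pair.intro[OF assms(1,2)])
  interpret NP: tensor_pair A N P by (rule tensor_pair.intro[OF bimodule_right_module[OF assms(2)] assms(3)])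
  interpret X: tensor_pair A M "btensor A N P"
    by (rule tensor_pair.intro[OF assms(1) btensor_bimodule[OF assms(2,3)]])
  note h = tassoc_inner(1)[OF assms(1-3), folded T_def]
    and pt = tassoc_inner(2)[OF assms(1-3), folded T_def]
  note ag = X.abelian_group_T[folded T_def]
  show ?thesis
  proof (rule balancedI)
    fix p assume "p \<in> carrier P"
    then show "(\<lambda>t. tlift T (\<lambda>m n. ptens A M (btensor A N P) m (ptens A N P n p)) t) \<in> ahom (tensor A M N) T"
      using h by simp
  next
    fix t assume t: "t \<in> carrier (tensor A M N)"
    have "tlift T (\<lambda>m n. ptens A M (btensor A N P) m (ptens A N P n (p \<oplus>\<^bsub>P\<^esub> q))) t =
       tlift T (\<lambda>m n. ptens A M (btensor A N P) m (ptens A N P n p)) t \<oplus>\<^bsub>T\<^esub>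
       tlift T (\<lambda>m n. ptens A M (btensor A N P) m (ptens A N P n q)) t"
      if "p \<in> carrier P" "q \<in> carrier P" for p q
      by (rule MN.tensor_eqI[OF ag h ahom_pointwise_add[OF ag h h]])
        (use that t in \<open>auto simp: pt NP.ptens_add_right NP.ptens_closed X.ptens_add_right[unfolded btensor_simps, folded T_def]\<close>)
    then show "(\<lambda>p. tlift T (\<lambda>m n. ptens A M (btensor A N P) m (ptens A N P n p)) t) \<in> ahom P T"
      using ahom_closed[OF h] t by (intro ahomI) auto
  next
    fix t a p assume *: "t \<in> carrier (tensor A M N)" "a \<in> carrier A" "p \<in> carrier P"
    show "tlift T (\<lambda>m n. ptens A M (btensor A N P) m (ptens A N P n p)) (t \<triangleleft>\<^bsub>tensor A M N\<^esub> a) =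
      tlift T (\<lambda>m n. ptens A M (btensor A N P) m (ptens A N P n (a \<triangleright>\<^bsub>P\<^esub> p))) t"
      by (rule MN.tensor_eqI[OF ag ahom_comp[OF h MN.tensor_ract_ahom] h])
        (use * in \<open>auto simp: pt MN.tensor_ract_ptens NP.ptens_balanced MN.N.ract_closed NP.N.lact_closed\<close>)
  qed
qed

lemma
  assumes M: "right_module A M" and N: "bimodule A N" and P: "bimodule A P"
  shows tassoc_ahom: "tassoc A M N P \<in> ahom (tensor_group A (tensor A M N) P) (tensor_group A M (btensor A N P))"
    and tassoc_ptens: "\<And>m n p. \<lbrakk>m \<in> carrier M; n \<in> carrier N; p \<in> carrier P\<rbrakk> \<Longrightarrow>
      tassoc A M N P (ptens A (tensor A M N) P (ptens A M N m n) p) =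
      ptens A M (btensor A N P) m (ptens A N P n p)"
proof -
  interpret MN: tensor_pair A M N by (rule tensor_pair.intro[OF M N])
  interpret X: tensor_pair A M "btensor A N P" by (rule tensor_pair.intro[OF M btensor_bimodule[OF N P]])
  interpret Y: tensor_pair A "tensor A M N" P by (rule tensor_pair.intro[OF MN.tensor_right_module P])
  note b = tassoc_balanced[OF M N P]
  show "tassoc A M N P \<in> ahom (tensor_group A (tensor A M N) P) (tensor_group A M (btensor A N P))"
    unfolding tassoc_def Let_def by (rule Y.tlift_ahom[OF X.abelian_group_T b])
  fix m n p assume *: "m \<in> carrier M" "n \<in> carrier N" "p \<in> carrier P"
  then have "ptens A M N m n \<in> carrier (tensor A M N)"
    by (simp add: MN.ptens_closed)
  from Y.tlift_ptens[OF X.abelian_group_T b this *(3)]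
  show "tassoc A M N P (ptens A (tensor A M N) P (ptens A M N m n) p) =
      ptens A M (btensor A N P) m (ptens A N P n p)"
    unfolding tassoc_def Let_def using tassoc_inner(2)[OF M N P *(3,1,2)] by simp
qed

section \<open>Direct sums\<close>

lemma (in abelian_monoid) finsum_eq_add:
  assumes "\<And>q. q \<in> J \<Longrightarrow> h q = f q \<oplus> g q" "f \<in> J \<rightarrow> carrier G" "g \<in> J \<rightarrow> carrier G"
  shows "(\<Oplus>q\<in>J. h q) = (\<Oplus>q\<in>J. f q) \<oplus> (\<Oplus>q\<in>J. g q)"
proof -
  have "(\<Oplus>q\<in>J. h q) = (\<Oplus>q\<in>J. f q \<oplus> g q)"
    using assms by (intro finsum_cong') auto
  then show ?thesis by (simp add: finsum_addf[OF assms(2,3)])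
qed

locale dsum_family =
  fixes I :: "'i set" and M :: "'i \<Rightarrow> ('m, 'x) ring_scheme"
  assumes summand: "i \<in> I \<Longrightarrow> abelian_group (M i)"
begin

abbreviation S where "S \<equiv> dsum I M"

lemma group_summand: "i \<in> I \<Longrightarrow> group (add_monoid (M i))"
  using abelian_group.a_group[OF summand] .

lemma carrier_S: "carrier S = {x \<in> \<Pi>\<^sub>E i\<in>I. carrier (M i). finite (dsupp I M x)}"
  using carrier_sum_group[of I "\<lambda>i. add_monoid (M i)"] group_summand by (simp add: dsum_def dsupp_def)

lemma zero_S: "\<zero>\<^bsub>S\<^esub> = (\<lambda>i\<in>I. \<zero>\<^bsub>M i\<^esub>)"
  by (simp add: dsum_def)

lemma add_S: "x \<oplus>\<^bsub>S\<^esub> y = (\<lambda>i\<in>I. x i \<oplus>\<^bsub>M i\<^esub> y i)"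
  by (simp add: dsum_def)

lemma S_apply: "x \<in> carrier S \<Longrightarrow> i \<in> I \<Longrightarrow> x i \<in> carrier (M i)"
  by (auto simp: carrier_S PiE_iff)

lemma S_ext: "\<lbrakk>x \<in> carrier S; y \<in> carrier S; \<And>i. i \<in> I \<Longrightarrow> x i = y i\<rbrakk> \<Longrightarrow> x = y"
  by (auto simp: carrier_S intro: PiE_ext)

lemma finite_dsupp: "x \<in> carrier S \<Longrightarrow> finite (dsupp I M x)"
  by (simp add: carrier_S)

lemma dsupp_subset: "dsupp I M x \<subseteq> I"
  by (auto simp: dsupp_def)

lemma dsuppD: "i \<in> dsupp I M x \<Longrightarrow> i \<in> I"
  by (simp add: dsupp_def)

lemma abelian_group_S: "abelian_group S"
proof -
  interpret G: group "sum_group I (\<lambda>i. add_monoid (M i))"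
    by (rule sum_group[OF group_summand])
  have "x \<otimes>\<^bsub>sum_group I (\<lambda>i. add_monoid (M i))\<^esub> y = y \<otimes>\<^bsub>sum_group I (\<lambda>i. add_monoid (M i))\<^esub> x"
    if "x \<in> carrier S" "y \<in> carrier S" for x y
    using S_apply[OF that(1)] S_apply[OF that(2)]
    by (auto intro!: restrict_ext simp: abelian_groupE(4)[OF summand])
  then have "comm_group (sum_group I (\<lambda>i. add_monoid (M i)))"
    by (intro G.group_comm_groupI) (simp add: dsum_def)
  then show ?thesis
    unfolding dsum_def by (rule abelian_group_add_ring)
qed

lemma proj_ahom: "i \<in> I \<Longrightarrow> (\<lambda>x. x i) \<in> ahom S (M i)"
  by (rule ahomI) (auto simp: S_apply add_S)

lemma dsupp_dinj: "dsupp I M (dinj I M i m) \<subseteq> {i}"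
  by (auto simp: dsupp_def dinj_def split: if_splits)

lemma dinj_closed: "\<lbrakk>i \<in> I; m \<in> carrier (M i)\<rbrakk> \<Longrightarrow> dinj I M i m \<in> carrier S"
  using finite_subset[OF dsupp_dinj] abelian_groupE(2)[OF summand]
  by (auto simp: carrier_S dinj_def)

lemma dinj_apply: "i \<in> I \<Longrightarrow> dinj I M i m i = m"
  by (simp add: dinj_def)

lemma dinj_ahom: "i \<in> I \<Longrightarrow> dinj I M i \<in> ahom (M i) S"
  using abelian_groupE(5)[OF summand] abelian_groupE(2)[OF summand]
  by (intro ahomI dinj_closed) (auto simp: add_S dinj_def fun_eq_iff)

lemma finsum_apply:
  assumes "f \<in> J \<rightarrow> carrier S" "i \<in> I"
  shows "(\<Oplus>\<^bsub>S\<^esub>j\<in>J. f j) i = (\<Oplus>\<^bsub>M i\<^esub>j\<in>J. f j i)"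
  by (rule ahom_finsum[OF abelian_group_S summand[OF assms(2)] proj_ahom[OF assms(2)] assms(1)])

lemma dinj_sum_apply:
  assumes "finite J" "J \<subseteq> I" "i \<in> I" "\<And>j. j \<in> J \<Longrightarrow> y j \<in> carrier (M j)"
  shows "(\<Oplus>\<^bsub>S\<^esub>j\<in>J. dinj I M j (y j)) i = (if i \<in> J then y i else \<zero>\<^bsub>M i\<^esub>)"
proof -
  interpret Mi: abelian_group "M i" by (rule summand[OF assms(3)])
  have "(\<lambda>j. dinj I M j (y j)) \<in> J \<rightarrow> carrier S"
    using assms by (auto intro!: dinj_closed)
  then have "(\<Oplus>\<^bsub>S\<^esub>j\<in>J. dinj I M j (y j)) i = (\<Oplus>\<^bsub>M i\<^esub>j\<in>J. dinj I M j (y j) i)"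
    by (rule finsum_apply[OF _ assms(3)])
  also have "\<dots> = (\<Oplus>\<^bsub>M i\<^esub>j\<in>J. if i = j then y j else \<zero>\<^bsub>M i\<^esub>)"
    using assms by (intro Mi.finsum_cong) (auto simp: dinj_def simp_implies_def)
  also have "\<dots> = (if i \<in> J then y i else \<zero>\<^bsub>M i\<^esub>)"
  proof (cases "i \<in> J")
    case True
    \<comment> \<open>The rule for singletons asks all values of the family to lie in \<open>M i\<close>, which \<open>y\<close> does not satisfy.\<close>
    have e: "(\<lambda>j. if i = j then y j else \<zero>\<^bsub>M i\<^esub>) = (\<lambda>j. if i = j then y i else \<zero>\<^bsub>M i\<^esub>)"
      by auto
    from True show ?thesis
      using Mi.finsum_singleton[OF True assms(1), of "\<lambda>j. y i"] assms(4) e by simp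
  next
    case False
    then have "(\<Oplus>\<^bsub>M i\<^esub>j\<in>J. if i = j then y j else \<zero>\<^bsub>M i\<^esub>) = (\<Oplus>\<^bsub>M i\<^esub>j\<in>J. \<zero>\<^bsub>M i\<^esub>)"
      by (intro Mi.finsum_cong') auto
    then show ?thesis using False by simp
  qed
  finally show ?thesis .
qed

lemma dsum_decomposition:
  assumes "x \<in> carrier S"
  shows "x = (\<Oplus>\<^bsub>S\<^esub>i\<in>dsupp I M x. dinj I M i (x i))"
proof -
  interpret S: abelian_group S by (rule abelian_group_S)
  have "i \<in> dsupp I M x \<Longrightarrow> x i \<in> carrier (M i)" for i
    using S_apply[OF assms] dsupp_subset by auto
  then have c: "(\<Oplus>\<^bsub>S\<^esub>i\<in>dsupp I M x. dinj I M i (x i)) \<in> carrier S"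
    using dsupp_subset by (intro S.finsum_closed) (auto intro!: dinj_closed)
  show ?thesis
    using S_apply[OF assms] dsupp_subset
    by (intro S_ext[OF assms c], subst dinj_sum_apply[OF finite_dsupp[OF assms]])
      (auto simp: dsupp_def)
qed

lemma dsum_eqI:
  assumes H: "abelian_group H" and f: "f \<in> ahom S H" and g: "g \<in> ahom S H" and x: "x \<in> carrier S"
    and eq: "\<And>i m. \<lbrakk>i \<in> I; m \<in> carrier (M i)\<rbrakk> \<Longrightarrow> f (dinj I M i m) = g (dinj I M i m)"
  shows "f x = g x"
proof -
  interpret H: abelian_group H by (rule H)
  have m: "x i \<in> carrier (M i)" "i \<in> I" if "i \<in> dsupp I M x" for i
    using S_apply[OF x] dsupp_subset that by auto
  then have fam: "(\<lambda>i. dinj I M i (x i)) \<in> dsupp I M x \<rightarrow> carrier S"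
    by (auto intro!: dinj_closed)
  have "f x = f (\<Oplus>\<^bsub>S\<^esub>i\<in>dsupp I M x. dinj I M i (x i))"
    using dsum_decomposition[OF x] by simp
  also have "\<dots> = (\<Oplus>\<^bsub>H\<^esub>i\<in>dsupp I M x. f (dinj I M i (x i)))"
    by (rule ahom_finsum[OF abelian_group_S H f fam])
  also have "\<dots> = (\<Oplus>\<^bsub>H\<^esub>i\<in>dsupp I M x. g (dinj I M i (x i)))"
    using m fam ahom_closed[OF g] by (intro H.finsum_cong) (auto simp: eq simp_implies_def Pi_iff)
  also have "\<dots> = g (\<Oplus>\<^bsub>S\<^esub>i\<in>dsupp I M x. dinj I M i (x i))"
    by (rule ahom_finsum[OF abelian_group_S H g fam, symmetric])
  also have "\<dots> = g x"
    using dsum_decomposition[OF x] by simp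
  finally show ?thesis .
qed

text \<open>
  The sum \<open>\<Oplus> h\<^sub>i(x\<^sub>i)\<close> over the support of \<open>x\<close> is the map on the direct sum induced by a family
  \<open>h\<^sub>i\<close>.  The coaction of \<open>F1\<close> and the action of \<open>F4\<close> have this form, and the next two lemmas give
  the universal property for them.
\<close>

lemma dlift_superset:
  assumes H: "abelian_group H" and h: "\<And>i. i \<in> I \<Longrightarrow> h i \<in> ahom (M i) H"
    and x: "x \<in> carrier S" and J: "finite J" "dsupp I M x \<subseteq> J" "J \<subseteq> I"
  shows "(\<Oplus>\<^bsub>H\<^esub>i\<in>dsupp I M x. h i (x i)) = (\<Oplus>\<^bsub>H\<^esub>i\<in>J. h i (x i))"
proof -
  interpret H: abelian_group H by (rule H)
  show ?thesis
    using J S_apply[OF x] ahom_closed[OF h] ahom_zero[OF summand H h]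
    by (intro H.add.finprod_mono_neutral_cong_left) (auto simp: dsupp_def subset_iff)
qed

lemma dlift_ahom:
  assumes H: "abelian_group H" and h: "\<And>i. i \<in> I \<Longrightarrow> h i \<in> ahom (M i) H"
  shows "(\<lambda>x. \<Oplus>\<^bsub>H\<^esub>i\<in>dsupp I M x. h i (x i)) \<in> ahom S H"
proof (rule ahomI)
  interpret H: abelian_group H by (rule H)
  interpret S: abelian_group S by (rule abelian_group_S)
  have c: "h i (x i) \<in> carrier H" if "x \<in> carrier S" "i \<in> I" for x i
    using ahom_closed[OF h[OF that(2)] S_apply[OF that]] .
  show "(\<Oplus>\<^bsub>H\<^esub>i\<in>dsupp I M x. h i (x i)) \<in> carrier H" if "x \<in> carrier S" for x
    using c[OF that] dsupp_subset by (intro H.finsum_closed) auto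
  fix x y assume xy: "x \<in> carrier S" "y \<in> carrier S"
  let ?J = "dsupp I M x \<union> dsupp I M y \<union> dsupp I M (x \<oplus>\<^bsub>S\<^esub> y)"
  have J: "finite ?J" "?J \<subseteq> I"
    using xy S.a_closed[OF xy] finite_dsupp dsupp_subset by auto
  have "(\<Oplus>\<^bsub>H\<^esub>i\<in>dsupp I M (x \<oplus>\<^bsub>S\<^esub> y). h i ((x \<oplus>\<^bsub>S\<^esub> y) i)) = (\<Oplus>\<^bsub>H\<^esub>i\<in>?J. h i ((x \<oplus>\<^bsub>S\<^esub> y) i))"
    by (rule dlift_superset[OF H h S.a_closed[OF xy] J(1) _ J(2)]) auto
  also have "\<dots> = (\<Oplus>\<^bsub>H\<^esub>i\<in>?J. h i (x i) \<oplus>\<^bsub>H\<^esub> h i (y i))"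
    using J(2) c[OF xy(1)] c[OF xy(2)] S_apply[OF xy(1)] S_apply[OF xy(2)]
    by (intro H.finsum_cong) (auto simp: simp_implies_def add_S ahom_add[OF h] subset_iff)
  also have "\<dots> = (\<Oplus>\<^bsub>H\<^esub>i\<in>?J. h i (x i)) \<oplus>\<^bsub>H\<^esub> (\<Oplus>\<^bsub>H\<^esub>i\<in>?J. h i (y i))"
    using J(2) c[OF xy(1)] c[OF xy(2)] by (intro H.finsum_addf) (auto simp: subset_iff)
  also have "(\<Oplus>\<^bsub>H\<^esub>i\<in>?J. h i (x i)) = (\<Oplus>\<^bsub>H\<^esub>i\<in>dsupp I M x. h i (x i))"
    by (rule dlift_superset[OF H h xy(1) J(1) _ J(2), symmetric]) auto
  also have "(\<Oplus>\<^bsub>H\<^esub>i\<in>?J. h i (y i)) = (\<Oplus>\<^bsub>H\<^esub>i\<in>dsupp I M y. h i (y i))"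
    by (rule dlift_superset[OF H h xy(2) J(1) _ J(2), symmetric]) auto
  finally show "(\<Oplus>\<^bsub>H\<^esub>i\<in>dsupp I M (x \<oplus>\<^bsub>S\<^esub> y). h i ((x \<oplus>\<^bsub>S\<^esub> y) i)) =
    (\<Oplus>\<^bsub>H\<^esub>i\<in>dsupp I M x. h i (x i)) \<oplus>\<^bsub>H\<^esub> (\<Oplus>\<^bsub>H\<^esub>i\<in>dsupp I M y. h i (y i))" .
qed

lemma dlift_dinj:
  assumes H: "abelian_group H" and h: "\<And>i. i \<in> I \<Longrightarrow> h i \<in> ahom (M i) H"
    and i: "i \<in> I" "m \<in> carrier (M i)"
  shows "(\<Oplus>\<^bsub>H\<^esub>j\<in>dsupp I M (dinj I M i m). h j (dinj I M i m j)) = h i m"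
proof -
  interpret H: abelian_group H by (rule H)
  have "(\<Oplus>\<^bsub>H\<^esub>j\<in>dsupp I M (dinj I M i m). h j (dinj I M i m j)) = (\<Oplus>\<^bsub>H\<^esub>j\<in>{i}. h j (dinj I M i m j))"
    by (rule dlift_superset[OF H h dinj_closed[OF i]]) (use i dsupp_dinj in auto)
  also have "\<dots> = h i m"
    using ahom_closed[OF h[OF i(1)] i(2)] i by (simp add: dinj_apply)
  finally show ?thesis .
qed

lemma dpart_iff: "i \<in> I \<Longrightarrow> x \<in> dpart I M i \<longleftrightarrow> (\<exists>m\<in>carrier (M i). x = dinj I M i m)"
proof
  assume i: "i \<in> I" and x: "x \<in> dpart I M i"
  then have c: "x \<in> carrier S" and s: "dsupp I M x \<subseteq> {i}" by (auto simp: dpart_def)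
  have "x = dinj I M i (x i)"
    using s i by (intro S_ext[OF c dinj_closed]) (auto simp: S_apply[OF c] dinj_def dsupp_def)
  then show "\<exists>m\<in>carrier (M i). x = dinj I M i m" using S_apply[OF c i] by blast
next
  assume "i \<in> I" "\<exists>m\<in>carrier (M i). x = dinj I M i m"
  then show "x \<in> dpart I M i" using dsupp_dinj by (auto simp: dpart_def dinj_closed)
qed

lemma dpart_subgroup: "i \<in> I \<Longrightarrow> subgroup (dpart I M i) (add_monoid S)"
proof -
  assume i: "i \<in> I"
  interpret S: abelian_group S by (rule abelian_group_S)
  interpret Mi: abelian_group "M i" by (rule summand[OF i])
  have h: "dinj I M i \<in> ahom (M i) S" by (rule dinj_ahom[OF i])
  show ?thesis
  proof (rule S.add.subgroupI)
    show "dpart I M i \<subseteq> carrier S" by (auto simp: dpart_def)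
    show "dpart I M i \<noteq> {}" using dpart_iff[OF i] Mi.zero_closed by blast
    show "\<ominus>\<^bsub>S\<^esub> x \<in> dpart I M i" if "x \<in> dpart I M i" for x
      using that ahom_neg[OF summand[OF i] abelian_group_S h] unfolding dpart_iff[OF i]
      by (metis Mi.a_inv_closed)
    show "x \<oplus>\<^bsub>S\<^esub> y \<in> dpart I M i" if "x \<in> dpart I M i" "y \<in> dpart I M i" for x y
      using that ahom_add[OF h] unfolding dpart_iff[OF i] by (metis Mi.a_closed)
  qed
qed

text \<open>
  The decomposition has the components \<open>x\<^sub>i\<close> in degree \<open>i\<close>; it is unique because evaluation at \<open>i\<close>
  annihilates all homogeneous parts of other degrees.
\<close>

lemma dpart_direct_sum:
  assumes x: "x \<in> carrier S"
  shows "\<exists>!y. y \<in> (\<Pi>\<^sub>E i\<in>I. dpart I M i) \<and> finite {i \<in> I. y i \<noteq> \<zero>\<^bsub>S\<^esub>} \<and>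
    x = (\<Oplus>\<^bsub>S\<^esub>i\<in>{i \<in> I. y i \<noteq> \<zero>\<^bsub>S\<^esub>}. y i)"
proof (rule ex1I[of _ "\<lambda>i\<in>I. dinj I M i (x i)"])
  let ?y = "\<lambda>i\<in>I. dinj I M i (x i)"
  have nz: "dinj I M i (x i) = \<zero>\<^bsub>S\<^esub> \<longleftrightarrow> x i = \<zero>\<^bsub>M i\<^esub>" if "i \<in> I" for i
    using that ahom_zero[OF summand[OF that] abelian_group_S dinj_ahom[OF that]]
      dinj_apply[OF that, of "x i"] by (auto simp: zero_S)
  then have s: "{i \<in> I. ?y i \<noteq> \<zero>\<^bsub>S\<^esub>} = dsupp I M x" by (auto simp: dsupp_def)
  have "(\<Oplus>\<^bsub>S\<^esub>i\<in>dsupp I M x. ?y i) = (\<Oplus>\<^bsub>S\<^esub>i\<in>dsupp I M x. dinj I M i (x i))"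
  proof -
    interpret S: abelian_group S by (rule abelian_group_S)
    show ?thesis
      using dsupp_subset S_apply[OF x] by (intro S.finsum_cong) (auto simp: simp_implies_def dinj_closed subset_iff)
  qed
  then show "?y \<in> (\<Pi>\<^sub>E i\<in>I. dpart I M i) \<and> finite {i \<in> I. ?y i \<noteq> \<zero>\<^bsub>S\<^esub>} \<and>
    x = (\<Oplus>\<^bsub>S\<^esub>i\<in>{i \<in> I. ?y i \<noteq> \<zero>\<^bsub>S\<^esub>}. ?y i)"
    using dsum_decomposition[OF x] finite_dsupp[OF x] S_apply[OF x] unfolding s by (auto simp: dpart_iff intro!: bexI)
next
  fix y assume y: "y \<in> (\<Pi>\<^sub>E i\<in>I. dpart I M i) \<and> finite {i \<in> I. y i \<noteq> \<zero>\<^bsub>S\<^esub>} \<and>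
    x = (\<Oplus>\<^bsub>S\<^esub>i\<in>{i \<in> I. y i \<noteq> \<zero>\<^bsub>S\<^esub>}. y i)"
  let ?J = "{i \<in> I. y i \<noteq> \<zero>\<^bsub>S\<^esub>}"
  interpret S: abelian_group S by (rule abelian_group_S)
  have yd: "y i = dinj I M i (y i i)" "y i i \<in> carrier (M i)" if "i \<in> I" for i
    using y that dpart_iff[OF that, of "y i"] by (auto simp: PiE_iff dinj_apply)
  have "x = (\<Oplus>\<^bsub>S\<^esub>i\<in>?J. dinj I M i (y i i))"
    by (subst conjunct2[OF conjunct2[OF y]], rule S.finsum_cong') (use yd in \<open>auto intro!: dinj_closed\<close>)
  moreover have "(\<Oplus>\<^bsub>S\<^esub>j\<in>?J. dinj I M j (y j j)) i = (if i \<in> ?J then y i i else \<zero>\<^bsub>M i\<^esub>)" if "i \<in> I" for i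
    by (rule dinj_sum_apply[OF _ _ that]) (use y yd(2) in auto)
  ultimately have "x i = y i i" if "i \<in> I" for i
    using that by (auto simp: zero_S)
  then show "y = (\<lambda>i\<in>I. dinj I M i (x i))"
    using y yd(1) by (intro ext) (auto simp: PiE_iff extensional_def)
qed

end

lemma dsum_map_closed:
  assumes "dsum_family I M" "dsum_family I N" and f: "\<And>i. i \<in> I \<Longrightarrow> f i \<in> ahom (M i) (N i)"
    and x: "x \<in> carrier (dsum I M)"
  shows "dsum_map I M f x \<in> carrier (dsum I N)"
proof -
  interpret M: dsum_family I M by fact
  interpret N: dsum_family I N by fact
  have "dsupp I N (dsum_map I M f x) \<subseteq> dsupp I M x"
    using x ahom_zero[OF M.summand N.summand f] by (auto simp: dsupp_def dsum_map_def)
  then show ?thesis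
    using x M.finite_dsupp[OF x] M.S_apply[OF x] ahom_closed[OF f] finite_subset
    by (auto simp: N.carrier_S dsum_map_def)
qed

lemma dsum_map_ahom:
  assumes "dsum_family I M" "dsum_family I N" and f: "\<And>i. i \<in> I \<Longrightarrow> f i \<in> ahom (M i) (N i)"
  shows "dsum_map I M f \<in> ahom (dsum I M) (dsum I N)"
proof -
  interpret M: dsum_family I M by fact
  interpret N: dsum_family I N by fact
  interpret S: abelian_group "dsum I M" by (rule M.abelian_group_S)
  show ?thesis
    using M.S_apply
    by (intro ahomI dsum_map_closed[OF assms])
      (auto simp: dsum_map_def M.add_S[symmetric] N.add_S intro!: restrict_ext,
       auto simp: M.add_S ahom_add[OF f])
qed

lemma dsum_map_dinj:
  assumes "dsum_family I M" "dsum_family I N" and f: "\<And>i. i \<in> I \<Longrightarrow> f i \<in> ahom (M i) (N i)"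
    and "i \<in> I" "m \<in> carrier (M i)"
  shows "dsum_map I M f (dinj I M i m) = dinj I N i (f i m)"
proof -
  interpret M: dsum_family I M by fact
  interpret N: dsum_family I N by fact
  show ?thesis
    using assms(4,5) ahom_zero[OF M.summand N.summand f]
    by (simp add: dsum_map_def M.dinj_closed) (auto simp: dinj_def)
qed

section \<open>Graded products\<close>

locale graded_product = G: group G + M: dsum_family "carrier G" M + N: dsum_family "carrier G" N +
    P: dsum_family "carrier G" P
  for G :: "('g, 'w) monoid_scheme" and M :: "'g \<Rightarrow> ('m, 'x) ring_scheme"
    and N :: "'g \<Rightarrow> ('n, 'y) ring_scheme" and P :: "'g \<Rightarrow> ('p, 'z) ring_scheme" +
  fixes op :: "'g \<Rightarrow> 'g \<Rightarrow> 'm \<Rightarrow> 'n \<Rightarrow> 'p"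
  assumes op: "\<lbrakk>\<alpha> \<in> carrier G; \<beta> \<in> carrier G\<rbrakk> \<Longrightarrow>
    biadditive (M \<alpha>) (N \<beta>) (P (\<alpha> \<otimes>\<^bsub>G\<^esub> \<beta>)) (op \<alpha> \<beta>)"
begin

abbreviation summ where
  "summ x y q \<equiv> dinj (carrier G) P (fst q \<otimes>\<^bsub>G\<^esub> snd q) (op (fst q) (snd q) (x (fst q)) (y (snd q)))"

lemma summ_closed:
  "\<lbrakk>x \<in> carrier M.S; y \<in> carrier N.S; q \<in> carrier G \<times> carrier G\<rbrakk> \<Longrightarrow> summ x y q \<in> carrier P.S"
  by (auto intro!: P.dinj_closed biadditive_closed[OF op] M.S_apply N.S_apply)

lemma summ_fun:
  "\<lbrakk>x \<in> carrier M.S; y \<in> carrier N.S; J \<subseteq> carrier G \<times> carrier G\<rbrakk> \<Longrightarrow> summ x y \<in> J \<rightarrow> carrier P.S"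
  using summ_closed by blast

text \<open>
  A pair of degrees outside the two supports contributes nothing, since a biadditive map vanishes as soon
  as one of its arguments does.
\<close>

lemma dext_superset:
  assumes x: "x \<in> carrier M.S" and y: "y \<in> carrier N.S"
    and J: "finite J" "dsupp (carrier G) M x \<times> dsupp (carrier G) N y \<subseteq> J" "J \<subseteq> carrier G \<times> carrier G"
  shows "dext G M N P op x y = (\<Oplus>\<^bsub>P.S\<^esub>q\<in>J. summ x y q)"
proof -
  interpret S: abelian_group P.S by (rule P.abelian_group_S)
  have "summ x y q = \<zero>\<^bsub>P.S\<^esub>" if q: "q \<in> J - dsupp (carrier G) M x \<times> dsupp (carrier G) N y" for q
  proof -
    obtain \<alpha> \<beta> where ab: "q = (\<alpha>, \<beta>)" "\<alpha> \<in> carrier G" "\<beta> \<in> carrier G" using q J by auto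
    have g: "\<alpha> \<otimes>\<^bsub>G\<^esub> \<beta> \<in> carrier G" using ab by simp
    have "op \<alpha> \<beta> (x \<alpha>) (y \<beta>) = \<zero>\<^bsub>P (\<alpha> \<otimes>\<^bsub>G\<^esub> \<beta>)\<^esub>"
    proof (cases "x \<alpha> = \<zero>\<^bsub>M \<alpha>\<^esub>")
      case True
      then show ?thesis
        using ahom_zero[OF M.summand P.summand biadditive_left[OF op]] ab g N.S_apply[OF y] by simp
    next
      case False
      then have "y \<beta> = \<zero>\<^bsub>N \<beta>\<^esub>" using q ab by (auto simp: dsupp_def)
      then show ?thesis
        using ahom_zero[OF N.summand P.summand biadditive_right[OF op]] ab g M.S_apply[OF x] by simp
    qed
    then show ?thesis
      using ahom_zero[OF P.summand P.abelian_group_S P.dinj_ahom] g ab by simp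
  qed
  then show ?thesis
    unfolding dext_def using J summ_closed[OF x y]
    by (intro S.add.finprod_mono_neutral_cong_left) (auto simp: subset_iff)
qed

lemma dext_closed: "\<lbrakk>x \<in> carrier M.S; y \<in> carrier N.S\<rbrakk> \<Longrightarrow> dext G M N P op x y \<in> carrier P.S"
proof -
  assume xy: "x \<in> carrier M.S" "y \<in> carrier N.S"
  interpret S: abelian_group P.S by (rule P.abelian_group_S)
  show ?thesis
    unfolding dext_def
    by (intro S.finsum_closed) (auto intro!: summ_closed[OF xy, of "(_, _)", simplified] dest: M.dsuppD N.dsuppD)
qed

text \<open>
  The supports of \<open>x\<close>, \<open>x'\<close> and \<open>x \<oplus> x'\<close> differ, so the three sums are first extended to the union of
  the supports.
\<close>

lemma dext_biadditive: "biadditive M.S N.S P.S (dext G M N P op)"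
proof -
  interpret S: abelian_group P.S by (rule P.abelian_group_S)
  interpret SM: abelian_group M.S by (rule M.abelian_group_S)
  interpret SN: abelian_group N.S by (rule N.abelian_group_S)
  have left: "(\<lambda>x. dext G M N P op x y) \<in> ahom M.S P.S" if y: "y \<in> carrier N.S" for y
  proof (rule ahomI)
    fix x x' assume x: "x \<in> carrier M.S" "x' \<in> carrier M.S"
    let ?J = "(dsupp (carrier G) M x \<union> dsupp (carrier G) M x' \<union> dsupp (carrier G) M (x \<oplus>\<^bsub>M.S\<^esub> x')) \<times>
      dsupp (carrier G) N y"
    have J: "finite ?J" "?J \<subseteq> carrier G \<times> carrier G"
      using x y SM.a_closed[OF x] M.finite_dsupp N.finite_dsupp by (auto dest: M.dsuppD N.dsuppD)
    have "summ (x \<oplus>\<^bsub>M.S\<^esub> x') y q = summ x y q \<oplus>\<^bsub>P.S\<^esub> summ x' y q" if q: "q \<in> ?J" for q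
    proof -
      obtain \<alpha> \<beta> where ab: "q = (\<alpha>, \<beta>)" "\<alpha> \<in> carrier G" "\<beta> \<in> carrier G" using q J by auto
      have c: "x \<alpha> \<in> carrier (M \<alpha>)" "x' \<alpha> \<in> carrier (M \<alpha>)" "y \<beta> \<in> carrier (N \<beta>)"
        using ab M.S_apply[OF x(1)] M.S_apply[OF x(2)] N.S_apply[OF y] by auto
      note b = op[OF ab(2,3)]
      show ?thesis
        using ab c biadditive_closed[OF b] ahom_add[OF P.dinj_ahom[OF G.m_closed[OF ab(2,3)]]]
        by (simp add: M.add_S biadditive_add_left[OF b])
    qed
    then have "(\<Oplus>\<^bsub>P.S\<^esub>q\<in>?J. summ (x \<oplus>\<^bsub>M.S\<^esub> x') y q) =
        (\<Oplus>\<^bsub>P.S\<^esub>q\<in>?J. summ x y q) \<oplus>\<^bsub>P.S\<^esub> (\<Oplus>\<^bsub>P.S\<^esub>q\<in>?J. summ x' y q)"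
      by (rule S.finsum_eq_add[OF _ summ_fun[OF x(1) y J(2)] summ_fun[OF x(2) y J(2)]])
    then show "dext G M N P op (x \<oplus>\<^bsub>M.S\<^esub> x') y = dext G M N P op x y \<oplus>\<^bsub>P.S\<^esub> dext G M N P op x' y"
      using dext_superset[OF x(1) y J(1) _ J(2)] dext_superset[OF x(2) y J(1) _ J(2)]
        dext_superset[OF SM.a_closed[OF x] y J(1) _ J(2)] by fastforce
  qed (simp add: dext_closed y)
  have right: "dext G M N P op x \<in> ahom N.S P.S" if x: "x \<in> carrier M.S" for x
  proof (rule ahomI)
    fix y y' assume y: "y \<in> carrier N.S" "y' \<in> carrier N.S"
    let ?J = "dsupp (carrier G) M x \<times>
      (dsupp (carrier G) N y \<union> dsupp (carrier G) N y' \<union> dsupp (carrier G) N (y \<oplus>\<^bsub>N.S\<^esub> y'))"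
    have J: "finite ?J" "?J \<subseteq> carrier G \<times> carrier G"
      using x y SN.a_closed[OF y] M.finite_dsupp N.finite_dsupp by (auto dest: M.dsuppD N.dsuppD)
    have "summ x (y \<oplus>\<^bsub>N.S\<^esub> y') q = summ x y q \<oplus>\<^bsub>P.S\<^esub> summ x y' q" if q: "q \<in> ?J" for q
    proof -
      obtain \<alpha> \<beta> where ab: "q = (\<alpha>, \<beta>)" "\<alpha> \<in> carrier G" "\<beta> \<in> carrier G" using q J by auto
      have c: "x \<alpha> \<in> carrier (M \<alpha>)" "y \<beta> \<in> carrier (N \<beta>)" "y' \<beta> \<in> carrier (N \<beta>)"
        using ab N.S_apply[OF y(1)] N.S_apply[OF y(2)] M.S_apply[OF x] by auto
      note b = op[OF ab(2,3)]
      show ?thesis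
        using ab c biadditive_closed[OF b] ahom_add[OF P.dinj_ahom[OF G.m_closed[OF ab(2,3)]]]
        by (simp add: N.add_S biadditive_add_right[OF b])
    qed
    then have "(\<Oplus>\<^bsub>P.S\<^esub>q\<in>?J. summ x (y \<oplus>\<^bsub>N.S\<^esub> y') q) =
        (\<Oplus>\<^bsub>P.S\<^esub>q\<in>?J. summ x y q) \<oplus>\<^bsub>P.S\<^esub> (\<Oplus>\<^bsub>P.S\<^esub>q\<in>?J. summ x y' q)"
      by (rule S.finsum_eq_add[OF _ summ_fun[OF x y(1) J(2)] summ_fun[OF x y(2) J(2)]])
    then show "dext G M N P op x (y \<oplus>\<^bsub>N.S\<^esub> y') = dext G M N P op x y \<oplus>\<^bsub>P.S\<^esub> dext G M N P op x y'"
      using dext_superset[OF x y(1) J(1) _ J(2)] dext_superset[OF x y(2) J(1) _ J(2)]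
        dext_superset[OF x SN.a_closed[OF y] J(1) _ J(2)] by fastforce
  qed (simp add: dext_closed x)
  from left right show ?thesis by (simp add: biadditive_def)
qed

lemma dext_dinj:
  assumes ab: "\<alpha> \<in> carrier G" "\<beta> \<in> carrier G" and m: "m \<in> carrier (M \<alpha>)" and n: "n \<in> carrier (N \<beta>)"
  shows "dext G M N P op (dinj (carrier G) M \<alpha> m) (dinj (carrier G) N \<beta> n) =
    dinj (carrier G) P (\<alpha> \<otimes>\<^bsub>G\<^esub> \<beta>) (op \<alpha> \<beta> m n)"
proof -
  interpret S: abelian_group P.S by (rule P.abelian_group_S)
  have "dext G M N P op (dinj (carrier G) M \<alpha> m) (dinj (carrier G) N \<beta> n) =
    (\<Oplus>\<^bsub>P.S\<^esub>q\<in>{(\<alpha>, \<beta>)}. summ (dinj (carrier G) M \<alpha> m) (dinj (carrier G) N \<beta> n) q)"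
    using M.dsupp_dinj N.dsupp_dinj ab
    by (intro dext_superset M.dinj_closed N.dinj_closed m n) (auto simp: subset_iff)
  also have "\<dots> = dinj (carrier G) P (\<alpha> \<otimes>\<^bsub>G\<^esub> \<beta>) (op \<alpha> \<beta> m n)"
    using ab by (simp add: M.dinj_apply N.dinj_apply P.dinj_closed[OF _ biadditive_closed[OF op[OF ab] m n]])
  finally show ?thesis .
qed

text \<open>
  Together with \<open>dext_biadditive\<close> and \<open>dext_dinj\<close> this characterises \<open>dext\<close> on the direct sums, so
  later arguments can avoid its definition.
\<close>

lemma dext_eqI:
  assumes H: "abelian_group H" and b: "biadditive M.S N.S H b" "biadditive M.S N.S H b'"
    and eq: "\<And>\<alpha> \<beta> m n. \<lbrakk>\<alpha> \<in> carrier G; \<beta> \<in> carrier G; m \<in> carrier (M \<alpha>); n \<in> carrier (N \<beta>)\<rbrakk> \<Longrightarrow>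
      b (dinj (carrier G) M \<alpha> m) (dinj (carrier G) N \<beta> n) = b' (dinj (carrier G) M \<alpha> m) (dinj (carrier G) N \<beta> n)"
    and x: "x \<in> carrier M.S" and y: "y \<in> carrier N.S"
  shows "b x y = b' x y"
proof (rule M.dsum_eqI[OF H biadditive_left[OF b(1) y] biadditive_left[OF b(2) y] x])
  fix \<alpha> m assume m: "\<alpha> \<in> carrier G" "m \<in> carrier (M \<alpha>)"
  show "b (dinj (carrier G) M \<alpha> m) y = b' (dinj (carrier G) M \<alpha> m) y"
    by (rule N.dsum_eqI[OF H biadditive_right[OF b(1) M.dinj_closed[OF m]]
          biadditive_right[OF b(2) M.dinj_closed[OF m]] y]) (rule eq[OF m(1) _ m(2)])
qed

end

text \<open>
  Four different products are allowed, so that the rule covers both the associativity of a graded ring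
  and the mixed associativity of a graded module.
\<close>

lemma dext_assoc:
  assumes "graded_product G L M P op1" "graded_product G P N Z op2"
    "graded_product G M N Q op3" "graded_product G L Q Z op4"
    and eq: "\<And>\<alpha> \<beta> \<gamma> l m n. \<lbrakk>\<alpha> \<in> carrier G; \<beta> \<in> carrier G; \<gamma> \<in> carrier G; l \<in> carrier (L \<alpha>);
      m \<in> carrier (M \<beta>); n \<in> carrier (N \<gamma>)\<rbrakk> \<Longrightarrow>
      op2 (\<alpha> \<otimes>\<^bsub>G\<^esub> \<beta>) \<gamma> (op1 \<alpha> \<beta> l m) n = op4 \<alpha> (\<beta> \<otimes>\<^bsub>G\<^esub> \<gamma>) l (op3 \<beta> \<gamma> m n)"
    and x: "x \<in> carrier (dsum (carrier G) L)" and y: "y \<in> carrier (dsum (carrier G) M)"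
    and z: "z \<in> carrier (dsum (carrier G) N)"
  shows "dext G P N Z op2 (dext G L M P op1 x y) z = dext G L Q Z op4 x (dext G M N Q op3 y z)"
proof -
  interpret p1: graded_product G L M P op1 by fact
  interpret p2: graded_product G P N Z op2 by fact
  interpret p3: graded_product G M N Q op3 by fact
  interpret p4: graded_product G L Q Z op4 by fact
  note b1 = p1.dext_biadditive and b2 = p2.dext_biadditive and b3 = p3.dext_biadditive
    and b4 = p4.dext_biadditive
  note H = p2.P.abelian_group_S
  note ca = ahom_comp
  show ?thesis
  proof (rule p1.M.dsum_eqI[OF H _ _ x])
    show "(\<lambda>x. dext G P N Z op2 (dext G L M P op1 x y) z) \<in> ahom (dsum (carrier G) L) (dsum (carrier G) Z)"
      by (rule ca[OF biadditive_left[OF b2 z] biadditive_left[OF b1 y]])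
    show "(\<lambda>x. dext G L Q Z op4 x (dext G M N Q op3 y z)) \<in> ahom (dsum (carrier G) L) (dsum (carrier G) Z)"
      by (rule biadditive_left[OF b4 p3.dext_closed[OF y z]])
    fix \<alpha> l assume l: "\<alpha> \<in> carrier G" "l \<in> carrier (L \<alpha>)"
    note l' = p1.M.dinj_closed[OF l]
    show "dext G P N Z op2 (dext G L M P op1 (dinj (carrier G) L \<alpha> l) y) z =
      dext G L Q Z op4 (dinj (carrier G) L \<alpha> l) (dext G M N Q op3 y z)"
    proof (rule p3.dext_eqI[OF H _ _ _ y z, where b = "\<lambda>y z. dext G P N Z op2 (dext G L M P op1 (dinj (carrier G) L \<alpha> l) y) z"
          and b' = "\<lambda>y z. dext G L Q Z op4 (dinj (carrier G) L \<alpha> l) (dext G M N Q op3 y z)"])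
      show "biadditive (dsum (carrier G) M) (dsum (carrier G) N) (dsum (carrier G) Z) (\<lambda>y z. dext G P N Z op2 (dext G L M P op1 (dinj (carrier G) L \<alpha> l) y) z)"
        unfolding biadditive_def
        using ca[OF biadditive_left[OF b2] biadditive_right[OF b1 l']] biadditive_right[OF b2 p1.dext_closed[OF l']] by auto
      show "biadditive (dsum (carrier G) M) (dsum (carrier G) N) (dsum (carrier G) Z) (\<lambda>y z. dext G L Q Z op4 (dinj (carrier G) L \<alpha> l) (dext G M N Q op3 y z))"
        unfolding biadditive_def
        using ca[OF biadditive_right[OF b4 l'] biadditive_left[OF b3]] ca[OF biadditive_right[OF b4 l'] biadditive_right[OF b3]] by auto
      fix \<beta> \<gamma> m n assume *: "\<beta> \<in> carrier G" "\<gamma> \<in> carrier G" "m \<in> carrier (M \<beta>)" "n \<in> carrier (N \<gamma>)"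
      show "dext G P N Z op2 (dext G L M P op1 (dinj (carrier G) L \<alpha> l) (dinj (carrier G) M \<beta> m)) (dinj (carrier G) N \<gamma> n) =
        dext G L Q Z op4 (dinj (carrier G) L \<alpha> l) (dext G M N Q op3 (dinj (carrier G) M \<beta> m) (dinj (carrier G) N \<gamma> n))"
        using l * biadditive_closed[OF p1.op] biadditive_closed[OF p3.op]
        by (simp add: p1.dext_dinj p2.dext_dinj p3.dext_dinj p4.dext_dinj eq p1.G.m_assoc)
    qed
  qed
qed

section \<open>Direct sums of modules\<close>

lemma dsum_mod_simps [simp]:
  "carrier (dsum_mod I M) = carrier (dsum I M)" "zero (dsum_mod I M) = zero (dsum I M)"
  "add (dsum_mod I M) = add (dsum I M)" "ract (dsum_mod I M) = (\<lambda>x a. \<lambda>i\<in>I. x i \<triangleleft>\<^bsub>M i\<^esub> a)"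
  by (simp_all add: dsum_mod_def)

lemma ahom_dsum_mod [simp]:
  "ahom (dsum_mod I M) H = ahom (dsum I M) H" "ahom H (dsum_mod I M) = ahom H (dsum I M)"
  by (simp_all add: ahom_def)

lemma
  fixes M :: "'i \<Rightarrow> ('a, 'm, 'x) rmod_scheme"
  assumes A: "ring A" and M: "\<And>i. i \<in> I \<Longrightarrow> right_module A (M i)"
  shows dsum_mod_right_module: "right_module A (dsum_mod I M)"
    and dinj_rhom: "\<And>i. i \<in> I \<Longrightarrow> dinj I M i \<in> rhom A (M i) (dsum_mod I M)"
proof -
  interpret F: dsum_family I M
    by (rule dsum_family.intro) (rule right_module_abelian_group[OF M])
  interpret A: ring A by (rule A)
  interpret S: abelian_group "dsum_mod I M"
    by (rule abelian_group_transfer[OF F.abelian_group_S]) simp_all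
  have z: "\<zero>\<^bsub>M i\<^esub> \<triangleleft>\<^bsub>M i\<^esub> a = \<zero>\<^bsub>M i\<^esub>" if "i \<in> I" "a \<in> carrier A" for i a
    using ahom_zero[OF F.summand F.summand ahom_ract[OF M]] that by blast
  have c: "(\<lambda>i\<in>I. x i \<triangleleft>\<^bsub>M i\<^esub> a) \<in> carrier F.S" if x: "x \<in> carrier F.S" and a: "a \<in> carrier A" for x a
  proof -
    have "dsupp I M (\<lambda>i\<in>I. x i \<triangleleft>\<^bsub>M i\<^esub> a) \<subseteq> dsupp I M x"
      using a z by (auto simp: dsupp_def)
    then show ?thesis
      using F.S_apply[OF x] a right_module.ract_closed[OF M] finite_subset F.finite_dsupp[OF x]
      by (auto simp: F.carrier_S)
  qed
  have e: "x i = undefined" if "x \<in> carrier F.S" "i \<notin> I" for x i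
    using that by (auto simp: F.carrier_S)
  show "right_module A (dsum_mod I M)"
  proof unfold_locales
    fix x y a b assume x: "x \<in> carrier (dsum_mod I M)" and y: "y \<in> carrier (dsum_mod I M)"
      and a: "a \<in> carrier A" and b: "b \<in> carrier A"
    note xy = F.S_apply[of x, OF x[simplified]] F.S_apply[of y, OF y[simplified]]
    show "x \<triangleleft>\<^bsub>dsum_mod I M\<^esub> a \<in> carrier (dsum_mod I M)"
      using c x a by simp
    show "(x \<oplus>\<^bsub>dsum_mod I M\<^esub> y) \<triangleleft>\<^bsub>dsum_mod I M\<^esub> a = x \<triangleleft>\<^bsub>dsum_mod I M\<^esub> a \<oplus>\<^bsub>dsum_mod I M\<^esub> y \<triangleleft>\<^bsub>dsum_mod I M\<^esub> a"
      using xy a by (auto simp: F.add_S right_module.ract_add_left[OF M] intro!: restrict_ext)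
    show "x \<triangleleft>\<^bsub>dsum_mod I M\<^esub> (a \<oplus>\<^bsub>A\<^esub> b) = x \<triangleleft>\<^bsub>dsum_mod I M\<^esub> a \<oplus>\<^bsub>dsum_mod I M\<^esub> x \<triangleleft>\<^bsub>dsum_mod I M\<^esub> b"
      using xy a b by (auto simp: F.add_S right_module.ract_add_right[OF M] intro!: restrict_ext)
    show "x \<triangleleft>\<^bsub>dsum_mod I M\<^esub> (a \<otimes>\<^bsub>A\<^esub> b) = (x \<triangleleft>\<^bsub>dsum_mod I M\<^esub> a) \<triangleleft>\<^bsub>dsum_mod I M\<^esub> b"
      using xy a b by (auto simp: right_module.ract_mult[OF M] intro!: restrict_ext)
  next
    fix x assume x: "x \<in> carrier (dsum_mod I M)"
    show "x \<triangleleft>\<^bsub>dsum_mod I M\<^esub> \<one>\<^bsub>A\<^esub> = x"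
      using F.S_apply[of x] e[of x] x by (auto simp: right_module.ract_one[OF M])
  qed
  show "dinj I M i \<in> rhom A (M i) (dsum_mod I M)" if "i \<in> I" for i
    using that F.dinj_ahom[OF that] z by (intro rhomI) (auto simp: dinj_def)
qed

section \<open>Contraction\<close>

lemma lhom_cong:
  assumes f: "f \<in> lhom A M N" and g: "\<And>x. x \<in> carrier M \<Longrightarrow> f x = g x" and M: "bimodule A M"
  shows "g \<in> lhom A M N"
proof (rule lhomI)
  show "g \<in> ahom M N"
    by (rule ahom_cong[OF lhom_ahom[OF f] g right_module_abelian_group[OF bimodule_right_module[OF M]]])
  show "g (a \<triangleright>\<^bsub>M\<^esub> x) = a \<triangleright>\<^bsub>N\<^esub> g x" if "x \<in> carrier M" "a \<in> carrier A" for x a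
    using lhom_lact[OF f that] g[OF that(1)] g[OF bimodule.lact_closed[OF M that(2,1)]] by simp
qed

lemma lhom_comp: "\<lbrakk>g \<in> lhom A M N; f \<in> lhom A L M\<rbrakk> \<Longrightarrow> (\<lambda>x. g (f x)) \<in> lhom A L N"
  by (auto simp: lhom_def Pi_def)

text \<open>
  Elements of the dual ring are extensional, whereas compositions of maps are not; only the values on the
  carrier matter for contraction.
\<close>

lemma contract_cong:
  assumes "tensor_pair A M N" "f \<in> lhom A N (regular A)" "\<And>n. n \<in> carrier N \<Longrightarrow> f n = g n"
    "t \<in> carrier (tensor_group A M N)"
  shows "contract M f t = contract M g t"
proof -
  interpret tensor_pair A M N by fact
  have g: "g \<in> lhom A N (regular A)" by (rule lhom_cong[OF assms(2,3) right])
  show ?thesis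
    by (rule tensor_eqI[OF M.abelian_group_axioms contract_ahom[OF assms(1,2)] contract_ahom[OF assms(1) g] assms(4)])
      (simp add: contract_ptens[OF assms(1,2)] contract_ptens[OF assms(1) g] assms(3))
qed

text \<open>
  Naturality of contraction in both tensor factors.  Its instances say that comodule morphisms are linear
  over the dual ring, that counits are preserved, and that the square of functors commutes.
\<close>

lemma contract_tmap:
  assumes "tensor_pair A M N" "tensor_pair A M' N'" and j: "j \<in> rhom A M M'" and d: "d \<in> lhom A N N'"
    and h: "h \<in> lhom A N' (regular A)" and t: "t \<in> carrier (tensor_group A M N)"
  shows "contract M' h (tmap A M' N' j d t) = j (contract M (\<lambda>n. h (d n)) t)"
proof -
  interpret MN: tensor_pair A M N by fact
  interpret MN': tensor_pair A M' N' by fact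
  note hd = lhom_comp[OF h d]
  have hc: "h (d n) \<in> carrier A" if "n \<in> carrier N" for n
    using ahom_closed[OF lhom_ahom[OF hd] that] by simp
  show ?thesis
    by (rule MN.tensor_eqI[OF MN'.M.abelian_group_axioms
          ahom_comp[OF contract_ahom[OF assms(2) h] tmap_ahom[OF assms(1,2) j d]]
          ahom_comp[OF rhom_ahom[OF j] contract_ahom[OF assms(1) hd]] t])
      (simp add: tmap_ptens[OF assms(1,2) j d] contract_ptens[OF assms(2) h] contract_ptens[OF assms(1) hd]
        ahom_closed[OF rhom_ahom[OF j]] ahom_closed[OF lhom_ahom[OF d]] rhom_ract[OF j] hc)
qed

lemma contract_lhom:
  assumes C: "bimodule A C" and D: "bimodule A D" and f: "f \<in> lhom A D (regular A)"
  shows "contract C f \<in> lhom A (btensor A C D) C"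
proof (rule lhomI)
  interpret C: bimodule A C by (rule C)
  interpret tensor_pair A C D by (rule tensor_pair.intro[OF bimodule_right_module[OF C] D])
  note h = contract_ahom[OF tensor_pair_axioms f]
  show "contract C f \<in> ahom (btensor A C D) C" using h by simp
  have fc: "\<And>x. x \<in> carrier D \<Longrightarrow> f x \<in> carrier A" using ahom_closed[OF lhom_ahom[OF f]] by simp
  have l: "(\<lambda>x. a \<triangleright>\<^bsub>C\<^esub> x) \<in> ahom C C" if "a \<in> carrier A" for a
    using that by (intro ahomI) (simp_all add: C.lact_closed C.lact_add_right)
  fix t a assume t: "t \<in> carrier (btensor A C D)" and a: "a \<in> carrier A"
  show "contract C f (a \<triangleright>\<^bsub>btensor A C D\<^esub> t) = a \<triangleright>\<^bsub>C\<^esub> contract C f t"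
    by (rule tensor_eqI[OF C.abelian_group_axioms ahom_comp[OF h btensor_lact_ahom[OF C D a]]
          ahom_comp[OF l[OF a] h]])
      (use t a in \<open>simp_all add: btensor_lact_ptens[OF C D] contract_ptens[OF tensor_pair_axioms f]
         C.lact_closed C.lact_ract fc\<close>)
qed

text \<open>
  Write \<open>h\<close> for the functional \<open>x \<otimes> y \<mapsto> g(x f(y))\<close> on \<open>C \<otimes> D\<close>.  Contracting with \<open>f\<close>, applying
  the coaction and contracting with \<open>g\<close> amounts to contracting \<open>(\<rho> \<otimes> D)(s)\<close>, reassociated, with \<open>h\<close>,
  because \<open>\<rho>\<close> is right linear: \<open>\<rho>(m f(y)) = \<rho>(m) f(y)\<close>.  Coassociativity turns this element into
  \<open>(N \<otimes> d)(t)\<close>, and contracting that with \<open>h\<close> is contracting \<open>t\<close> with \<open>h \<circ> d\<close>.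
\<close>

lemma contract_contract:
  assumes M: "right_module A M" and N: "right_module A N" and C: "bimodule A C" and D: "bimodule A D"
    and E: "bimodule A E" and d: "d \<in> lhom A E (btensor A C D)"
    and f: "f \<in> lhom A D (regular A)" and g: "g \<in> lhom A C (regular A)"
    and rho: "rho \<in> rhom A M (tensor A N C)"
    and s: "s \<in> carrier (tensor_group A M D)" and t: "t \<in> carrier (tensor_group A N E)"
    and coassoc: "tmap A N (btensor A C D) (\<lambda>z. z) d t = tassoc A N C D (tmap A (tensor A N C) D rho (\<lambda>z. z) s)"
  shows "contract N g (rho (contract M f s)) = contract N (\<lambda>e. g (contract C f (d e))) t"
proof -
  interpret MD: tensor_pair A M D by (rule tensor_pair.intro[OF M D])
  interpret NE: tensor_pair A N E by (rule tensor_pair.intro[OF N E])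
  interpret NC: tensor_pair A N C by (rule tensor_pair.intro[OF N C])
  note CD = tensor_pair.intro[OF bimodule_right_module[OF C] D]
  note NCD = tensor_pair.intro[OF NC.tensor_right_module D]
  note N_CD = tensor_pair.intro[OF N btensor_bimodule[OF C D]]
  note ag = right_module_abelian_group[OF N]
  let ?h = "\<lambda>z. g (contract C f z)" and ?ta = "tassoc A N C D"
  note cf = contract_lhom[OF C D f]
  note h = lhom_comp[OF g cf]
  note ch = contract_ahom[OF N_CD h] and cg = contract_ahom[OF NC.tensor_pair_axioms g]
    and ta = tassoc_ahom[OF N C D]
  have fc: "\<And>x. x \<in> carrier D \<Longrightarrow> f x \<in> carrier A" using ahom_closed[OF lhom_ahom[OF f]] by simp
  have inner: "contract N g (u \<triangleleft>\<^bsub>tensor A N C\<^esub> f c) = contract N ?h (?ta (ptens A (tensor A N C) D u c))"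
    if u: "u \<in> carrier (tensor_group A N C)" and c: "c \<in> carrier D" for u c
  proof (rule NC.tensor_eqI[OF ag _ _ u])
    show "(\<lambda>u. contract N g (u \<triangleleft>\<^bsub>tensor A N C\<^esub> f c)) \<in> ahom NC.T N"
      by (rule ahom_comp[OF cg NC.tensor_ract_ahom[OF fc[OF c]]])
    have "(\<lambda>u. ptens A (tensor A N C) D u c) \<in> ahom NC.T (tensor_group A (tensor A N C) D)"
      using biadditive_left[OF balanced_biadditive[OF tensor_pair.balanced_ptens[OF NCD]] c] by simp
    then show "(\<lambda>u. contract N ?h (?ta (ptens A (tensor A N C) D u c))) \<in> ahom NC.T N"
      by (intro ahom_comp[OF ch] ahom_comp[OF ta])
    fix n x assume nx: "n \<in> carrier N" "x \<in> carrier C"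
    have "ptens A C D x c \<in> carrier (btensor A C D)"
      using tensor_pair.ptens_closed[OF CD nx(2) c] by simp
    then show "contract N g (ptens A N C n x \<triangleleft>\<^bsub>tensor A N C\<^esub> f c) =
        contract N ?h (?ta (ptens A (tensor A N C) D (ptens A N C n x) c))"
      using nx c
      by (simp add: NC.tensor_ract_ptens fc tassoc_ptens[OF N C D] contract_ptens[OF NC.tensor_pair_axioms g]
          contract_ptens[OF N_CD h] contract_ptens[OF CD f] NC.N.ract_closed)
  qed
  note tr = tmap_ahom[OF MD.tensor_pair_axioms NCD rho lhom_id]
  have "contract N g (rho (contract M f s)) = contract N ?h (?ta (tmap A (tensor A N C) D rho (\<lambda>z. z) s))"
  proof (rule MD.tensor_eqI[OF ag _ _ s])
    show "(\<lambda>s. contract N g (rho (contract M f s))) \<in> ahom MD.T N"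
      using rhom_ahom[OF rho] by (intro ahom_comp[OF cg] ahom_comp[OF _ contract_ahom[OF MD.tensor_pair_axioms f]]) simp
    show "(\<lambda>s. contract N ?h (?ta (tmap A (tensor A N C) D rho (\<lambda>z. z) s))) \<in> ahom MD.T N"
      by (intro ahom_comp[OF ch] ahom_comp[OF ta] tr)
    fix m c assume mc: "m \<in> carrier M" "c \<in> carrier D"
    have "rho m \<in> carrier NC.T" using ahom_closed[OF rhom_ahom[OF rho] mc(1)] by simp
    from inner[OF this mc(2)] mc
    show "contract N g (rho (contract M f (ptens A M D m c))) =
        contract N ?h (?ta (tmap A (tensor A N C) D rho (\<lambda>z. z) (ptens A M D m c)))"
      by (simp add: contract_ptens[OF MD.tensor_pair_axioms f] rhom_ract[OF rho] fc
          tmap_ptens[OF MD.tensor_pair_axioms NCD rho lhom_id])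
  qed
  also have "\<dots> = contract N ?h (tmap A N (btensor A C D) (\<lambda>z. z) d t)"
    by (simp add: coassoc)
  also have "\<dots> = contract N (\<lambda>e. g (contract C f (d e))) t"
    by (rule contract_tmap[OF NE.tensor_pair_axioms N_CD rhom_id d h t])
  finally show ?thesis .
qed

lemma runit_tmap_counit:
  assumes M: "right_module A M" and C: "bimodule A C" and e: "e \<in> lhom A C (regular A)"
    and t: "t \<in> carrier (tensor_group A M C)"
  shows "runit M (tmap A M (regular A) (\<lambda>z. z) e t) = contract M e t"
  unfolding runit_eq_contract
  using contract_tmap[OF tensor_pair.intro[OF M C] tensor_pair.intro[OF M regular_bimodule] rhom_id e lhom_id t]
    right_module_ring[OF M] by simp

lemma tlift_comp:
  assumes "tensor_pair A M N" "abelian_group H" "abelian_group H'" "balanced A M N H b" "h \<in> ahom H H'"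
    "t \<in> carrier (tensor_group A M N)"
  shows "tlift H' (\<lambda>m n. h (b m n)) t = h (tlift H b t)"
proof -
  interpret tensor_pair A M N by fact
  have b: "balanced A M N H' (\<lambda>m n. h (b m n))"
    using assms(4) unfolding balanced_def biadditive_def by (auto intro: ahom_comp[OF assms(5)])
  show ?thesis
    by (rule tensor_eqI[OF assms(3) tlift_ahom[OF assms(3) b] ahom_comp[OF assms(5) tlift_ahom[OF assms(2,4)]] assms(6)])
      (simp add: tlift_ptens[OF assms(3) b] tlift_ptens[OF assms(2,4)])
qed

text \<open>
  Coassociativity of the coring mentions the bimodule \<open>C \<otimes> C\<close>, that of a comodule the right module
  \<open>M \<otimes> C\<close>; for the coring as a comodule over itself the two agree.
\<close>

lemma tmap_btensor: "tmap A (btensor A M N) P = tmap A (tensor A M N) P"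
  by (rule tmap_cong) simp_all

section \<open>The left dual graded ring\<close>

context group_coring
begin

text \<open>
  The component \<open>R\<^sub>\<alpha>\<close> consists of functionals on \<open>D \<alpha>\<close>, the part of the coring in degree
  \<open>\<alpha>\<inverse>\<close>.
\<close>

abbreviation gmult (infixl "\<cdot>" 70) where "gmult \<equiv> monoid.mult G"
abbreviation ginv ("\<iota>") where "ginv \<equiv> m_inv G"
abbreviation D where "D \<alpha> \<equiv> cmod C (\<iota> \<alpha>)"
abbreviation Q where "Q \<equiv> dual_comp G A C"
abbreviation R where "R \<equiv> dual_ring G A C"
abbreviation dual_prod (infixl "\<star>" 70) where "r \<star> s \<equiv> dext G Q Q Q (dual_mult G A C) r s"

lemma cmod_right_module: "\<alpha> \<in> carrier G \<Longrightarrow> right_module A (cmod C \<alpha>)"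
  by (rule bimodule_right_module[OF cmod_bimodule])

lemma tensor_pair_cmod: "\<lbrakk>right_module A M; \<alpha> \<in> carrier G\<rbrakk> \<Longrightarrow> tensor_pair A M (cmod C \<alpha>)"
  by (rule tensor_pair.intro[OF _ cmod_bimodule])

lemma comult_rhom:
  "\<lbrakk>\<alpha> \<in> carrier G; \<beta> \<in> carrier G\<rbrakk> \<Longrightarrow>
   comult C \<alpha> \<beta> \<in> rhom A (cmod C (\<alpha> \<cdot> \<beta>)) (tensor A (cmod C \<alpha>) (cmod C \<beta>))"
  using comult_hom[of \<alpha> \<beta>] by (auto simp: rhom_def)

lemma comult_lhom:
  "\<lbrakk>\<alpha> \<in> carrier G; \<beta> \<in> carrier G\<rbrakk> \<Longrightarrow>
   comult C \<alpha> \<beta> \<in> lhom A (cmod C (\<alpha> \<cdot> \<beta>)) (btensor A (cmod C \<alpha>) (cmod C \<beta>))"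
  using comult_hom by blast

lemma comult_closed:
  "\<lbrakk>\<alpha> \<in> carrier G; \<beta> \<in> carrier G; c \<in> carrier (cmod C (\<alpha> \<cdot> \<beta>))\<rbrakk> \<Longrightarrow>
   comult C \<alpha> \<beta> c \<in> carrier (tensor_group A (cmod C \<alpha>) (cmod C \<beta>))"
  using ahom_closed[OF rhom_ahom[OF comult_rhom]] by simp

lemma counit_lhom: "counit C \<in> lhom A (cmod C \<one>\<^bsub>G\<^esub>) (regular A)"
  using counit_hom by blast

lemma dual_carrier: "carrier (Q \<alpha>) = lhom A (D \<alpha>) (regular A) \<inter> extensional (carrier (D \<alpha>))"
  by (simp add: dual_comp_def Let_def)

lemma dual_zero: "\<zero>\<^bsub>Q \<alpha>\<^esub> = (\<lambda>c\<in>carrier (D \<alpha>). \<zero>\<^bsub>A\<^esub>)"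
  by (simp add: dual_comp_def Let_def)

lemma dual_add: "f \<oplus>\<^bsub>Q \<alpha>\<^esub> g = (\<lambda>c\<in>carrier (D \<alpha>). f c \<oplus>\<^bsub>A\<^esub> g c)"
  by (simp add: dual_comp_def Let_def)

lemma dual_add_apply: "c \<in> carrier (D \<alpha>) \<Longrightarrow> (f \<oplus>\<^bsub>Q \<alpha>\<^esub> g) c = f c \<oplus>\<^bsub>A\<^esub> g c"
  by (simp add: dual_add)

lemma dual_lhom: "f \<in> carrier (Q \<alpha>) \<Longrightarrow> f \<in> lhom A (D \<alpha>) (regular A)"
  by (simp add: dual_carrier)

lemma dual_ahom: "f \<in> carrier (Q \<alpha>) \<Longrightarrow> f \<in> ahom (D \<alpha>) A"
  using lhom_ahom[OF dual_lhom] by (simp add: ahom_def)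

lemma dual_apply_closed: "\<lbrakk>f \<in> carrier (Q \<alpha>); c \<in> carrier (D \<alpha>)\<rbrakk> \<Longrightarrow> f c \<in> carrier A"
  using ahom_closed[OF dual_ahom] .

lemma dual_ext:
  "\<lbrakk>f \<in> carrier (Q \<alpha>); g \<in> carrier (Q \<alpha>); \<And>c. c \<in> carrier (D \<alpha>) \<Longrightarrow> f c = g c\<rbrakk> \<Longrightarrow> f = g"
  by (auto simp: dual_carrier intro: extensionalityI)

lemma restrict_lhom:
  assumes "bimodule A M" "f \<in> lhom A M N" shows "restrict f (carrier M) \<in> lhom A M N"
  by (rule lhom_cong[OF assms(2) _ assms(1)]) simp

lemma dualI:
  assumes "\<alpha> \<in> carrier G" "f \<in> lhom A (D \<alpha>) (regular A)"
  shows "restrict f (carrier (D \<alpha>)) \<in> carrier (Q \<alpha>)"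
  using restrict_lhom[OF cmod_bimodule assms(2)] assms(1) by (simp add: dual_carrier)

lemma dual_abelian_group: assumes a: "\<alpha> \<in> carrier G" shows "abelian_group (Q \<alpha>)"
proof -
  interpret D: bimodule A "D \<alpha>" using a by (intro cmod_bimodule) simp
  show ?thesis
  proof (rule abelian_groupI)
    fix f g assume f: "f \<in> carrier (Q \<alpha>)" and g: "g \<in> carrier (Q \<alpha>)"
    note fa = dual_apply_closed[OF f] lhom_lact[OF dual_lhom[OF f], simplified] ahom_add[OF dual_ahom[OF f]]
    note ga = dual_apply_closed[OF g] lhom_lact[OF dual_lhom[OF g], simplified] ahom_add[OF dual_ahom[OF g]]
    show "f \<oplus>\<^bsub>Q \<alpha>\<^esub> g \<in> carrier (Q \<alpha>)"
      unfolding dual_add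
      by (rule dualI[OF a], rule lhomI, rule ahomI) (simp_all add: fa ga A.a_ac A.r_distr)
    show "f \<oplus>\<^bsub>Q \<alpha>\<^esub> g = g \<oplus>\<^bsub>Q \<alpha>\<^esub> f"
      unfolding dual_add by (rule restrict_ext) (simp add: fa ga A.a_comm)
    fix h assume h: "h \<in> carrier (Q \<alpha>)"
    show "f \<oplus>\<^bsub>Q \<alpha>\<^esub> g \<oplus>\<^bsub>Q \<alpha>\<^esub> h = f \<oplus>\<^bsub>Q \<alpha>\<^esub> (g \<oplus>\<^bsub>Q \<alpha>\<^esub> h)"
      unfolding dual_add by (rule restrict_ext) (simp add: fa ga dual_apply_closed[OF h] A.a_assoc)
  next
    show "\<zero>\<^bsub>Q \<alpha>\<^esub> \<in> carrier (Q \<alpha>)"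
      unfolding dual_zero by (rule dualI[OF a], rule lhomI, rule ahomI) simp_all
  next
    fix f assume f: "f \<in> carrier (Q \<alpha>)"
    note fa = dual_apply_closed[OF f] lhom_lact[OF dual_lhom[OF f], simplified] ahom_add[OF dual_ahom[OF f]]
    show "\<zero>\<^bsub>Q \<alpha>\<^esub> \<oplus>\<^bsub>Q \<alpha>\<^esub> f = f"
      unfolding dual_add dual_zero
      using f by (intro extensionalityI[of _ "carrier (D \<alpha>)"]) (simp_all add: fa dual_carrier)
    have "(\<lambda>c\<in>carrier (D \<alpha>). \<ominus>\<^bsub>A\<^esub> f c) \<in> carrier (Q \<alpha>)"
      by (rule dualI[OF a], rule lhomI, rule ahomI) (simp_all add: fa A.minus_add A.r_minus)
    moreover have "(\<lambda>c\<in>carrier (D \<alpha>). \<ominus>\<^bsub>A\<^esub> f c) \<oplus>\<^bsub>Q \<alpha>\<^esub> f = \<zero>\<^bsub>Q \<alpha>\<^esub>"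
      unfolding dual_add dual_zero by (rule restrict_ext) (simp add: fa A.l_neg)
    ultimately show "\<exists>g\<in>carrier (Q \<alpha>). g \<oplus>\<^bsub>Q \<alpha>\<^esub> f = \<zero>\<^bsub>Q \<alpha>\<^esub>" by blast
  qed
qed

lemma dual_family: "dsum_family (carrier G) Q"
  by (rule dsum_family.intro[OF dual_abelian_group])

lemma contract_dual_ahom:
  assumes M: "right_module A M" and b: "\<beta> \<in> carrier G"
    and t: "t \<in> carrier (tensor_group A M (D \<beta>))"
  shows "(\<lambda>f. contract M f t) \<in> ahom (Q \<beta>) M"
proof (rule ahomI)
  interpret tensor_pair A M "D \<beta>" using M b by (intro tensor_pair_cmod) simp_all
  interpret Qb: abelian_group "Q \<beta>" by (rule dual_abelian_group[OF b])
  note tp = tensor_pair_axioms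
  show "contract M f t \<in> carrier M" if "f \<in> carrier (Q \<beta>)" for f
    using ahom_closed[OF contract_ahom[OF tp dual_lhom[OF that]] t] .
  fix f g assume f: "f \<in> carrier (Q \<beta>)" and g: "g \<in> carrier (Q \<beta>)"
  note fg = Qb.a_closed[OF f g]
  show "contract M (f \<oplus>\<^bsub>Q \<beta>\<^esub> g) t = contract M f t \<oplus>\<^bsub>M\<^esub> contract M g t"
    by (rule tensor_eqI[OF M.abelian_group_axioms contract_ahom[OF tp dual_lhom[OF fg]]
          ahom_pointwise_add[OF M.abelian_group_axioms contract_ahom[OF tp dual_lhom[OF f]]
            contract_ahom[OF tp dual_lhom[OF g]]] t])
      (simp add: contract_ptens[OF tp dual_lhom[OF f]] contract_ptens[OF tp dual_lhom[OF g]]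
        contract_ptens[OF tp dual_lhom[OF fg]] dual_add_apply dual_apply_closed[OF f] dual_apply_closed[OF g] M.ract_add_right)
qed

lemma contract_coaction_biadditive:
  assumes N: "right_module A N" and b: "\<beta> \<in> carrier G"
    and rho: "rho \<in> ahom M (tensor_group A N (D \<beta>))"
  shows "biadditive M (Q \<beta>) N (\<lambda>m f. contract N f (rho m))"
  unfolding biadditive_def
proof (intro conjI ballI)
  have tp: "tensor_pair A N (D \<beta>)" using N b by (intro tensor_pair_cmod) simp_all
  show "(\<lambda>m. contract N f (rho m)) \<in> ahom M N" if "f \<in> carrier (Q \<beta>)" for f
    by (rule ahom_comp[OF contract_ahom[OF tp dual_lhom[OF that]] rho])
  show "(\<lambda>f. contract N f (rho m)) \<in> ahom (Q \<beta>) N" if "m \<in> carrier M" for m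
    by (rule contract_dual_ahom[OF N b ahom_closed[OF rho that]])
qed

text \<open>
  The coring acts as a comodule over itself: \<open>c \<cdot> f = c\<^sub>1 f(c\<^sub>2)\<close>, and \<open>f # g\<close> is \<open>g\<close> applied to it.
\<close>

lemma dual_mult_eq:
  assumes ab: "\<alpha> \<in> carrier G" "\<beta> \<in> carrier G" and f: "f \<in> carrier (Q \<alpha>)" and g: "g \<in> carrier (Q \<beta>)"
    and c: "c \<in> carrier (D (\<alpha> \<cdot> \<beta>))"
  shows "dual_mult G A C \<alpha> \<beta> f g c =
    g (contract (D \<beta>) f (comult C (\<iota> \<beta>) (\<iota> \<alpha>) c))"
proof -
  have tp: "tensor_pair A (D \<beta>) (D \<alpha>)"
    using ab by (intro tensor_pair_cmod cmod_right_module) auto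
  have "comult C (\<iota> \<beta>) (\<iota> \<alpha>) c \<in> carrier (tensor_group A (D \<beta>) (D \<alpha>))"
    using ab c by (intro comult_closed) (auto simp: G.inv_mult_group)
  from tlift_comp[OF tp _ A.abelian_group_axioms balanced_contract[OF tp dual_lhom[OF f]] dual_ahom[OF g] this] c
  show ?thesis
    using tensor_pair.left[OF tp] by (simp add: dual_mult_def contract_def right_module_abelian_group)
qed

lemma dual_mult_lhom:
  assumes ab: "\<alpha> \<in> carrier G" "\<beta> \<in> carrier G" and f: "f \<in> carrier (Q \<alpha>)" and g: "g \<in> carrier (Q \<beta>)"
  shows "(\<lambda>c. g (contract (D \<beta>) f (comult C (\<iota> \<beta>) (\<iota> \<alpha>) c)))
    \<in> lhom A (D (\<alpha> \<cdot> \<beta>)) (regular A)"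
proof -
  have c: "contract (D \<beta>) f \<in> lhom A (btensor A (D \<beta>) (D \<alpha>)) (D \<beta>)"
    using ab by (intro contract_lhom cmod_bimodule dual_lhom[OF f]) auto
  have d: "comult C (\<iota> \<beta>) (\<iota> \<alpha>) \<in>
      lhom A (D (\<alpha> \<cdot> \<beta>)) (btensor A (D \<beta>) (D \<alpha>))"
    using comult_lhom[of "\<iota> \<beta>" "\<iota> \<alpha>"] ab by (simp add: G.inv_mult_group)
  show ?thesis
    by (rule lhom_comp[OF dual_lhom[OF g] lhom_comp[OF c d]])
qed

lemma dual_mult_closed:
  assumes ab: "\<alpha> \<in> carrier G" "\<beta> \<in> carrier G" and f: "f \<in> carrier (Q \<alpha>)" and g: "g \<in> carrier (Q \<beta>)"
  shows "dual_mult G A C \<alpha> \<beta> f g \<in> carrier (Q (\<alpha> \<cdot> \<beta>))"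
proof -
  have "dual_mult G A C \<alpha> \<beta> f g = restrict (\<lambda>c. g (contract (D \<beta>) f (comult C (\<iota> \<beta>) (\<iota> \<alpha>) c)))
      (carrier (D (\<alpha> \<cdot> \<beta>)))"
    using dual_mult_eq[OF assms] by (auto simp: dual_mult_def)
  then show ?thesis
    using dualI[OF _ dual_mult_lhom[OF assms]] ab by simp
qed

text \<open>
  The form of \<open>contract_contract\<close> from which all three associativity laws follow: for the ring itself,
  for graded comodules and for comodules.
\<close>

lemma coaction_dual_mult:
  assumes M: "right_module A M" and N: "right_module A N" and ab: "\<alpha> \<in> carrier G" "\<beta> \<in> carrier G"
    and f: "f \<in> carrier (Q \<alpha>)" and g: "g \<in> carrier (Q \<beta>)"
    and rho: "rho \<in> rhom A M (tensor A N (D \<beta>))"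
    and s: "s \<in> carrier (tensor_group A M (D \<alpha>))"
    and t: "t \<in> carrier (tensor_group A N (D (\<alpha> \<cdot> \<beta>)))"
    and coassoc: "tmap A N (btensor A (D \<beta>) (D \<alpha>)) (\<lambda>z. z)
        (comult C (\<iota> \<beta>) (\<iota> \<alpha>)) t =
      tassoc A N (D \<beta>) (D \<alpha>)
        (tmap A (tensor A N (D \<beta>)) (D \<alpha>) rho (\<lambda>z. z) s)"
  shows "contract N g (rho (contract M f s)) = contract N (dual_mult G A C \<alpha> \<beta> f g) t"
proof -
  have d: "comult C (\<iota> \<beta>) (\<iota> \<alpha>) \<in>
      lhom A (D (\<alpha> \<cdot> \<beta>)) (btensor A (D \<beta>) (D \<alpha>))"
    using comult_lhom[of "\<iota> \<beta>" "\<iota> \<alpha>"] ab by (simp add: G.inv_mult_group)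
  have "contract N g (rho (contract M f s)) =
    contract N (\<lambda>e. g (contract (D \<beta>) f (comult C (\<iota> \<beta>) (\<iota> \<alpha>) e))) t"
    using ab by (intro contract_contract[OF M N _ _ _ d dual_lhom[OF f] dual_lhom[OF g] rho s t coassoc] cmod_bimodule) auto
  also have "\<dots> = contract N (dual_mult G A C \<alpha> \<beta> f g) t"
    using ab by (intro contract_cong[OF tensor_pair_cmod[OF N] dual_mult_lhom[OF ab f g] _ t])
      (auto simp: dual_mult_eq[OF ab f g])
  finally show ?thesis .
qed

text \<open>
  Both sides send \<open>c\<close> to \<open>h((c \<cdot> f) \<cdot> g) = h(c \<cdot> (f # g))\<close>.
\<close>

lemma dual_mult_assoc:
  assumes abg: "\<alpha> \<in> carrier G" "\<beta> \<in> carrier G" "\<gamma> \<in> carrier G"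
    and f: "f \<in> carrier (Q \<alpha>)" and g: "g \<in> carrier (Q \<beta>)" and h: "h \<in> carrier (Q \<gamma>)"
  shows "dual_mult G A C (\<alpha> \<cdot> \<beta>) \<gamma> (dual_mult G A C \<alpha> \<beta> f g) h =
    dual_mult G A C \<alpha> (\<beta> \<cdot> \<gamma>) f (dual_mult G A C \<beta> \<gamma> g h)"
proof (rule dual_ext)
  show "dual_mult G A C (\<alpha> \<cdot> \<beta>) \<gamma> (dual_mult G A C \<alpha> \<beta> f g) h \<in> carrier (Q (\<alpha> \<cdot> \<beta> \<cdot> \<gamma>))"
    using assms by (intro dual_mult_closed) auto
  show "dual_mult G A C \<alpha> (\<beta> \<cdot> \<gamma>) f (dual_mult G A C \<beta> \<gamma> g h) \<in> carrier (Q (\<alpha> \<cdot> \<beta> \<cdot> \<gamma>))"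
    using dual_mult_closed[of \<alpha> "\<beta> \<cdot> \<gamma>" f "dual_mult G A C \<beta> \<gamma> g h"] assms
    by (simp add: dual_mult_closed G.m_assoc)
  fix c assume c: "c \<in> carrier (D (\<alpha> \<cdot> \<beta> \<cdot> \<gamma>))"
  let ?a = "\<iota> \<alpha>" and ?b = "\<iota> \<beta>" and ?g = "\<iota> \<gamma>"
  let ?bg = "\<iota> (\<beta> \<cdot> \<gamma>)" and ?ab = "\<iota> (\<alpha> \<cdot> \<beta>)"
  have i: "?a \<in> carrier G" "?b \<in> carrier G" "?g \<in> carrier G" "?bg \<in> carrier G" "?ab \<in> carrier G"
    using abg by auto
  have e: "?bg = ?g \<cdot> ?b" "?ab = ?b \<cdot> ?a"
    "\<iota> (\<alpha> \<cdot> \<beta> \<cdot> \<gamma>) = ?g \<cdot> ?b \<cdot> ?a" "?g \<cdot> ?b \<cdot> ?a = ?g \<cdot> (?b \<cdot> ?a)"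
    using abg i by (simp_all add: G.inv_mult_group G.m_assoc)
  have s: "comult C ?bg ?a c \<in> carrier (tensor_group A (cmod C ?bg) (cmod C ?a))"
    using c i e by (intro comult_closed) auto
  have t: "comult C ?g ?ab c \<in> carrier (tensor_group A (cmod C ?g) (cmod C ?ab))"
    using c i e by (intro comult_closed) auto
  have key: "contract (cmod C ?g) g (comult C ?g ?b (contract (cmod C ?bg) f (comult C ?bg ?a c))) =
    contract (cmod C ?g) (dual_mult G A C \<alpha> \<beta> f g) (comult C ?g ?ab c)"
    by (rule coaction_dual_mult[OF cmod_right_module cmod_right_module abg(1,2) f g _ s t])
      (use i e c comult_rhom[OF i(3,2)] coassoc[OF i(3,2,1), of c, symmetric] in \<open>simp_all add: tmap_btensor\<close>)
  have c': "contract (cmod C ?bg) f (comult C ?bg ?a c) \<in> carrier (cmod C ?bg)"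
    by (rule ahom_closed[OF contract_ahom[OF tensor_pair_cmod[OF cmod_right_module] dual_lhom[OF f]] s])
      (use i in auto)
  have "dual_mult G A C (\<alpha> \<cdot> \<beta>) \<gamma> (dual_mult G A C \<alpha> \<beta> f g) h c =
      h (contract (cmod C ?g) (dual_mult G A C \<alpha> \<beta> f g) (comult C ?g ?ab c))"
    using abg c by (intro dual_mult_eq dual_mult_closed f g h) auto
  also have "\<dots> = dual_mult G A C \<beta> \<gamma> g h (contract (cmod C ?bg) f (comult C ?bg ?a c))"
    using dual_mult_eq[OF abg(2,3) g h c'] key by simp
  also have "\<dots> = dual_mult G A C \<alpha> (\<beta> \<cdot> \<gamma>) f (dual_mult G A C \<beta> \<gamma> g h) c"
    using abg c by (intro dual_mult_eq[symmetric] dual_mult_closed f g h) (auto simp: G.m_assoc)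
  finally show "dual_mult G A C (\<alpha> \<cdot> \<beta>) \<gamma> (dual_mult G A C \<alpha> \<beta> f g) h c =
    dual_mult G A C \<alpha> (\<beta> \<cdot> \<gamma>) f (dual_mult G A C \<beta> \<gamma> g h) c" .
qed

text \<open>
  The elements of the dual components are extensional, so the counit has to be restricted to become the
  unit of the dual ring.
\<close>

abbreviation eps where "eps \<equiv> restrict (counit C) (carrier (cmod C \<one>\<^bsub>G\<^esub>))"

lemma eps_closed: "eps \<in> carrier (Q \<one>\<^bsub>G\<^esub>)"
  using dualI[of "\<one>\<^bsub>G\<^esub>" "counit C"] counit_lhom by simp

lemma contract_eps:
  assumes M: "right_module A M" and t: "t \<in> carrier (tensor_group A M (cmod C \<one>\<^bsub>G\<^esub>))"
  shows "contract M eps t = runit M (tmap A M (regular A) (\<lambda>z. z) (counit C) t)"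
proof -
  have "contract M (counit C) t = contract M eps t"
    by (rule contract_cong[OF tensor_pair_cmod[OF M] counit_lhom _ t]) auto
  then show ?thesis
    using runit_tmap_counit[OF M cmod_bimodule counit_lhom t] by simp
qed

text \<open>
  By right counitality, \<open>c \<cdot> \<epsilon> = c\<close>.
\<close>

lemma dual_mult_eps_left:
  assumes a: "\<alpha> \<in> carrier G" and f: "f \<in> carrier (Q \<alpha>)"
  shows "dual_mult G A C \<one>\<^bsub>G\<^esub> \<alpha> eps f = f"
proof (rule dual_ext)
  show "dual_mult G A C \<one>\<^bsub>G\<^esub> \<alpha> eps f \<in> carrier (Q \<alpha>)"
    using dual_mult_closed[OF G.one_closed a eps_closed f] a by simp
  fix c assume c: "c \<in> carrier (D \<alpha>)"
  have t: "comult C (\<iota> \<alpha>) \<one>\<^bsub>G\<^esub> c \<in> carrier (tensor_group A (D \<alpha>) (cmod C \<one>\<^bsub>G\<^esub>))"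
    using a c by (intro comult_closed) auto
  show "dual_mult G A C \<one>\<^bsub>G\<^esub> \<alpha> eps f c = f c"
    using dual_mult_eq[OF G.one_closed a eps_closed f, of c] a c contract_eps[OF cmod_right_module t]
      counit_right[of "\<iota> \<alpha>" c] by simp
qed (rule f)

text \<open>
  Here left counitality is needed: the counit is applied to the first factor of \<open>c\<^sub>1 \<otimes> c\<^sub>2\<close>.
\<close>

lemma dual_mult_eps_right:
  assumes a: "\<alpha> \<in> carrier G" and f: "f \<in> carrier (Q \<alpha>)"
  shows "dual_mult G A C \<alpha> \<one>\<^bsub>G\<^esub> f eps = f"
proof (rule dual_ext)
  show "dual_mult G A C \<alpha> \<one>\<^bsub>G\<^esub> f eps \<in> carrier (Q \<alpha>)"
    using dual_mult_closed[OF a G.one_closed f eps_closed] a by simp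
  fix c assume c: "c \<in> carrier (D \<alpha>)"
  let ?a = "\<iota> \<alpha>" and ?C = "D \<alpha>" and ?E = "cmod C \<one>\<^bsub>G\<^esub>"
  have a': "?a \<in> carrier G" using a by simp
  interpret Ca: bimodule A ?C by (rule cmod_bimodule[OF a'])
  interpret E: bimodule A ?E by (rule cmod_bimodule[OF G.one_closed])
  note EC = tensor_pair_cmod[OF E.right_module_axioms a']
  note RA = regular_bimodule[OF A.ring_axioms]
  note RC = tensor_pair_cmod[OF bimodule_right_module[OF RA] a']
  have er: "counit C \<in> rhom A ?E (regular A)" using counit_hom by blast
  have ea: "eps \<in> ahom ?E A" using dual_ahom[OF eps_closed] by simp
  have ec: "\<And>x. x \<in> carrier ?E \<Longrightarrow> counit C x \<in> carrier A"
    using ahom_closed[OF rhom_ahom[OF er]] by simp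
  have t: "comult C \<one>\<^bsub>G\<^esub> ?a c \<in> carrier (tensor_group A ?E ?C)"
    using a c by (intro comult_closed) auto
  have bl: "balanced A (regular A) ?C ?C (\<lambda>x m. x \<triangleright>\<^bsub>?C\<^esub> m)"
    by (rule balancedI)
      (auto intro!: ahomI simp: Ca.lact_closed Ca.lact_add_left Ca.lact_add_right Ca.lact_mult)
  note lu = tensor_pair.tlift_ahom[OF RC Ca.abelian_group_axioms bl, folded lunit_def]
    and lp = tensor_pair.tlift_ptens[OF RC Ca.abelian_group_axioms bl, folded lunit_def]
  note tm = tmap_ahom[OF EC RC er lhom_id] and tp = tmap_ptens[OF EC RC er lhom_id]
  \<comment> \<open>\<open>\<epsilon>(x f(y)) = \<epsilon>(x) f(y) = f(\<epsilon>(x) y)\<close>\<close>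
  have "eps (contract ?E f u) = f (lunit ?C (tmap A (regular A) ?C (counit C) (\<lambda>z. z) u))"
    if u: "u \<in> carrier (tensor_group A ?E ?C)" for u
  proof (rule tensor_pair.tensor_eqI[OF EC A.abelian_group_axioms
        ahom_comp[OF ea contract_ahom[OF EC dual_lhom[OF f]]] ahom_comp[OF dual_ahom[OF f] ahom_comp[OF lu tm]] u])
    fix x y assume xy: "x \<in> carrier ?E" "y \<in> carrier ?C"
    then show "eps (contract ?E f (ptens A ?E ?C x y)) =
        f (lunit ?C (tmap A (regular A) ?C (counit C) (\<lambda>z. z) (ptens A ?E ?C x y)))"
      using lhom_lact[OF dual_lhom[OF f], of y "counit C x"] rhom_ract[OF er, of x "f y"]
        dual_apply_closed[OF f xy(2)] ec[OF xy(1)]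
      by (simp add: contract_ptens[OF EC dual_lhom[OF f]] tp lp E.ract_closed)
  qed
  from this[OF t] show "dual_mult G A C \<alpha> \<one>\<^bsub>G\<^esub> f eps c = f c"
    using dual_mult_eq[OF a G.one_closed f eps_closed, of c] a c counit_left[OF a' c] by simp
qed (rule f)

lemma dual_mult_biadditive:
  assumes ab: "\<alpha> \<in> carrier G" "\<beta> \<in> carrier G"
  shows "biadditive (Q \<alpha>) (Q \<beta>) (Q (\<alpha> \<cdot> \<beta>)) (dual_mult G A C \<alpha> \<beta>)"
proof -
  let ?a = "\<iota> \<alpha>" and ?b = "\<iota> \<beta>" and ?ab = "\<iota> (\<alpha> \<cdot> \<beta>)"
  interpret Qa: abelian_group "Q \<alpha>" by (rule dual_abelian_group[OF ab(1)])
  interpret Qb: abelian_group "Q \<beta>" by (rule dual_abelian_group[OF ab(2)])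
  have t: "comult C ?b ?a c \<in> carrier (tensor_group A (cmod C ?b) (cmod C ?a))" if "c \<in> carrier (cmod C ?ab)" for c
    using that ab by (intro comult_closed) (auto simp: G.inv_mult_group)
  have h: "(\<lambda>f. contract (cmod C ?b) f (comult C ?b ?a c)) \<in> ahom (Q \<alpha>) (cmod C ?b)" if "c \<in> carrier (cmod C ?ab)" for c
    using ab by (intro contract_dual_ahom t that cmod_right_module) auto
  note eq = dual_mult_eq[OF ab]
  have "(\<lambda>f. dual_mult G A C \<alpha> \<beta> f g) \<in> ahom (Q \<alpha>) (Q (\<alpha> \<cdot> \<beta>))" if g: "g \<in> carrier (Q \<beta>)" for g
  proof (rule ahomI)
    fix f f' assume f: "f \<in> carrier (Q \<alpha>)" "f' \<in> carrier (Q \<alpha>)"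
    show "dual_mult G A C \<alpha> \<beta> (f \<oplus>\<^bsub>Q \<alpha>\<^esub> f') g =
        dual_mult G A C \<alpha> \<beta> f g \<oplus>\<^bsub>Q (\<alpha> \<cdot> \<beta>)\<^esub> dual_mult G A C \<alpha> \<beta> f' g"
      using ab f g by (intro dual_ext[OF dual_mult_closed abelian_groupE(1)[OF dual_abelian_group]] dual_mult_closed)
        (auto simp: eq dual_add_apply ahom_add[OF h] ahom_closed[OF h] ahom_add[OF dual_ahom[OF g]])
  qed (use dual_mult_closed[OF ab] g in auto)
  moreover have "dual_mult G A C \<alpha> \<beta> f \<in> ahom (Q \<beta>) (Q (\<alpha> \<cdot> \<beta>))" if f: "f \<in> carrier (Q \<alpha>)" for f
  proof (rule ahomI)
    fix g g' assume g: "g \<in> carrier (Q \<beta>)" "g' \<in> carrier (Q \<beta>)"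
    show "dual_mult G A C \<alpha> \<beta> f (g \<oplus>\<^bsub>Q \<beta>\<^esub> g') =
        dual_mult G A C \<alpha> \<beta> f g \<oplus>\<^bsub>Q (\<alpha> \<cdot> \<beta>)\<^esub> dual_mult G A C \<alpha> \<beta> f g'"
      using ab f g by (intro dual_ext[OF dual_mult_closed abelian_groupE(1)[OF dual_abelian_group]] dual_mult_closed)
        (auto simp: eq dual_add_apply ahom_closed[OF h])
  qed (use dual_mult_closed[OF ab] f in auto)
  ultimately show ?thesis by (simp add: biadditive_def)
qed

lemma dual_product: "graded_product G Q Q Q (dual_mult G A C)"
  using dual_family dual_mult_biadditive G.group_axioms
  by (simp add: graded_product_def graded_product_axioms_def)

lemma dual_ring_simps [simp]:
  "carrier R = carrier (dsum (carrier G) Q)" "zero R = zero (dsum (carrier G) Q)"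
  "add R = add (dsum (carrier G) Q)" "monoid.mult R = dext G Q Q Q (dual_mult G A C)"
  "one R = dinj (carrier G) Q \<one>\<^bsub>G\<^esub> eps"
  by (simp_all add: dual_ring_def Let_def)

lemma dual_ring_is_ring: "ring R"
proof -
  interpret P: graded_product G Q Q Q "dual_mult G A C" by (rule dual_product)
  note one = P.M.dinj_closed[OF G.one_closed eps_closed]
  note b = P.dext_biadditive and ag = P.M.abelian_group_S
  have assoc: "x \<star> y \<star> z = x \<star> (y \<star> z)"
    if "x \<in> carrier P.M.S" "y \<in> carrier P.M.S" "z \<in> carrier P.M.S" for x y z
    by (rule dext_assoc[OF dual_product dual_product dual_product dual_product _ that]) (rule dual_mult_assoc)
  show ?thesis
  proof (rule ringI)
    show "abelian_group R" by (rule abelian_group_transfer[OF ag]) simp_all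
    show "monoid R"
    proof (rule monoidI; simp)
      fix x assume x: "x \<in> carrier (dsum (carrier G) Q)"
      show "dinj (carrier G) Q \<one>\<^bsub>G\<^esub> eps \<star> x = x"
        by (rule P.M.dsum_eqI[OF ag biadditive_right[OF b one] ahom_id x])
          (simp add: P.dext_dinj eps_closed dual_mult_eps_left)
      show "x \<star> dinj (carrier G) Q \<one>\<^bsub>G\<^esub> eps = x"
        by (rule P.M.dsum_eqI[OF ag biadditive_left[OF b one] ahom_id x])
          (simp add: P.dext_dinj eps_closed dual_mult_eps_right)
    qed (simp_all add: P.dext_closed one assoc)
  qed (simp_all add: biadditive_add_left[OF b] biadditive_add_right[OF b])
qed

section \<open>Modules over the dual ring\<close>

text \<open>
  The common shape of the values of \<open>F3\<close> and \<open>G5\<close>: a direct sum on which the dual ring acts through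
  homogeneous components \<open>op \<alpha> \<beta>\<close>.
\<close>

definition graded_module :: "('g \<Rightarrow> ('n, 'z) ring_scheme) \<Rightarrow> ('g \<Rightarrow> 'g \<Rightarrow> 'n \<Rightarrow> ('c \<Rightarrow> 'a) \<Rightarrow> 'n) \<Rightarrow>
    ('g, 'g \<Rightarrow> 'c \<Rightarrow> 'a, 'g \<Rightarrow> 'n) grmod" where
  "graded_module N op = rmod.extend
     (with_ract (dsum (carrier G) N) (\<lambda>x\<in>carrier (dsum (carrier G) N). \<lambda>r\<in>carrier R. dext G N Q N op x r))
     (grmod.fields (dpart (carrier G) N))"

lemma graded_module_simps [simp]:
  "carrier (graded_module N op) = carrier (dsum (carrier G) N)"
  "zero (graded_module N op) = zero (dsum (carrier G) N)"
  "add (graded_module N op) = add (dsum (carrier G) N)"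
  "\<lbrakk>x \<in> carrier (dsum (carrier G) N); r \<in> carrier (dsum (carrier G) Q)\<rbrakk> \<Longrightarrow>
   x \<triangleleft>\<^bsub>graded_module N op\<^esub> r = dext G N Q N op x r"
  "grade (graded_module N op) = dpart (carrier G) N"
  by (simp_all add: graded_module_def rmod.defs grmod.defs)

lemma graded_module_graded_right_module:
  assumes "graded_product G N Q N op"
    and assoc: "\<And>\<alpha> \<beta> \<gamma> n f g. \<lbrakk>\<alpha> \<in> carrier G; \<beta> \<in> carrier G; \<gamma> \<in> carrier G; n \<in> carrier (N \<alpha>);
      f \<in> carrier (Q \<beta>); g \<in> carrier (Q \<gamma>)\<rbrakk> \<Longrightarrow>
      op (\<alpha> \<cdot> \<beta>) \<gamma> (op \<alpha> \<beta> n f) g = op \<alpha> (\<beta> \<cdot> \<gamma>) n (dual_mult G A C \<beta> \<gamma> f g)"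
    and unit: "\<And>\<alpha> n. \<lbrakk>\<alpha> \<in> carrier G; n \<in> carrier (N \<alpha>)\<rbrakk> \<Longrightarrow> op \<alpha> \<one>\<^bsub>G\<^esub> n eps = n"
  shows "graded_right_module G R (dual_part G A C) (graded_module N op)"
proof -
  interpret P: graded_product G N Q N op by fact
  interpret D: graded_product G Q Q Q "dual_mult G A C" by (rule dual_product)
  interpret R: ring R by (rule dual_ring_is_ring)
  note b = P.dext_biadditive and ag = P.M.abelian_group_S
  interpret M: abelian_group "graded_module N op"
    by (rule abelian_group_transfer[OF ag]) simp_all
  note one = P.N.dinj_closed[OF G.one_closed eps_closed]
  have u: "dext G N Q N op x (dinj (carrier G) Q \<one>\<^bsub>G\<^esub> eps) = x" if x: "x \<in> carrier P.M.S" for x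
    by (rule P.M.dsum_eqI[OF ag biadditive_left[OF b one] ahom_id x])
      (simp add: P.dext_dinj eps_closed unit)
  have assoc': "dext G N Q N op (dext G N Q N op x r) s = dext G N Q N op x (r \<star> s)"
    if "x \<in> carrier P.M.S" "r \<in> carrier P.N.S" "s \<in> carrier P.N.S" for x r s
    by (rule dext_assoc[OF assms(1) assms(1) dual_product assms(1) _ that]) (rule assoc)
  have addS: "r \<oplus>\<^bsub>P.N.S\<^esub> s \<in> carrier P.N.S" if "r \<in> carrier P.N.S" "s \<in> carrier P.N.S" for r s
    using abelian_groupE(1)[OF P.N.abelian_group_S that] .
  have addN: "r \<oplus>\<^bsub>P.M.S\<^esub> s \<in> carrier P.M.S" if "r \<in> carrier P.M.S" "s \<in> carrier P.M.S" for r s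
    using abelian_groupE(1)[OF ag that] .
  have "right_module R (graded_module N op)"
    by unfold_locales
      (simp_all add: P.dext_closed biadditive_add_left[OF b] biadditive_add_right[OF b] u one D.dext_closed
        addS addN assoc')
  then interpret M: right_module R "graded_module N op" .
  show ?thesis
  proof (intro graded_right_module.intro G.group_axioms M.right_module_axioms graded_right_module_axioms.intro)
    show "subgroup (grade (graded_module N op) \<alpha>) (add_monoid (graded_module N op))" if "\<alpha> \<in> carrier G" for \<alpha>
      using P.M.dpart_subgroup[OF that] by (simp add: subgroup_def m_inv_def)
    show "\<exists>!y. y \<in> (\<Pi>\<^sub>E \<alpha>\<in>carrier G. grade (graded_module N op) \<alpha>) \<and>
        finite {\<alpha> \<in> carrier G. y \<alpha> \<noteq> \<zero>\<^bsub>graded_module N op\<^esub>} \<and>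
        x = (\<Oplus>\<^bsub>graded_module N op\<^esub>\<alpha>\<in>{\<alpha> \<in> carrier G. y \<alpha> \<noteq> \<zero>\<^bsub>graded_module N op\<^esub>}. y \<alpha>)"
      if "x \<in> carrier (graded_module N op)" for x
      using P.M.dpart_direct_sum[of x] that
      by (simp add: finsum_transfer[of "graded_module N op" "dsum (carrier G) N"])
    show "m \<triangleleft>\<^bsub>graded_module N op\<^esub> r \<in> grade (graded_module N op) (\<alpha> \<cdot> \<beta>)"
      if ab: "\<alpha> \<in> carrier G" "\<beta> \<in> carrier G" and m: "m \<in> grade (graded_module N op) \<alpha>" and r: "r \<in> dual_part G A C \<beta>"
      for \<alpha> \<beta> m r
    proof -
      obtain n where n: "n \<in> carrier (N \<alpha>)" "m = dinj (carrier G) N \<alpha> n"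
        using m P.M.dpart_iff[OF ab(1)] by auto
      obtain f where f: "f \<in> carrier (Q \<beta>)" "r = dinj (carrier G) Q \<beta> f"
        using r P.N.dpart_iff[OF ab(2)] by (auto simp: dual_part_def)
      show ?thesis
        using ab n f biadditive_closed[OF P.op[OF ab] n(1) f(1)]
        by (auto simp: P.M.dinj_closed P.N.dinj_closed P.dext_dinj P.M.dpart_iff)
    qed
  qed
qed

lemma graded_module_rhom:
  assumes P: "graded_product G N Q N op" and P': "graded_product G N' Q N' op'"
    and f: "\<And>\<alpha>. \<alpha> \<in> carrier G \<Longrightarrow> f \<alpha> \<in> ahom (N \<alpha>) (N' \<alpha>)"
    and comm: "\<And>\<alpha> \<beta> n r. \<lbrakk>\<alpha> \<in> carrier G; \<beta> \<in> carrier G; n \<in> carrier (N \<alpha>); r \<in> carrier (Q \<beta>)\<rbrakk> \<Longrightarrow>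
      f (\<alpha> \<cdot> \<beta>) (op \<alpha> \<beta> n r) = op' \<alpha> \<beta> (f \<alpha> n) r"
  shows "dsum_map (carrier G) N f \<in> rhom R (graded_module N op) (graded_module N' op')"
    and "\<alpha> \<in> carrier G \<Longrightarrow> dsum_map (carrier G) N f ` grade (graded_module N op) \<alpha> \<subseteq> grade (graded_module N' op') \<alpha>"
proof -
  interpret P: graded_product G N Q N op by fact
  interpret P': graded_product G N' Q N' op' by fact
  let ?f = "dsum_map (carrier G) N f"
  note fam = P.M.dsum_family_axioms P'.M.dsum_family_axioms
  note h = dsum_map_ahom[OF fam f] and hd = dsum_map_dinj[OF fam, of f]
  note b = P.dext_biadditive and b' = P'.dext_biadditive and ag = P'.M.abelian_group_S
  show "?f \<in> rhom R (graded_module N op) (graded_module N' op')"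
  proof (rule rhomI)
    show "?f \<in> ahom (graded_module N op) (graded_module N' op')" using h by (simp add: ahom_def)
    fix x r assume x: "x \<in> carrier (graded_module N op)" and r: "r \<in> carrier R"
    have "?f (dext G N Q N op x r) = dext G N' Q N' op' (?f x) r"
    proof (rule P.dext_eqI[OF ag, where b = "\<lambda>x r. ?f (dext G N Q N op x r)" and b' = "\<lambda>x r. dext G N' Q N' op' (?f x) r"])
      show "biadditive P.M.S P.N.S P'.M.S (\<lambda>x r. ?f (dext G N Q N op x r))"
        using b unfolding biadditive_def by (auto intro: ahom_comp[OF h])
      show "biadditive P.M.S P.N.S P'.M.S (\<lambda>x r. dext G N' Q N' op' (?f x) r)"
        using ahom_comp[OF biadditive_left[OF b'] h] biadditive_right[OF b' ahom_closed[OF h]]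
        unfolding biadditive_def by auto
      fix \<alpha> \<beta> n q assume *: "\<alpha> \<in> carrier G" "\<beta> \<in> carrier G" "n \<in> carrier (N \<alpha>)" "q \<in> carrier (Q \<beta>)"
      show "?f (dext G N Q N op (dinj (carrier G) N \<alpha> n) (dinj (carrier G) Q \<beta> q)) =
        dext G N' Q N' op' (?f (dinj (carrier G) N \<alpha> n)) (dinj (carrier G) Q \<beta> q)"
        using * biadditive_closed[OF P.op] ahom_closed[OF f]
        by (simp add: P.dext_dinj P'.dext_dinj hd f comm)
    qed (use x r in auto)
    then show "?f (x \<triangleleft>\<^bsub>graded_module N op\<^esub> r) = ?f x \<triangleleft>\<^bsub>graded_module N' op'\<^esub> r"
      using x r ahom_closed[OF h] by simp
  qed
  show "?f ` grade (graded_module N op) \<alpha> \<subseteq> grade (graded_module N' op') \<alpha>" if a: "\<alpha> \<in> carrier G"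
    using ahom_closed[OF f[OF a]] hd[OF f a] by (auto simp: P.M.dpart_iff[OF a] P'.M.dpart_iff[OF a] intro!: bexI)
qed

end

section \<open>Transport of coactions\<close>

text \<open>
  Coactions are transported along maps \<open>j\<close> of comodules while the coring stays the same, so the
  associator is moved past a map in its first factor.
\<close>

lemma tassoc_natural:
  assumes N: "right_module A N" and N': "right_module A N'" and C: "bimodule A C" and D: "bimodule A D"
    and j: "j \<in> rhom A N N'" and u: "u \<in> carrier (tensor_group A (tensor A N C) D)"
  shows "tassoc A N' C D (tmap A (tensor A N' C) D (tmap A N' C j (\<lambda>z. z)) (\<lambda>z. z) u) =
    tmap A N' (btensor A C D) j (\<lambda>z. z) (tassoc A N C D u)"
proof -
  interpret NC: tensor_pair A N C by (rule tensor_pair.intro[OF N C])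
  interpret NC': tensor_pair A N' C by (rule tensor_pair.intro[OF N' C])
  note NCD = tensor_pair.intro[OF NC.tensor_right_module D]
    and NCD' = tensor_pair.intro[OF NC'.tensor_right_module D]
    and B = tensor_pair.intro[OF N btensor_bimodule[OF C D]]
    and B' = tensor_pair.intro[OF N' btensor_bimodule[OF C D]]
    and CD = tensor_pair.intro[OF bimodule_right_module[OF C] D]
  note jC = tmap_rhom[OF NC.tensor_pair_axioms NC'.tensor_pair_axioms j lhom_id rhom_id]
  note t = tmap_ahom[OF NCD NCD' jC lhom_id] and tp = tmap_ptens[OF NCD NCD' jC lhom_id]
  note a = tassoc_ahom[OF N C D] and a' = tassoc_ahom[OF N' C D]
  note b = tmap_ahom[OF B B' j lhom_id] and bp = tmap_ptens[OF B B' j lhom_id]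
  note ag = tensor_pair.abelian_group_T[OF B']
  let ?f = "\<lambda>u. tassoc A N' C D (tmap A (tensor A N' C) D (tmap A N' C j (\<lambda>z. z)) (\<lambda>z. z) u)"
  let ?g = "\<lambda>u. tmap A N' (btensor A C D) j (\<lambda>z. z) (tassoc A N C D u)"
  show ?thesis
  proof (rule tensor_pair.tensor_eqI[OF NCD ag ahom_comp[OF a' t] ahom_comp[OF b a] u])
    fix s d assume s: "s \<in> carrier (tensor A N C)" and d: "d \<in> carrier D"
    have p: "(\<lambda>s. ptens A (tensor A N C) D s d) \<in> ahom NC.T (tensor_group A (tensor A N C) D)"
      using biadditive_left[OF balanced_biadditive[OF tensor_pair.balanced_ptens[OF NCD]] d] by simp
    show "?f (ptens A (tensor A N C) D s d) = ?g (ptens A (tensor A N C) D s d)"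
    proof (rule NC.tensor_eqI[OF ag ahom_comp[OF ahom_comp[OF a' t] p] ahom_comp[OF ahom_comp[OF b a] p]])
      show "s \<in> carrier NC.T" using s by simp
      fix n c assume nc: "n \<in> carrier N" "c \<in> carrier C"
      have "j n \<in> carrier N'" using ahom_closed[OF rhom_ahom[OF j] nc(1)] .
      then show "?f (ptens A (tensor A N C) D (ptens A N C n c) d) = ?g (ptens A (tensor A N C) D (ptens A N C n c) d)"
        using nc d NC.ptens_closed[OF nc] tensor_pair.ptens_closed[OF CD nc(2) d]
        by (simp add: tp tassoc_ptens[OF N C D] tassoc_ptens[OF N' C D] bp
            tmap_ptens[OF NC.tensor_pair_axioms NC'.tensor_pair_axioms j lhom_id])
    qed
  qed
qed

text \<open>
  If \<open>rho'\<close> restricts to \<open>rho\<close> along \<open>k\<close> and \<open>j\<close>, then coassociativity of \<open>rho\<close> at an element gives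
  that of \<open>rho'\<close> at its image.  The four modules are independent since in a graded comodule the coactions
  run between different components.
\<close>

lemma coassoc_transport:
  assumes M: "right_module A M" and M': "right_module A M'" and N: "right_module A N" and N': "right_module A N'"
    and C: "bimodule A C" and D: "bimodule A D" and E: "bimodule A E" and d: "d \<in> lhom A E (btensor A C D)"
    and j: "j \<in> rhom A N N'" and k: "k \<in> rhom A M M'"
    and rho: "rho \<in> rhom A M (tensor A N C)" and rho': "rho' \<in> rhom A M' (tensor A N' C)"
    and comm: "\<And>m. m \<in> carrier M \<Longrightarrow> rho' (k m) = tmap A N' C j (\<lambda>z. z) (rho m)"
    and s: "s \<in> carrier (tensor_group A M D)" and t: "t \<in> carrier (tensor_group A N E)"
    and coassoc: "tmap A N (btensor A C D) (\<lambda>z. z) d t = tassoc A N C D (tmap A (tensor A N C) D rho (\<lambda>z. z) s)"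
  shows "tmap A N' (btensor A C D) (\<lambda>z. z) d (tmap A N' E j (\<lambda>z. z) t) =
    tassoc A N' C D (tmap A (tensor A N' C) D rho' (\<lambda>z. z) (tmap A M' D k (\<lambda>z. z) s))"
proof -
  note NC = tensor_pair.intro[OF N C] and NC' = tensor_pair.intro[OF N' C]
    and NE = tensor_pair.intro[OF N E] and NE' = tensor_pair.intro[OF N' E]
    and MD = tensor_pair.intro[OF M D] and MD' = tensor_pair.intro[OF M' D]
  note NCD = tensor_pair.intro[OF tensor_pair.tensor_right_module[OF NC] D]
    and NCD' = tensor_pair.intro[OF tensor_pair.tensor_right_module[OF NC'] D]
    and B = tensor_pair.intro[OF N btensor_bimodule[OF C D]]
    and B' = tensor_pair.intro[OF N' btensor_bimodule[OF C D]]
  note jC = tmap_rhom[OF NC NC' j lhom_id rhom_id]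
  have "tmap A N' (btensor A C D) (\<lambda>z. z) d (tmap A N' E j (\<lambda>z. z) t) = tmap A N' (btensor A C D) j d t"
    by (rule tmap_tmap[OF NE NE' B' j lhom_id rhom_id d t])
  also have "\<dots> = tmap A N' (btensor A C D) j (\<lambda>z. z) (tmap A N (btensor A C D) (\<lambda>z. z) d t)"
    by (rule tmap_tmap[OF NE B B' rhom_id d j lhom_id t, symmetric])
  also have "\<dots> = tassoc A N' C D (tmap A (tensor A N' C) D (tmap A N' C j (\<lambda>z. z)) (\<lambda>z. z)
      (tmap A (tensor A N C) D rho (\<lambda>z. z) s))"
    unfolding coassoc
    by (rule tassoc_natural[OF N N' C D j ahom_closed[OF tmap_ahom[OF MD NCD rho lhom_id] s], symmetric])
  also have "tmap A (tensor A N' C) D (tmap A N' C j (\<lambda>z. z)) (\<lambda>z. z) (tmap A (tensor A N C) D rho (\<lambda>z. z) s) =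
      tmap A (tensor A N' C) D (\<lambda>m. tmap A N' C j (\<lambda>z. z) (rho m)) (\<lambda>z. z) s"
    by (rule tmap_tmap[OF MD NCD NCD' rho lhom_id jC lhom_id s])
  also have "\<dots> = tmap A (tensor A N' C) D (\<lambda>m. rho' (k m)) (\<lambda>z. z) s"
    by (rule tmap_cong_fun[OF MD NCD' rhom_comp[OF jC rho] lhom_id _ _ s]) (simp_all add: comm)
  also have "\<dots> = tmap A (tensor A N' C) D rho' (\<lambda>z. z) (tmap A M' D k (\<lambda>z. z) s)"
    by (rule tmap_tmap[OF MD MD' NCD' k lhom_id rho' lhom_id s, symmetric])
  finally show ?thesis .
qed

lemma counit_transport:
  assumes N: "right_module A N" and N': "right_module A N'" and C: "bimodule A C"
    and e: "e \<in> lhom A C (regular A)" and j: "j \<in> rhom A N N'" and t: "t \<in> carrier (tensor_group A N C)"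
  shows "runit N' (tmap A N' (regular A) (\<lambda>z. z) e (tmap A N' C j (\<lambda>z. z) t)) =
    j (runit N (tmap A N (regular A) (\<lambda>z. z) e t))"
proof -
  note NC = tensor_pair.intro[OF N C] and NC' = tensor_pair.intro[OF N' C]
  show ?thesis
    using ahom_closed[OF tmap_ahom[OF NC NC' j lhom_id] t]
    by (simp add: runit_tmap_counit[OF N' C e] runit_tmap_counit[OF N C e t] contract_tmap[OF NC NC' j lhom_id e t])
qed

section \<open>Comodules and modules built by the functors\<close>

lemma mu_simps [simp]:
  "carrier (mu \<alpha> M) = Pair \<alpha> ` carrier M" "zero (mu \<alpha> M) = (\<alpha>, \<zero>\<^bsub>M\<^esub>)"
  "x \<oplus>\<^bsub>mu \<alpha> M\<^esub> y = (\<alpha>, snd x \<oplus>\<^bsub>M\<^esub> snd y)" "x \<triangleleft>\<^bsub>mu \<alpha> M\<^esub> a = (\<alpha>, snd x \<triangleleft>\<^bsub>M\<^esub> a)"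
  by (simp_all add: mu_def)

lemma mu_right_module:
  assumes "right_module A M" shows "right_module A (mu \<alpha> M)"
proof -
  interpret right_module A M by fact
  interpret mu: abelian_group "mu \<alpha> M"
    by (rule abelian_groupI) (auto simp: a_assoc intro: a_comm add.l_inv_ex)
  show ?thesis
    by unfold_locales
      (auto simp: ract_closed ract_add_left ract_add_right ract_mult ract_one)
qed

lemma Pair_rhom: "Pair \<alpha> \<in> rhom A M (mu \<alpha> M)"
  by (auto simp: rhom_def)

lemma snd_rhom: "snd \<in> rhom A (mu \<alpha> M) M"
  by (auto simp: rhom_def)

lemma truncate_simps [simp]:
  "carrier (rmod.truncate M) = carrier M" "zero (rmod.truncate M) = zero M"
  "add (rmod.truncate M) = add M" "ract (rmod.truncate M) = ract M"
  by (simp_all add: rmod.defs)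

lemma mu_truncate [simp]: "mu \<alpha> (rmod.truncate M) = mu \<alpha> M"
  by (simp add: mu_def)

context group_coring
begin

lemma comodule_right_module: "comodule G A C M \<Longrightarrow> right_module A M"
  by (rule comodule.axioms)

lemma coact_closed:
  "\<lbrakk>comodule G A C M; \<alpha> \<in> carrier G; m \<in> carrier M\<rbrakk> \<Longrightarrow> coact M \<alpha> m \<in> carrier (tensor_group A M (cmod C \<alpha>))"
  using ahom_closed[OF rhom_ahom[OF comodule.coact_hom]] by fastforce

lemma gcoact_closed:
  "\<lbrakk>gcomodule G A C M; \<alpha> \<in> carrier G; \<beta> \<in> carrier G; m \<in> carrier (gmod M (\<alpha> \<cdot> \<beta>))\<rbrakk> \<Longrightarrow>
   gcoact M \<alpha> \<beta> m \<in> carrier (tensor_group A (gmod M \<alpha>) (cmod C \<beta>))"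
  using ahom_closed[OF rhom_ahom[OF gcomodule.gcoact_hom]] by fastforce

lemma G1_simps [simp]:
  "gmod (fob (G1 G A C) M) = (\<lambda>\<alpha>. mu \<alpha> M)"
  "gcoact (fob (G1 G A C) M) \<alpha> \<beta> x = tmap A (mu \<alpha> M) (cmod C \<beta>) (Pair \<alpha>) (\<lambda>z. z) (coact M \<beta> (snd x))"
  by (simp_all add: G1_def)

lemma G1_gcomodule:
  assumes M: "comodule G A C M"
  shows "gcomodule G A C (fob (G1 G A C) M)"
proof (rule gcomodule.intro[OF group_coring_axioms gcomodule_axioms.intro])
  interpret comodule G A C M by (rule M)
  note Mm = comodule_right_module[OF M]
  note mum = mu_right_module[OF Mm]
  note tp = tensor_pair_cmod[OF Mm] and tpm = tensor_pair_cmod[OF mum]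
  show "right_module A (gmod (fob (G1 G A C) M) \<alpha>)" for \<alpha> using mum by simp
  have h: "gcoact (fob (G1 G A C) M) \<alpha> \<beta> \<in> rhom A (mu (\<alpha> \<cdot> \<beta>) M) (tensor A (mu \<alpha> M) (cmod C \<beta>))"
    if "\<alpha> \<in> carrier G" "\<beta> \<in> carrier G" for \<alpha> \<beta>
  proof -
    have "(\<lambda>x. tmap A (mu \<alpha> M) (cmod C \<beta>) (Pair \<alpha>) (\<lambda>z. z) (coact M \<beta> (snd x)))
        \<in> rhom A (mu (\<alpha> \<cdot> \<beta>) M) (tensor A (mu \<alpha> M) (cmod C \<beta>))"
      using that by (intro rhom_comp[OF tmap_rhom[OF tp tpm Pair_rhom lhom_id rhom_id]]
          rhom_comp[OF coact_hom snd_rhom]) auto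
    then show ?thesis by (simp flip: G1_simps(2))
  qed
  then show "gcoact (fob (G1 G A C) M) \<alpha> \<beta> \<in>
      rhom A (gmod (fob (G1 G A C) M) (\<alpha> \<cdot> \<beta>)) (tensor A (gmod (fob (G1 G A C) M) \<alpha>) (cmod C \<beta>))"
    if "\<alpha> \<in> carrier G" "\<beta> \<in> carrier G" for \<alpha> \<beta>
    using that by simp
  {
    fix \<alpha> \<beta> \<gamma> x assume abg: "\<alpha> \<in> carrier G" "\<beta> \<in> carrier G" "\<gamma> \<in> carrier G"
      and x: "x \<in> carrier (gmod (fob (G1 G A C) M) (\<alpha> \<cdot> \<beta> \<cdot> \<gamma>))"
    then have m: "snd x \<in> carrier M" by auto
    have bg: "\<beta> \<cdot> \<gamma> \<in> carrier G" using abg by simp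
    show "tmap A (gmod (fob (G1 G A C) M) \<alpha>) (btensor A (cmod C \<beta>) (cmod C \<gamma>)) (\<lambda>z. z) (comult C \<beta> \<gamma>)
         (gcoact (fob (G1 G A C) M) \<alpha> (\<beta> \<cdot> \<gamma>) x) =
       tassoc A (gmod (fob (G1 G A C) M) \<alpha>) (cmod C \<beta>) (cmod C \<gamma>)
         (tmap A (tensor A (gmod (fob (G1 G A C) M) \<alpha>) (cmod C \<beta>)) (cmod C \<gamma>)
           (gcoact (fob (G1 G A C) M) \<alpha> \<beta>) (\<lambda>z. z) (gcoact (fob (G1 G A C) M) (\<alpha> \<cdot> \<beta>) \<gamma> x))"
      using coassoc_transport[OF Mm mum Mm mum cmod_bimodule[OF abg(2)] cmod_bimodule[OF abg(3)] cmod_bimodule[OF bg]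
          comult_lhom[OF abg(2,3)] Pair_rhom Pair_rhom coact_hom[OF abg(2)] h[OF abg(1,2)] _
          coact_closed[OF M abg(3) m] coact_closed[OF M bg m] coact_coassoc[OF abg(2,3) m]]
      by simp
  next
    fix \<alpha> x assume a: "\<alpha> \<in> carrier G" and x: "x \<in> carrier (gmod (fob (G1 G A C) M) \<alpha>)"
    then have m: "snd x \<in> carrier M" by auto
    show "runit (gmod (fob (G1 G A C) M) \<alpha>) (tmap A (gmod (fob (G1 G A C) M) \<alpha>) (regular A) (\<lambda>z. z) (counit C)
        (gcoact (fob (G1 G A C) M) \<alpha> \<one>\<^bsub>G\<^esub> x)) = x"
      using counit_transport[OF Mm mum cmod_bimodule[OF G.one_closed] counit_lhom Pair_rhom
          coact_closed[OF M G.one_closed m]] coact_counit[OF m] x by auto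
  }
qed

lemma F1_simps [simp]:
  "carrier (fob (F1 G A C) M) = carrier (dsum (carrier G) (gmod M))"
  "zero (fob (F1 G A C) M) = zero (dsum (carrier G) (gmod M))"
  "add (fob (F1 G A C) M) = add (dsum (carrier G) (gmod M))"
  "ract (fob (F1 G A C) M) = ract (dsum_mod (carrier G) (gmod M))"
  by (simp_all add: F1_def Let_def rmod.defs comod.defs)

text \<open>
  The coaction restated over the comodule itself in place of the underlying module, so that the tensor
  products match those in the definition of a comodule.
\<close>

lemma F1_coact:
  "coact (fob (F1 G A C) M) \<alpha> x =
    (\<Oplus>\<^bsub>tensor_group A (fob (F1 G A C) M) (cmod C \<alpha>)\<^esub>\<beta>\<in>dsupp (carrier G) (gmod M) x.
       tmap A (fob (F1 G A C) M) (cmod C \<alpha>) (dinj (carrier G) (gmod M) (\<beta> \<cdot> \<iota> \<alpha>)) (\<lambda>z. z)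
         (gcoact M (\<beta> \<cdot> \<iota> \<alpha>) \<alpha> (x \<beta>)))"
proof -
  let ?S = "dsum_mod (carrier G) (gmod M)" and ?X = "fob (F1 G A C) M"
  show ?thesis
    by (simp add: tensor_group_cong[of ?X ?S] tmap_cong[of ?X ?S]) (simp add: F1_def Let_def rmod.defs comod.defs)
qed

lemma gmod_family: "gcomodule G A C M \<Longrightarrow> dsum_family (carrier G) (gmod M)"
  by (rule dsum_family.intro) (rule right_module_abelian_group[OF gcomodule.gmod_module])

lemma F1_right_module:
  assumes M: "gcomodule G A C M" shows "right_module A (fob (F1 G A C) M)"
proof -
  interpret S: right_module A "dsum_mod (carrier G) (gmod M)"
    by (rule dsum_mod_right_module[OF A.ring_axioms gcomodule.gmod_module[OF M]])
  interpret X: abelian_group "fob (F1 G A C) M"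
    by (rule abelian_group_transfer[OF S.abelian_group_axioms]) simp_all
  show ?thesis
    using S.ract_closed S.ract_add_left S.ract_add_right S.ract_mult S.ract_one
    by unfold_locales (simp_all del: dsum_mod_simps(4))
qed

lemma F1_dinj_rhom:
  assumes M: "gcomodule G A C M" and a: "\<alpha> \<in> carrier G"
  shows "dinj (carrier G) (gmod M) \<alpha> \<in> rhom A (gmod M \<alpha>) (fob (F1 G A C) M)"
  using dinj_rhom[OF A.ring_axioms gcomodule.gmod_module[OF M] a] by (simp add: rhom_def)

lemma F1_coact_summand_rhom:
  assumes M: "gcomodule G A C M" and a: "\<alpha> \<in> carrier G" and b: "\<beta> \<in> carrier G"
  shows "(\<lambda>m. tmap A (fob (F1 G A C) M) (cmod C \<alpha>) (dinj (carrier G) (gmod M) (\<beta> \<cdot> \<iota> \<alpha>)) (\<lambda>z. z)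
         (gcoact M (\<beta> \<cdot> \<iota> \<alpha>) \<alpha> m)) \<in> rhom A (gmod M \<beta>) (tensor A (fob (F1 G A C) M) (cmod C \<alpha>))"
proof -
  have ba: "\<beta> \<cdot> \<iota> \<alpha> \<in> carrier G" using a b by simp
  have e: "\<beta> \<cdot> \<iota> \<alpha> \<cdot> \<alpha> = \<beta>" using a b by (simp add: G.m_assoc)
  show ?thesis
    using gcomodule.gcoact_hom[OF M ba a] unfolding e
    by (intro rhom_comp[OF tmap_rhom[OF tensor_pair_cmod[OF gcomodule.gmod_module[OF M ba] a]
          tensor_pair_cmod[OF F1_right_module[OF M] a] F1_dinj_rhom[OF M ba] lhom_id rhom_id]])
qed

lemma F1_coact_ahom:
  assumes M: "gcomodule G A C M" and a: "\<alpha> \<in> carrier G"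
  shows "coact (fob (F1 G A C) M) \<alpha> \<in> ahom (dsum (carrier G) (gmod M)) (tensor_group A (fob (F1 G A C) M) (cmod C \<alpha>))"
  unfolding F1_coact[abs_def]
  by (rule dsum_family.dlift_ahom[OF gmod_family[OF M], where h = "\<lambda>\<beta> m.
        tmap A (fob (F1 G A C) M) (cmod C \<alpha>) (dinj (carrier G) (gmod M) (\<beta> \<cdot> \<iota> \<alpha>)) (\<lambda>z. z)
          (gcoact M (\<beta> \<cdot> \<iota> \<alpha>) \<alpha> m)",
        OF tensor_pair.abelian_group_T[OF tensor_pair_cmod[OF F1_right_module[OF M] a]]])
    (use rhom_ahom[OF F1_coact_summand_rhom[OF M a]] in simp)

lemma F1_coact_dinj:
  assumes M: "gcomodule G A C M" and a: "\<alpha> \<in> carrier G" and b: "\<beta> \<in> carrier G" and m: "m \<in> carrier (gmod M \<beta>)"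
  shows "coact (fob (F1 G A C) M) \<alpha> (dinj (carrier G) (gmod M) \<beta> m) =
    tmap A (fob (F1 G A C) M) (cmod C \<alpha>) (dinj (carrier G) (gmod M) (\<beta> \<cdot> \<iota> \<alpha>)) (\<lambda>z. z)
      (gcoact M (\<beta> \<cdot> \<iota> \<alpha>) \<alpha> m)"
  unfolding F1_coact
  by (rule dsum_family.dlift_dinj[OF gmod_family[OF M], where h = "\<lambda>\<beta> m.
        tmap A (fob (F1 G A C) M) (cmod C \<alpha>) (dinj (carrier G) (gmod M) (\<beta> \<cdot> \<iota> \<alpha>)) (\<lambda>z. z)
          (gcoact M (\<beta> \<cdot> \<iota> \<alpha>) \<alpha> m)",
        OF tensor_pair.abelian_group_T[OF tensor_pair_cmod[OF F1_right_module[OF M] a]] _ b m])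
    (use rhom_ahom[OF F1_coact_summand_rhom[OF M a]] in simp)

text \<open>
  Every axiom is an equality of additive maps on the direct sum, so it is checked on homogeneous
  elements.  There the coaction is that of \<open>M\<close> followed by the inclusion of a summand, and
  coassociativity is transported along the inclusions.
\<close>

lemma F1_comodule:
  assumes M: "gcomodule G A C M"
  shows "comodule G A C (fob (F1 G A C) M)"
proof (rule comodule.intro[OF group_coring_axioms F1_right_module[OF M] comodule_axioms.intro])
  interpret gcomodule G A C M by (rule M)
  interpret S: dsum_family "carrier G" "gmod M" by (rule gmod_family[OF M])
  let ?X = "fob (F1 G A C) M" and ?i = "dinj (carrier G) (gmod M)"
  note Xm = F1_right_module[OF M]
  note tp = tensor_pair_cmod[OF Xm]
  have r: "(\<lambda>x. x \<triangleleft>\<^bsub>?X\<^esub> a) \<in> ahom S.S S.S" if "a \<in> carrier A" for a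
    using ahom_ract[OF Xm that] by (simp add: ahom_def)
  show h: "coact ?X \<alpha> \<in> rhom A ?X (tensor A ?X (cmod C \<alpha>))" if a: "\<alpha> \<in> carrier G" for \<alpha>
  proof (rule rhomI)
    note ca = F1_coact_ahom[OF M a]
    show "coact ?X \<alpha> \<in> ahom ?X (tensor A ?X (cmod C \<alpha>))" using ca by (simp add: ahom_def)
    fix x s assume x: "x \<in> carrier ?X" and s: "s \<in> carrier A"
    show "coact ?X \<alpha> (x \<triangleleft>\<^bsub>?X\<^esub> s) = coact ?X \<alpha> x \<triangleleft>\<^bsub>tensor A ?X (cmod C \<alpha>)\<^esub> s"
    proof (rule S.dsum_eqI[OF tensor_pair.abelian_group_T[OF tp[OF a]] ahom_comp[OF ca r[OF s]]
          ahom_comp[OF tensor_pair.tensor_ract_ahom[OF tp[OF a] s] ca]])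
      show "x \<in> carrier S.S" using x by simp
      fix \<beta> m assume b: "\<beta> \<in> carrier G" and m: "m \<in> carrier (gmod M \<beta>)"
      have "?i \<beta> m \<triangleleft>\<^bsub>?X\<^esub> s = ?i \<beta> (m \<triangleleft>\<^bsub>gmod M \<beta>\<^esub> s)"
        using rhom_ract[OF F1_dinj_rhom[OF M b] m s] by simp
      then show "coact ?X \<alpha> (?i \<beta> m \<triangleleft>\<^bsub>?X\<^esub> s) = coact ?X \<alpha> (?i \<beta> m) \<triangleleft>\<^bsub>tensor A ?X (cmod C \<alpha>)\<^esub> s"
        using rhom_ract[OF F1_coact_summand_rhom[OF M a b] m s] right_module.ract_closed[OF gmod_module[OF b] m s]
        by (simp add: F1_coact_dinj[OF M a b] m del: F1_simps(4))
    qed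
  qed
  {
    fix \<alpha> \<beta> x assume ab: "\<alpha> \<in> carrier G" "\<beta> \<in> carrier G" and x: "x \<in> carrier ?X"
    let ?B = "btensor A (cmod C \<alpha>) (cmod C \<beta>)"
    have c: "\<alpha> \<cdot> \<beta> \<in> carrier G" using ab by simp
    note bm = cmod_bimodule[OF ab(1)] cmod_bimodule[OF ab(2)]
    note B = tensor_pair.intro[OF Xm btensor_bimodule[OF bm]]
    note XC = tensor_pair.intro[OF tensor_pair.tensor_right_module[OF tp[OF ab(1)]] bm(2)]
    show "tmap A ?X ?B (\<lambda>z. z) (comult C \<alpha> \<beta>) (coact ?X (\<alpha> \<cdot> \<beta>) x) =
       tassoc A ?X (cmod C \<alpha>) (cmod C \<beta>)
         (tmap A (tensor A ?X (cmod C \<alpha>)) (cmod C \<beta>) (coact ?X \<alpha>) (\<lambda>z. z) (coact ?X \<beta> x))"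
    proof (rule S.dsum_eqI[OF tensor_pair.abelian_group_T[OF B]
          ahom_comp[OF tmap_ahom[OF tp[OF c] B rhom_id comult_lhom[OF ab]] F1_coact_ahom[OF M c]]
          ahom_comp[OF tassoc_ahom[OF Xm bm] ahom_comp[OF tmap_ahom[OF tp[OF ab(2)] XC h[OF ab(1)] lhom_id]
              F1_coact_ahom[OF M ab(2)]]]])
      show "x \<in> carrier S.S" using x by simp
      fix \<gamma> m assume g: "\<gamma> \<in> carrier G" and m: "m \<in> carrier (gmod M \<gamma>)"
      \<comment> \<open>The degree left after \<open>\<alpha>\<close> and \<open>\<beta>\<close> are split off from \<open>\<gamma>\<close>, so that \<open>\<gamma> = ?d \<alpha> \<beta>\<close>.\<close>
      let ?d = "\<gamma> \<cdot> \<iota> (\<alpha> \<cdot> \<beta>)"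
      have d: "?d \<in> carrier G" using ab g by simp
      have da: "?d \<cdot> \<alpha> \<in> carrier G" using d ab by simp
      have e3: "?d \<cdot> (\<alpha> \<cdot> \<beta>) = \<gamma>"
        using ab g by (simp add: G.m_assoc)
      have e: "\<gamma> \<cdot> \<iota> \<beta> = ?d \<cdot> \<alpha>" "?d \<cdot> \<alpha> \<cdot> \<iota> \<alpha> = ?d"
        "?d \<cdot> (\<alpha> \<cdot> \<beta>) = \<gamma>" "?d \<cdot> \<alpha> \<cdot> \<beta> = \<gamma>"
        using ab g e3 by (simp_all add: G.m_assoc) (simp add: G.inv_mult_group G.m_assoc)
      have s: "gcoact M (?d \<cdot> \<alpha>) \<beta> m \<in> carrier (tensor_group A (gmod M (?d \<cdot> \<alpha>)) (cmod C \<beta>))"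
        by (rule gcoact_closed[OF M da ab(2)]) (simp add: e(4) m)
      have t: "gcoact M ?d (\<alpha> \<cdot> \<beta>) m \<in> carrier (tensor_group A (gmod M ?d) (cmod C (\<alpha> \<cdot> \<beta>)))"
        by (rule gcoact_closed[OF M d c]) (simp add: e(3) m)
      have ca: "coact ?X \<alpha> (?i (?d \<cdot> \<alpha>) n) = tmap A ?X (cmod C \<alpha>) (?i ?d) (\<lambda>z. z) (gcoact M ?d \<alpha> n)"
        if "n \<in> carrier (gmod M (?d \<cdot> \<alpha>))" for n
        using F1_coact_dinj[OF M ab(1) da that] unfolding e(2) .
      have co: "tmap A (gmod M ?d) ?B (\<lambda>z. z) (comult C \<alpha> \<beta>) (gcoact M ?d (\<alpha> \<cdot> \<beta>) m) =
          tassoc A (gmod M ?d) (cmod C \<alpha>) (cmod C \<beta>)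
            (tmap A (tensor A (gmod M ?d) (cmod C \<alpha>)) (cmod C \<beta>) (gcoact M ?d \<alpha>) (\<lambda>z. z)
              (gcoact M (?d \<cdot> \<alpha>) \<beta> m))"
        by (rule gcoact_coassoc[OF d ab]) (simp add: e(4) m)
      show "tmap A ?X ?B (\<lambda>z. z) (comult C \<alpha> \<beta>) (coact ?X (\<alpha> \<cdot> \<beta>) (?i \<gamma> m)) =
       tassoc A ?X (cmod C \<alpha>) (cmod C \<beta>)
         (tmap A (tensor A ?X (cmod C \<alpha>)) (cmod C \<beta>) (coact ?X \<alpha>) (\<lambda>z. z) (coact ?X \<beta> (?i \<gamma> m)))"
        unfolding F1_coact_dinj[OF M c g m] F1_coact_dinj[OF M ab(2) g m] e(1)
        by (rule coassoc_transport[OF gmod_module[OF da] Xm gmod_module[OF d] Xm bm cmod_bimodule[OF c]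
              comult_lhom[OF ab] F1_dinj_rhom[OF M d] F1_dinj_rhom[OF M da] gcoact_hom[OF d ab(1)] h[OF ab(1)]
              _ s t co]) (rule ca)
    qed
  next
    fix x assume x: "x \<in> carrier ?X"
    note one = cmod_bimodule[OF G.one_closed]
    have "contract ?X (counit C) (coact ?X \<one>\<^bsub>G\<^esub> x) = x"
    proof (rule S.dsum_eqI[OF S.abelian_group_S _ ahom_id])
      show "(\<lambda>x. contract ?X (counit C) (coact ?X \<one>\<^bsub>G\<^esub> x)) \<in> ahom S.S S.S"
        using ahom_comp[OF contract_ahom[OF tp[OF G.one_closed] counit_lhom] F1_coact_ahom[OF M G.one_closed]]
        by (simp add: ahom_def)
      show "x \<in> carrier S.S" using x by simp
      fix \<beta> m assume b: "\<beta> \<in> carrier G" and m: "m \<in> carrier (gmod M \<beta>)"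
      have t: "gcoact M \<beta> \<one>\<^bsub>G\<^esub> m \<in> carrier (tensor_group A (gmod M \<beta>) (cmod C \<one>\<^bsub>G\<^esub>))"
        by (rule gcoact_closed[OF M b G.one_closed]) (simp add: b m)
      have "coact ?X \<one>\<^bsub>G\<^esub> (?i \<beta> m) = tmap A ?X (cmod C \<one>\<^bsub>G\<^esub>) (?i \<beta>) (\<lambda>z. z) (gcoact M \<beta> \<one>\<^bsub>G\<^esub> m)"
        using F1_coact_dinj[OF M G.one_closed b m] b by simp
      then show "contract ?X (counit C) (coact ?X \<one>\<^bsub>G\<^esub> (?i \<beta> m)) = ?i \<beta> m"
        using contract_tmap[OF tensor_pair_cmod[OF gmod_module[OF b] G.one_closed] tp[OF G.one_closed]
            F1_dinj_rhom[OF M b] lhom_id counit_lhom t]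
          gcoact_counit[OF b m] runit_tmap_counit[OF gmod_module[OF b] one counit_lhom t] by simp
    qed
    then show "runit ?X (tmap A ?X (regular A) (\<lambda>z. z) (counit C) (coact ?X \<one>\<^bsub>G\<^esub> x)) = x"
      using runit_tmap_counit[OF Xm one counit_lhom ahom_closed[OF F1_coact_ahom[OF M G.one_closed]]] x by simp
  }
qed

abbreviation F3_op where
  "F3_op M \<equiv> (\<lambda>\<alpha> \<beta> m f. contract (gmod M (\<alpha> \<cdot> \<beta>)) f (gcoact M (\<alpha> \<cdot> \<beta>) (\<iota> \<beta>) m))"

lemma F3_fob: "fob (F3 G A C) M = graded_module (gmod M) (F3_op M)"
  by (simp add: F3_def graded_module_def Let_def)

lemma F3_product:
  assumes M: "gcomodule G A C M"
  shows "graded_product G (gmod M) Q (gmod M) (F3_op M)"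
proof -
  interpret gcomodule G A C M by (rule M)
  have "biadditive (gmod M \<alpha>) (Q \<beta>) (gmod M (\<alpha> \<cdot> \<beta>)) (F3_op M \<alpha> \<beta>)" if ab: "\<alpha> \<in> carrier G" "\<beta> \<in> carrier G" for \<alpha> \<beta>
  proof -
    have c: "\<alpha> \<cdot> \<beta> \<in> carrier G" "\<iota> \<beta> \<in> carrier G" "\<alpha> \<cdot> \<beta> \<cdot> \<iota> \<beta> = \<alpha>"
      using ab by (auto simp: G.m_assoc)
    show ?thesis
      using rhom_ahom[OF gcoact_hom[OF c(1,2)]] unfolding c(3)
      by (intro contract_coaction_biadditive[OF gmod_module[OF c(1)] ab(2)]) simp
  qed
  then show ?thesis
    using gmod_family[OF M] dual_family G.group_axioms by (simp add: graded_product_def graded_product_axioms_def)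
qed

lemma F3_graded_right_module:
  assumes M: "gcomodule G A C M"
  shows "graded_right_module G R (dual_part G A C) (fob (F3 G A C) M)"
  unfolding F3_fob
proof (rule graded_module_graded_right_module[OF F3_product[OF M]])
  interpret gcomodule G A C M by (rule M)
  fix \<alpha> \<beta> \<gamma> n f g
  assume abg: "\<alpha> \<in> carrier G" "\<beta> \<in> carrier G" "\<gamma> \<in> carrier G" and n: "n \<in> carrier (gmod M \<alpha>)"
    and f: "f \<in> carrier (Q \<beta>)" and g: "g \<in> carrier (Q \<gamma>)"
  let ?ab = "\<alpha> \<cdot> \<beta>" and ?abg = "\<alpha> \<cdot> \<beta> \<cdot> \<gamma>"
  have c: "?ab \<in> carrier G" "?abg \<in> carrier G" "\<iota> \<beta> \<in> carrier G" "\<iota> \<gamma> \<in> carrier G" "\<iota> (\<beta> \<cdot> \<gamma>) \<in> carrier G"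
    using abg by auto
  have e: "?abg \<cdot> \<iota> \<gamma> = ?ab" "?ab \<cdot> \<iota> \<beta> = \<alpha>" "\<alpha> \<cdot> (\<beta> \<cdot> \<gamma>) = ?abg"
    "\<iota> (\<beta> \<cdot> \<gamma>) = \<iota> \<gamma> \<cdot> \<iota> \<beta>" "?abg \<cdot> \<iota> (\<beta> \<cdot> \<gamma>) = \<alpha>"
    using abg G.r_inv[of "\<beta> \<cdot> \<gamma>"] by (simp_all add: G.m_assoc G.inv_mult_group)
  have s: "gcoact M ?ab (\<iota> \<beta>) n \<in> carrier (tensor_group A (gmod M ?ab) (D \<beta>))"
    by (rule gcoact_closed[OF M c(1,3)]) (simp add: e(2) n)
  have t: "gcoact M ?abg (\<iota> (\<beta> \<cdot> \<gamma>)) n \<in> carrier (tensor_group A (gmod M ?abg) (D (\<beta> \<cdot> \<gamma>)))"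
    by (rule gcoact_closed[OF M c(2,5)]) (simp add: e(5) n)
  have co: "n \<in> carrier (gmod M (?abg \<cdot> \<iota> \<gamma> \<cdot> \<iota> \<beta>))"
    unfolding e by (rule n)
  show "F3_op M ?ab \<gamma> (F3_op M \<alpha> \<beta> n f) g = F3_op M \<alpha> (\<beta> \<cdot> \<gamma>) n (dual_mult G A C \<beta> \<gamma> f g)"
    unfolding e(3)
    by (rule coaction_dual_mult[OF gmod_module[OF c(1)] gmod_module[OF c(2)] abg(2,3) f g
          gcoact_hom[OF c(2,4), unfolded e(1)] s t])
      (use gcoact_coassoc[OF c(2,4,3) co] in \<open>simp only: e\<close>)
next
  interpret gcomodule G A C M by (rule M)
  fix \<alpha> n assume a: "\<alpha> \<in> carrier G" and n: "n \<in> carrier (gmod M \<alpha>)"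
  have t: "gcoact M \<alpha> \<one>\<^bsub>G\<^esub> n \<in> carrier (tensor_group A (gmod M \<alpha>) (cmod C \<one>\<^bsub>G\<^esub>))"
    by (rule gcoact_closed[OF M a G.one_closed]) (simp add: a n)
  show "F3_op M \<alpha> \<one>\<^bsub>G\<^esub> n eps = n"
    using a contract_eps[OF gmod_module[OF a] t] gcoact_counit[OF a n] by simp
qed

abbreviation F4_act where
  "F4_act M m r \<equiv> (\<Oplus>\<^bsub>M\<^esub>\<beta>\<in>dsupp (carrier G) Q r. contract M (r \<beta>) (coact M (\<iota> \<beta>) m))"

lemma F4_simps [simp]:
  "carrier (fob (F4 G A C) M) = carrier M" "zero (fob (F4 G A C) M) = zero M" "add (fob (F4 G A C) M) = add M"
  "\<lbrakk>m \<in> carrier M; r \<in> carrier (dsum (carrier G) Q)\<rbrakk> \<Longrightarrow> m \<triangleleft>\<^bsub>fob (F4 G A C) M\<^esub> r = F4_act M m r"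
  by (simp_all add: F4_def)

lemma F4_act_ahom:
  assumes M: "comodule G A C M" and m: "m \<in> carrier M"
  shows "F4_act M m \<in> ahom (dsum (carrier G) Q) M"
  using comodule_right_module[OF M] m
  by (intro dsum_family.dlift_ahom[OF dual_family, where h = "\<lambda>\<beta> f. contract M f (coact M (\<iota> \<beta>) m)"]
      contract_dual_ahom right_module_abelian_group coact_closed[OF M]) auto

lemma F4_act_dinj:
  assumes M: "comodule G A C M" and m: "m \<in> carrier M" and b: "\<beta> \<in> carrier G" and f: "f \<in> carrier (Q \<beta>)"
  shows "F4_act M m (dinj (carrier G) Q \<beta> f) = contract M f (coact M (\<iota> \<beta>) m)"
  using comodule_right_module[OF M] m
  by (intro dsum_family.dlift_dinj[OF dual_family _ _ b f, where h = "\<lambda>\<beta> f. contract M f (coact M (\<iota> \<beta>) m)"]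
      contract_dual_ahom right_module_abelian_group coact_closed[OF M]) auto

text \<open>
  Additivity in \<open>r\<close> is the universal property of the direct sum; for additivity in \<open>m\<close> the index set of
  the sum stays the same.
\<close>

lemma F4_act_biadditive:
  assumes M: "comodule G A C M"
  shows "biadditive M (dsum (carrier G) Q) M (F4_act M)"
  unfolding biadditive_def
proof (intro conjI ballI)
  interpret comodule G A C M by (rule M)
  interpret Q: dsum_family "carrier G" Q by (rule dual_family)
  note Mm = comodule_right_module[OF M]
  fix r assume r: "r \<in> carrier (dsum (carrier G) Q)"
  have h: "(\<lambda>m. contract M (r \<beta>) (coact M (\<iota> \<beta>) m)) \<in> ahom M M" if "\<beta> \<in> carrier G" for \<beta>
  proof -
    have i: "\<iota> \<beta> \<in> carrier G" using that by simp
    have "coact M (\<iota> \<beta>) \<in> ahom M (tensor_group A M (D \<beta>))"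
      using rhom_ahom[OF coact_hom[OF i]] by simp
    then show ?thesis
      by (rule ahom_comp[OF contract_ahom[OF tensor_pair_cmod[OF Mm i] dual_lhom[OF Q.S_apply[OF r that]]]])
  qed
  show "(\<lambda>m. F4_act M m r) \<in> ahom M M"
  proof (rule ahomI)
    fix m n assume mn: "m \<in> carrier M" "n \<in> carrier M"
    show "F4_act M (m \<oplus>\<^bsub>M\<^esub> n) r = F4_act M m r \<oplus>\<^bsub>M\<^esub> F4_act M n r"
      using mn ahom_closed[OF h] ahom_add[OF h] Q.dsuppD by (intro M.finsum_eq_add) auto
  qed (rule ahom_closed[OF F4_act_ahom[OF M] r])
qed (rule F4_act_ahom[OF M])

text \<open>
  For fixed \<open>m\<close> both sides of \<open>m \<cdot> (r # s) = (m \<cdot> r) \<cdot> s\<close> are biadditive in \<open>r\<close> and \<open>s\<close>; on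
  homogeneous elements the identity is coassociativity of the coaction.
\<close>

lemma F4_right_module:
  assumes M: "comodule G A C M"
  shows "right_module R (fob (F4 G A C) M)"
proof -
  interpret comodule G A C M by (rule M)
  interpret P: graded_product G Q Q Q "dual_mult G A C" by (rule dual_product)
  interpret R: ring R by (rule dual_ring_is_ring)
  note Mm = comodule_right_module[OF M]
  note ag = right_module_abelian_group[OF Mm]
  interpret X: abelian_group "fob (F4 G A C) M" by (rule abelian_group_transfer[OF ag]) simp_all
  note b = F4_act_biadditive[OF M] and bd = P.dext_biadditive
  note hom = F4_act_ahom[OF M] and cl = biadditive_closed[OF b]
  have assoc: "F4_act M m (r \<star> s) = F4_act M (F4_act M m r) s"
    if m: "m \<in> carrier M" and r: "r \<in> carrier P.M.S" and s: "s \<in> carrier P.M.S" for m r s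
  proof (rule P.dext_eqI[OF ag _ _ _ r s, where b = "\<lambda>r s. F4_act M m (r \<star> s)"
        and b' = "\<lambda>r s. F4_act M (F4_act M m r) s"])
    show "biadditive P.M.S P.M.S M (\<lambda>r s. F4_act M m (r \<star> s))"
      using bd unfolding biadditive_def by (auto intro: ahom_comp[OF hom[OF m]])
    show "biadditive P.M.S P.M.S M (\<lambda>r s. F4_act M (F4_act M m r) s)"
      unfolding biadditive_def
    proof (intro conjI ballI)
      fix s assume "s \<in> carrier P.M.S"
      then show "(\<lambda>r. F4_act M (F4_act M m r) s) \<in> ahom P.M.S M"
        by (rule ahom_comp[OF biadditive_left[OF b] hom[OF m]])
    next
      fix r assume "r \<in> carrier P.M.S"
      then show "F4_act M (F4_act M m r) \<in> ahom P.M.S M" by (rule hom[OF cl[OF m]])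
    qed
    fix \<alpha> \<beta> f g assume ab: "\<alpha> \<in> carrier G" "\<beta> \<in> carrier G" and f: "f \<in> carrier (Q \<alpha>)" and g: "g \<in> carrier (Q \<beta>)"
    let ?a = "\<iota> \<alpha>" and ?b = "\<iota> \<beta>"
    have i: "?a \<in> carrier G" "?b \<in> carrier G" "\<iota> (\<alpha> \<cdot> \<beta>) \<in> carrier G" using ab by auto
    have e: "\<iota> (\<alpha> \<cdot> \<beta>) = ?b \<cdot> ?a" using ab by (simp add: G.inv_mult_group)
    have "contract M g (coact M ?b (contract M f (coact M ?a m))) =
        contract M (dual_mult G A C \<alpha> \<beta> f g) (coact M (\<iota> (\<alpha> \<cdot> \<beta>)) m)"
      by (rule coaction_dual_mult[OF Mm Mm ab f g coact_hom[OF i(2)] coact_closed[OF M i(1) m] coact_closed[OF M i(3) m]])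
        (use coact_coassoc[OF i(2,1) m] in \<open>simp only: e\<close>)
    moreover have "F4_act M m (dinj (carrier G) Q \<alpha> f) \<in> carrier M"
      by (rule cl[OF m P.M.dinj_closed[OF ab(1) f]])
    ultimately show "F4_act M m (dinj (carrier G) Q \<alpha> f \<star> dinj (carrier G) Q \<beta> g) =
        F4_act M (F4_act M m (dinj (carrier G) Q \<alpha> f)) (dinj (carrier G) Q \<beta> g)"
      using ab f g m by (simp add: P.dext_dinj F4_act_dinj[OF M] dual_mult_closed)
  qed
  have one: "F4_act M m (dinj (carrier G) Q \<one>\<^bsub>G\<^esub> eps) = m" if m: "m \<in> carrier M" for m
    using F4_act_dinj[OF M m G.one_closed eps_closed] contract_eps[OF Mm coact_closed[OF M G.one_closed m]]
      coact_counit[OF m] by simp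
  have dadd: "r \<oplus>\<^bsub>P.M.S\<^esub> s \<in> carrier P.M.S" if "r \<in> carrier P.M.S" "s \<in> carrier P.M.S" for r s
    using abelian_groupE(1)[OF P.M.abelian_group_S that] .
  show ?thesis
    by unfold_locales
      (simp_all add: cl biadditive_add_left[OF b] biadditive_add_right[OF b] assoc one dadd P.dext_closed
         P.M.dinj_closed eps_closed M.a_closed)
qed

end

section \<open>The four categories\<close>

lemma rhom_compose:
  assumes L: "right_module A L" and f: "f \<in> rhom A L M" and g: "g \<in> rhom A M N"
  shows "compose (carrier L) g f \<in> rhom A L N"
  by (rule rhom_cong[OF rhom_comp[OF g f] _ L]) (simp add: compose_def)

lemma rhom_restrict_id: "right_module A M \<Longrightarrow> (\<lambda>m\<in>carrier M. m) \<in> rhom A M M"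
  by (rule rhom_cong[OF rhom_id]) simp_all

lemma rhom_funcset: "f \<in> rhom A M N \<Longrightarrow> f \<in> carrier M \<rightarrow> carrier N"
  by (simp add: rhom_def)

lemma rhom_compose_Id:
  "\<lbrakk>f \<in> rhom A M N; f \<in> extensional (carrier M)\<rbrakk> \<Longrightarrow> compose (carrier M) f (\<lambda>m\<in>carrier M. m) = f"
  by (rule compose_Id[OF rhom_funcset])

lemma rhom_Id_compose:
  "\<lbrakk>f \<in> rhom A M N; f \<in> extensional (carrier M)\<rbrakk> \<Longrightarrow> compose (carrier M) (\<lambda>m\<in>carrier N. m) f = f"
  by (rule Id_compose[OF rhom_funcset])

lemma rhom_compose_assoc:
  "f \<in> rhom A L M \<Longrightarrow>
   compose (carrier L) h (compose (carrier L) g f) = compose (carrier L) (compose (carrier M) h g) f"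
  by (rule compose_assoc[OF rhom_funcset])

lemma rmod_cat_category: "category (rmod_cat S)"
  by (rule category.intro)
    (auto simp: rmod_cat_def rhom_restrict_id rhom_compose_Id rhom_Id_compose
      intro: rhom_compose rhom_compose_assoc)

lemma grmod_cat_simps [simp]:
  "M \<in> Ob (grmod_cat G S SS) \<longleftrightarrow> graded_right_module G S SS M"
  "f \<in> Hom (grmod_cat G S SS) M N \<longleftrightarrow> f \<in> rhom S M N \<and> f \<in> extensional (carrier M) \<and>
     (\<forall>\<alpha>\<in>carrier G. f ` grade M \<alpha> \<subseteq> grade N \<alpha>)"
  "Ident (grmod_cat G S SS) M = (\<lambda>m\<in>carrier M. m)"
  "Comp (grmod_cat G S SS) L M N g f = compose (carrier L) g f"
  by (auto simp: grmod_cat_def)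

lemma graded_right_module_right_module: "graded_right_module G S SS M \<Longrightarrow> right_module S M"
  by (rule graded_right_module.axioms)

lemma grade_subset: "\<lbrakk>graded_right_module G S SS M; \<alpha> \<in> carrier G\<rbrakk> \<Longrightarrow> grade M \<alpha> \<subseteq> carrier M"
  using subgroup.subset[OF graded_right_module.grade_subgroup] by fastforce

lemma grmod_cat_category: "category (grmod_cat G S SS)"
proof (rule category.intro; unfold grmod_cat_simps)
  fix M assume M: "graded_right_module G S SS M"
  show "(\<lambda>m\<in>carrier M. m) \<in> rhom S M M \<and> (\<lambda>m\<in>carrier M. m) \<in> extensional (carrier M) \<and>
      (\<forall>\<alpha>\<in>carrier G. (\<lambda>m\<in>carrier M. m) ` grade M \<alpha> \<subseteq> grade M \<alpha>)"
    using grade_subset[OF M] by (auto simp: rhom_restrict_id graded_right_module_right_module[OF M] subset_iff)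
next
  fix L M N f g assume L: "graded_right_module G S SS L"
    and f: "f \<in> rhom S L M \<and> f \<in> extensional (carrier L) \<and> (\<forall>\<alpha>\<in>carrier G. f ` grade L \<alpha> \<subseteq> grade M \<alpha>)"
    and g: "g \<in> rhom S M N \<and> g \<in> extensional (carrier M) \<and> (\<forall>\<alpha>\<in>carrier G. g ` grade M \<alpha> \<subseteq> grade N \<alpha>)"
  have "compose (carrier L) g f x \<in> grade N \<alpha>" if a: "\<alpha> \<in> carrier G" and x: "x \<in> grade L \<alpha>" for \<alpha> x
    using f g a x grade_subset[OF L a] by (subst compose_eq) blast+
  then show "compose (carrier L) g f \<in> rhom S L N \<and> compose (carrier L) g f \<in> extensional (carrier L) \<and>
      (\<forall>\<alpha>\<in>carrier G. compose (carrier L) g f ` grade L \<alpha> \<subseteq> grade N \<alpha>)"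
    using rhom_compose[OF graded_right_module_right_module[OF L]] f g by auto
qed (auto intro: rhom_compose_Id rhom_Id_compose rhom_compose_assoc)

lemma is_functor_comp:
  assumes "is_functor K L F" "is_functor L M H"
  shows "is_functor K M (H \<circ>\<^sub>F F)"
proof -
  interpret F: is_functor K L F by fact
  interpret H: is_functor L M H by fact
  show ?thesis
    by (unfold_locales)
      (simp_all add: fcomp_def F.fob_Ob H.fob_Ob F.far_Hom H.far_Hom F.far_Ident H.far_Ident F.far_Comp H.far_Comp)
qed

lemma is_functorI:
  assumes "category K" "category L"
    and "\<And>X. X \<in> Ob K \<Longrightarrow> fob F X \<in> Ob L"
    and "\<And>X Y f. \<lbrakk>X \<in> Ob K; Y \<in> Ob K; f \<in> Hom K X Y\<rbrakk> \<Longrightarrow> far F X Y f \<in> Hom L (fob F X) (fob F Y)"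
    and "\<And>X. X \<in> Ob K \<Longrightarrow> far F X X (Ident K X) = Ident L (fob F X)"
    and "\<And>X Y Z f g. \<lbrakk>X \<in> Ob K; Y \<in> Ob K; Z \<in> Ob K; f \<in> Hom K X Y; g \<in> Hom K Y Z\<rbrakk> \<Longrightarrow>
       far F X Z (Comp K X Y Z g f) = Comp L (fob F X) (fob F Y) (fob F Z) (far F Y Z g) (far F X Y f)"
  shows "is_functor K L F"
  using assms by (simp add: is_functor_def is_functor_axioms_def)

lemma F5_functor: "is_functor (grmod_cat G S SS) (rmod_cat S) F5"
proof (rule is_functorI[OF grmod_cat_category rmod_cat_category])
  fix M assume "M \<in> Ob (grmod_cat G S SS)"
  then interpret graded_right_module G S SS M by (simp add: grmod_cat_def)
  interpret T: abelian_group "rmod.truncate M" by (rule abelian_group_transfer[OF abelian_group_axioms]) simp_all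
  have "right_module S (rmod.truncate M)"
    by unfold_locales (simp_all add: ract_closed ract_add_left ract_add_right ract_mult ract_one)
  then show "fob F5 M \<in> Ob (rmod_cat S)" by (simp add: F5_def rmod_cat_def)
qed (auto simp: F5_def rmod_cat_def grmod_cat_def rhom_def)

context group_coring
begin

abbreviation "CC \<equiv> comod_cat G A C"
abbreviation "GC \<equiv> gcomod_cat G A C"

lemma CC_Ob [simp]: "M \<in> Ob CC \<longleftrightarrow> comodule G A C M"
  by (simp add: comod_cat_def)

lemma CC_Hom: "f \<in> Hom CC M N \<longleftrightarrow> f \<in> rhom A M N \<and> f \<in> extensional (carrier M) \<and>
    (\<forall>\<alpha>\<in>carrier G. \<forall>m\<in>carrier M. coact N \<alpha> (f m) = tmap A N (cmod C \<alpha>) f (\<lambda>z. z) (coact M \<alpha> m))"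
  by (simp add: comod_cat_def)

lemma CC_Ident [simp]: "Ident CC M = (\<lambda>m\<in>carrier M. m)"
  by (simp add: comod_cat_def)

lemma CC_Comp [simp]: "Comp CC L M N g f = compose (carrier L) g f"
  by (simp add: comod_cat_def)

lemma GC_Ob [simp]: "M \<in> Ob GC \<longleftrightarrow> gcomodule G A C M"
  by (simp add: gcomod_cat_def)

lemma GC_Hom: "f \<in> Hom GC M N \<longleftrightarrow> f \<in> extensional (carrier G) \<and>
    (\<forall>\<alpha>\<in>carrier G. f \<alpha> \<in> rhom A (gmod M \<alpha>) (gmod N \<alpha>) \<and> f \<alpha> \<in> extensional (carrier (gmod M \<alpha>))) \<and>
    (\<forall>\<alpha>\<in>carrier G. \<forall>\<beta>\<in>carrier G. \<forall>m\<in>carrier (gmod M (\<alpha> \<cdot> \<beta>)).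
       tmap A (gmod N \<alpha>) (cmod C \<beta>) (f \<alpha>) (\<lambda>z. z) (gcoact M \<alpha> \<beta> m) = gcoact N \<alpha> \<beta> (f (\<alpha> \<cdot> \<beta>) m))"
  by (auto simp: gcomod_cat_def PiE_iff)

lemma GC_Ident [simp]: "Ident GC M = (\<lambda>\<alpha>\<in>carrier G. \<lambda>m\<in>carrier (gmod M \<alpha>). m)"
  by (simp add: gcomod_cat_def)

lemma GC_Comp [simp]: "Comp GC L M N g f = (\<lambda>\<alpha>\<in>carrier G. compose (carrier (gmod L \<alpha>)) (g \<alpha>) (f \<alpha>))"
  by (simp add: gcomod_cat_def)

lemma tmap_restrict_id:
  assumes M: "right_module A M" and a: "\<alpha> \<in> carrier G" and t: "t \<in> carrier (tensor_group A M (cmod C \<alpha>))"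
  shows "tmap A M (cmod C \<alpha>) (\<lambda>m\<in>carrier M. m) (\<lambda>z. z) t = t"
proof -
  note tp = tensor_pair_cmod[OF M a]
  have "tmap A M (cmod C \<alpha>) (\<lambda>z. z) (\<lambda>z. z) t = tmap A M (cmod C \<alpha>) (\<lambda>m\<in>carrier M. m) (\<lambda>z. z) t"
    by (rule tmap_cong_fun[OF tp tp rhom_id lhom_id _ _ t]) simp_all
  then show ?thesis using tmap_id[OF tp t] by simp
qed

lemma tmap_compose:
  assumes L: "right_module A L" and M: "right_module A M" and N: "right_module A N"
    and f: "f \<in> rhom A L M" and g: "g \<in> rhom A M N" and a: "\<alpha> \<in> carrier G"
    and t: "t \<in> carrier (tensor_group A L (cmod C \<alpha>))"
  shows "tmap A N (cmod C \<alpha>) (compose (carrier L) g f) (\<lambda>z. z) t =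
    tmap A N (cmod C \<alpha>) g (\<lambda>z. z) (tmap A M (cmod C \<alpha>) f (\<lambda>z. z) t)"
proof -
  note tp = tensor_pair_cmod[OF L a] tensor_pair_cmod[OF M a] tensor_pair_cmod[OF N a]
  have "tmap A N (cmod C \<alpha>) (\<lambda>x. g (f x)) (\<lambda>z. z) t = tmap A N (cmod C \<alpha>) (compose (carrier L) g f) (\<lambda>z. z) t"
    by (rule tmap_cong_fun[OF tp(1,3) rhom_comp[OF g f] lhom_id _ _ t]) (simp_all add: compose_eq)
  then show ?thesis using tmap_tmap[OF tp f lhom_id g lhom_id t] by simp
qed

lemma comod_cat_category: "category CC"
proof (rule category.intro; unfold CC_Ob CC_Ident CC_Comp)
  fix M assume M: "comodule G A C M"
  show "(\<lambda>m\<in>carrier M. m) \<in> Hom CC M M"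
    using comodule_right_module[OF M] coact_closed[OF M]
    by (simp add: CC_Hom rhom_restrict_id tmap_restrict_id)
next
  fix L M N f g assume o: "comodule G A C L" "comodule G A C M" "comodule G A C N"
    and f: "f \<in> Hom CC L M" and g: "g \<in> Hom CC M N"
  note m = o[THEN comodule_right_module]
  have fr: "f \<in> rhom A L M" and gr: "g \<in> rhom A M N" using f g by (auto simp: CC_Hom)
  show "compose (carrier L) g f \<in> Hom CC L N"
    using f g rhom_compose[OF m(1) fr gr] tmap_compose[OF m fr gr] coact_closed[OF o(1)] ahom_closed[OF rhom_ahom[OF fr]]
    by (simp add: CC_Hom compose_eq)
next
  fix L M N P f g h assume "f \<in> Hom CC L M"
  then show "compose (carrier L) h (compose (carrier L) g f) = compose (carrier L) (compose (carrier M) h g) f"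
    by (intro rhom_compose_assoc) (auto simp: CC_Hom)
qed (auto simp: CC_Hom intro: rhom_compose_Id rhom_Id_compose)

lemma gcomod_cat_category: "category GC"
proof (rule category.intro; unfold GC_Ob GC_Ident GC_Comp)
  fix M assume M: "gcomodule G A C M"
  show "(\<lambda>\<alpha>\<in>carrier G. \<lambda>m\<in>carrier (gmod M \<alpha>). m) \<in> Hom GC M M"
    using gcomodule.gmod_module[OF M] gcoact_closed[OF M]
    by (simp add: GC_Hom rhom_restrict_id tmap_restrict_id)
next
  fix L M N f g assume o: "gcomodule G A C L" "gcomodule G A C M" "gcomodule G A C N"
    and f: "f \<in> Hom GC L M" and g: "g \<in> Hom GC M N"
  note m = o[THEN gcomodule.gmod_module]
  have fr: "f \<alpha> \<in> rhom A (gmod L \<alpha>) (gmod M \<alpha>)" and gr: "g \<alpha> \<in> rhom A (gmod M \<alpha>) (gmod N \<alpha>)"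
    if "\<alpha> \<in> carrier G" for \<alpha> using f g that by (auto simp: GC_Hom)
  show "(\<lambda>\<alpha>\<in>carrier G. compose (carrier (gmod L \<alpha>)) (g \<alpha>) (f \<alpha>)) \<in> Hom GC L N"
    using f g rhom_compose[OF m(1) fr gr] tmap_compose[OF m fr gr] gcoact_closed[OF o(1)]
      ahom_closed[OF rhom_ahom[OF fr]]
    by (simp add: GC_Hom compose_eq)
next
  fix M N f assume f: "f \<in> Hom GC M N"
  show "(\<lambda>\<alpha>\<in>carrier G. compose (carrier (gmod M \<alpha>)) (f \<alpha>) ((\<lambda>\<alpha>\<in>carrier G. \<lambda>m\<in>carrier (gmod M \<alpha>). m) \<alpha>)) = f"
    using f by (intro extensionalityI[of _ "carrier G"])
      (auto simp: GC_Hom intro: rhom_compose_Id)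
  show "(\<lambda>\<alpha>\<in>carrier G. compose (carrier (gmod M \<alpha>)) ((\<lambda>\<alpha>\<in>carrier G. \<lambda>m\<in>carrier (gmod N \<alpha>). m) \<alpha>) (f \<alpha>)) = f"
    using f by (intro extensionalityI[of _ "carrier G"])
      (auto simp: GC_Hom intro: rhom_Id_compose)
next
  fix L M N P f g h assume f: "f \<in> Hom GC L M"
  show "(\<lambda>\<alpha>\<in>carrier G. compose (carrier (gmod L \<alpha>)) (h \<alpha>) ((\<lambda>\<alpha>\<in>carrier G. compose (carrier (gmod L \<alpha>)) (g \<alpha>) (f \<alpha>)) \<alpha>)) =
    (\<lambda>\<alpha>\<in>carrier G. compose (carrier (gmod L \<alpha>)) ((\<lambda>\<alpha>\<in>carrier G. compose (carrier (gmod M \<alpha>)) (h \<alpha>) (g \<alpha>)) \<alpha>) (f \<alpha>))"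
  proof (rule restrict_ext)
    fix \<alpha> assume a: "\<alpha> \<in> carrier G"
    then have "f \<alpha> \<in> rhom A (gmod L \<alpha>) (gmod M \<alpha>)" using f by (simp add: GC_Hom)
    from rhom_compose_assoc[OF this, of "h \<alpha>" "g \<alpha>"] a
    show "compose (carrier (gmod L \<alpha>)) (h \<alpha>) ((\<lambda>\<alpha>\<in>carrier G. compose (carrier (gmod L \<alpha>)) (g \<alpha>) (f \<alpha>)) \<alpha>) =
      compose (carrier (gmod L \<alpha>)) ((\<lambda>\<alpha>\<in>carrier G. compose (carrier (gmod M \<alpha>)) (h \<alpha>) (g \<alpha>)) \<alpha>) (f \<alpha>)"
      by simp
  qed
qed

section \<open>Functoriality\<close>

text \<open>
  Identities and composites in the category of graded comodules are restricted to the group and to the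
  carriers, whereas \<open>dsum_map\<close> uses the components at elements of the direct sum only; this and the next lemma reconcile
  the two conventions.
\<close>

lemma dsum_map_Ident:
  assumes "dsum_family (carrier G) M"
  shows "dsum_map (carrier G) M (\<lambda>\<alpha>\<in>carrier G. \<lambda>m\<in>carrier (M \<alpha>). m) = (\<lambda>x\<in>carrier (dsum (carrier G) M). x)"
proof -
  interpret dsum_family "carrier G" M by fact
  show ?thesis
    unfolding dsum_map_def
    by (intro restrict_ext S_ext) (auto simp: carrier_S dsupp_def PiE_iff extensional_def cong: conj_cong)
qed

lemma dsum_map_compose:
  assumes L: "dsum_family (carrier G) L" and M: "dsum_family (carrier G) M"
    and f: "\<And>\<alpha>. \<alpha> \<in> carrier G \<Longrightarrow> f \<alpha> \<in> ahom (L \<alpha>) (M \<alpha>)"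
  shows "dsum_map (carrier G) L (\<lambda>\<alpha>\<in>carrier G. compose (carrier (L \<alpha>)) (g \<alpha>) (f \<alpha>)) =
    compose (carrier (dsum (carrier G) L)) (dsum_map (carrier G) M g) (dsum_map (carrier G) L f)"
proof -
  interpret L: dsum_family "carrier G" L by fact
  have "dsum_map (carrier G) L f x \<in> carrier (dsum (carrier G) M)" if "x \<in> carrier L.S" for x
    by (rule dsum_map_closed[OF L M f that])
  then show ?thesis
    using L.S_apply unfolding compose_def
    by (intro ext) (auto simp: dsum_map_def compose_def)
qed

lemma dsum_map_extensional: "dsum_map I M f \<in> extensional (carrier (dsum I M))"
  by (simp add: dsum_map_def)

lemma dsum_map_GC_Comp:
  assumes "gcomodule G A C L" "gcomodule G A C M" and f: "f \<in> Hom GC L M"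
  shows "dsum_map (carrier G) (gmod L) (Comp GC L M N g f) =
    compose (carrier (dsum (carrier G) (gmod L))) (dsum_map (carrier G) (gmod M) g) (dsum_map (carrier G) (gmod L) f)"
  unfolding GC_Comp
  by (rule dsum_map_compose[OF gmod_family[OF assms(1)] gmod_family[OF assms(2)]])
    (rule rhom_ahom[of _ A], use f in \<open>simp add: GC_Hom\<close>)

lemma F1_far [simp]: "far (F1 G A C) M N f = dsum_map (carrier G) (gmod M) f"
  by (simp add: F1_def)

lemma F3_far [simp]: "far (F3 G A C) M N f = dsum_map (carrier G) (gmod M) f"
  by (simp add: F3_def)

text \<open>
  The sum \<open>\<Oplus>f\<close> of a morphism \<open>f\<close> of graded comodules carries the inclusion of the summand of degree
  \<open>\<delta>\<close> to the inclusion after \<open>f\<^sub>\<delta>\<close>, which reduces compatibility with the coactions to the components of \<open>f\<close>.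
\<close>

lemma F1_functor: "is_functor GC CC (F1 G A C)"
proof (rule is_functorI[OF gcomod_cat_category comod_cat_category])
  fix M N f assume MN: "M \<in> Ob GC" "N \<in> Ob GC" and f: "f \<in> Hom GC M N"
  then have M: "gcomodule G A C M" and N: "gcomodule G A C N" by simp_all
  note fam = gmod_family[OF M] gmod_family[OF N]
  interpret M: gcomodule G A C M by (rule M)
  interpret S: dsum_family "carrier G" "gmod M" by (rule fam(1))
  let ?X = "fob (F1 G A C) M" and ?Y = "fob (F1 G A C) N" and ?f = "dsum_map (carrier G) (gmod M) f"
  have fr: "f \<alpha> \<in> rhom A (gmod M \<alpha>) (gmod N \<alpha>)" if "\<alpha> \<in> carrier G" for \<alpha> using f that by (simp add: GC_Hom)
  note fa = rhom_ahom[OF fr]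
  note h = dsum_map_ahom[OF fam fa] and hd = dsum_map_dinj[OF fam fa]
  note Xm = F1_right_module[OF M] and Ym = F1_right_module[OF N]
  have r: "(\<lambda>x. x \<triangleleft>\<^bsub>?X\<^esub> a) \<in> ahom S.S S.S" if "a \<in> carrier A" for a
    using ahom_ract[OF Xm that] by (simp add: ahom_def)
  have r': "(\<lambda>x. x \<triangleleft>\<^bsub>?Y\<^esub> a) \<in> ahom (dsum (carrier G) (gmod N)) (dsum (carrier G) (gmod N))" if "a \<in> carrier A" for a
    using ahom_ract[OF Ym that] by (simp add: ahom_def)
  have rh: "?f \<in> rhom A ?X ?Y"
  proof (rule rhomI)
    show "?f \<in> ahom ?X ?Y" using h by (simp add: ahom_def)
    fix x a assume x: "x \<in> carrier ?X" and a: "a \<in> carrier A"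
    show "?f (x \<triangleleft>\<^bsub>?X\<^esub> a) = ?f x \<triangleleft>\<^bsub>?Y\<^esub> a"
    proof (rule S.dsum_eqI[OF dsum_family.abelian_group_S[OF fam(2)] ahom_comp[OF h r[OF a]] ahom_comp[OF r'[OF a] h]])
      show "x \<in> carrier S.S" using x by simp
      fix \<beta> m assume b: "\<beta> \<in> carrier G" and m: "m \<in> carrier (gmod M \<beta>)"
      have "f \<beta> m \<in> carrier (gmod N \<beta>)" using ahom_closed[OF fa[OF b] m] .
      then show "?f (dinj (carrier G) (gmod M) \<beta> m \<triangleleft>\<^bsub>?X\<^esub> a) = ?f (dinj (carrier G) (gmod M) \<beta> m) \<triangleleft>\<^bsub>?Y\<^esub> a"
        using rhom_ract[OF F1_dinj_rhom[OF M b] m a, symmetric] rhom_ract[OF F1_dinj_rhom[OF N b] _ a, symmetric]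
          right_module.ract_closed[OF M.gmod_module[OF b] m a] rhom_ract[OF fr[OF b] m a]
        by (simp add: hd fa b m del: F1_simps)
    qed
  qed
  have "coact ?Y \<alpha> (?f x) = tmap A ?Y (cmod C \<alpha>) ?f (\<lambda>z. z) (coact ?X \<alpha> x)"
    if a: "\<alpha> \<in> carrier G" and x: "x \<in> carrier S.S" for \<alpha> x
  proof (rule S.dsum_eqI[OF tensor_pair.abelian_group_T[OF tensor_pair_cmod[OF Ym a]] ahom_comp[OF F1_coact_ahom[OF N a] h]
        ahom_comp[OF tmap_ahom[OF tensor_pair_cmod[OF Xm a] tensor_pair_cmod[OF Ym a] rh lhom_id] F1_coact_ahom[OF M a]] x])
    fix \<beta> m assume b: "\<beta> \<in> carrier G" and m: "m \<in> carrier (gmod M \<beta>)"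
    let ?d = "\<beta> \<cdot> \<iota> \<alpha>"
    have d: "?d \<in> carrier G" and e: "?d \<cdot> \<alpha> = \<beta>" using a b by (auto simp: G.m_assoc)
    have m': "m \<in> carrier (gmod M (?d \<cdot> \<alpha>))" unfolding e by (rule m)
    have t: "gcoact M ?d \<alpha> m \<in> carrier (tensor_group A (gmod M ?d) (cmod C \<alpha>))"
      by (rule gcoact_closed[OF M d a m'])
    note tp = tensor_pair_cmod[OF M.gmod_module[OF d] a] tensor_pair_cmod[OF gcomodule.gmod_module[OF N d] a]
      tensor_pair_cmod[OF Xm a] tensor_pair_cmod[OF Ym a]
    have fm: "f \<beta> m \<in> carrier (gmod N \<beta>)" using ahom_closed[OF fa[OF b] m] .
    have "coact ?Y \<alpha> (?f (dinj (carrier G) (gmod M) \<beta> m)) =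
        tmap A ?Y (cmod C \<alpha>) (dinj (carrier G) (gmod N) ?d) (\<lambda>z. z) (gcoact N ?d \<alpha> (f \<beta> m))"
      using hd[OF _ b m] F1_coact_dinj[OF N a b fm] by simp
    also have "gcoact N ?d \<alpha> (f \<beta> m) = tmap A (gmod N ?d) (cmod C \<alpha>) (f ?d) (\<lambda>z. z) (gcoact M ?d \<alpha> m)"
      using f d a m' unfolding GC_Hom by (metis e)
    also have "tmap A ?Y (cmod C \<alpha>) (dinj (carrier G) (gmod N) ?d) (\<lambda>z. z) \<dots> =
        tmap A ?Y (cmod C \<alpha>) (\<lambda>n. dinj (carrier G) (gmod N) ?d (f ?d n)) (\<lambda>z. z) (gcoact M ?d \<alpha> m)"
      by (rule tmap_tmap[OF tp(1,2,4) fr[OF d] lhom_id F1_dinj_rhom[OF N d] lhom_id t])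
    also have "\<dots> = tmap A ?Y (cmod C \<alpha>) (\<lambda>n. ?f (dinj (carrier G) (gmod M) ?d n)) (\<lambda>z. z) (gcoact M ?d \<alpha> m)"
      by (rule tmap_cong_fun[OF tp(1,4) rhom_comp[OF F1_dinj_rhom[OF N d] fr[OF d]] lhom_id _ _ t])
        (simp_all add: hd[OF _ d])
    also have "\<dots> = tmap A ?Y (cmod C \<alpha>) ?f (\<lambda>z. z)
        (tmap A ?X (cmod C \<alpha>) (dinj (carrier G) (gmod M) ?d) (\<lambda>z. z) (gcoact M ?d \<alpha> m))"
      by (rule tmap_tmap[OF tp(1,3,4) F1_dinj_rhom[OF M d] lhom_id rh lhom_id t, symmetric])
    also have "tmap A ?X (cmod C \<alpha>) (dinj (carrier G) (gmod M) ?d) (\<lambda>z. z) (gcoact M ?d \<alpha> m) =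
        coact ?X \<alpha> (dinj (carrier G) (gmod M) \<beta> m)"
      using F1_coact_dinj[OF M a b m] by simp
    finally show "coact ?Y \<alpha> (?f (dinj (carrier G) (gmod M) \<beta> m)) =
      tmap A ?Y (cmod C \<alpha>) ?f (\<lambda>z. z) (coact ?X \<alpha> (dinj (carrier G) (gmod M) \<beta> m))" .
  qed
  then show "far (F1 G A C) M N f \<in> Hom CC ?X ?Y"
    using rh dsum_map_extensional by (simp add: CC_Hom)
next
  fix L M N f g assume "L \<in> Ob GC" "M \<in> Ob GC" "f \<in> Hom GC L M"
  then show "far (F1 G A C) L N (Comp GC L M N g f) = Comp CC (fob (F1 G A C) L) (fob (F1 G A C) M)
      (fob (F1 G A C) N) (far (F1 G A C) M N g) (far (F1 G A C) L M f)"
    using dsum_map_GC_Comp[of L M f N g] by (simp del: GC_Comp)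
qed (simp_all add: F1_comodule dsum_map_Ident[OF gmod_family])

lemma F3_functor: "is_functor GC (grmod_cat G R (dual_part G A C)) (F3 G A C)"
proof (rule is_functorI[OF gcomod_cat_category grmod_cat_category])
  fix M N f assume MN: "M \<in> Ob GC" "N \<in> Ob GC" and f: "f \<in> Hom GC M N"
  then have M: "gcomodule G A C M" and N: "gcomodule G A C N" by simp_all
  interpret M: gcomodule G A C M by (rule M)
  interpret N: gcomodule G A C N by (rule N)
  have fr: "f \<alpha> \<in> rhom A (gmod M \<alpha>) (gmod N \<alpha>)" if "\<alpha> \<in> carrier G" for \<alpha> using f that by (simp add: GC_Hom)
  have comm: "f (\<alpha> \<cdot> \<beta>) (F3_op M \<alpha> \<beta> n r) = F3_op N \<alpha> \<beta> (f \<alpha> n) r"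
    if ab: "\<alpha> \<in> carrier G" "\<beta> \<in> carrier G" and n: "n \<in> carrier (gmod M \<alpha>)" and r: "r \<in> carrier (Q \<beta>)" for \<alpha> \<beta> n r
  proof -
    have c: "\<alpha> \<cdot> \<beta> \<in> carrier G" "\<iota> \<beta> \<in> carrier G" and e: "\<alpha> \<cdot> \<beta> \<cdot> \<iota> \<beta> = \<alpha>"
      using ab by (auto simp: G.m_assoc)
    have n': "n \<in> carrier (gmod M (\<alpha> \<cdot> \<beta> \<cdot> \<iota> \<beta>))" unfolding e by (rule n)
    have "gcoact N (\<alpha> \<cdot> \<beta>) (\<iota> \<beta>) (f \<alpha> n) =
        tmap A (gmod N (\<alpha> \<cdot> \<beta>)) (D \<beta>) (f (\<alpha> \<cdot> \<beta>)) (\<lambda>z. z) (gcoact M (\<alpha> \<cdot> \<beta>) (\<iota> \<beta>) n)"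
      using f c n' unfolding GC_Hom by (metis e)
    then show ?thesis
      using contract_tmap[OF tensor_pair_cmod[OF M.gmod_module[OF c(1)] c(2)] tensor_pair_cmod[OF N.gmod_module[OF c(1)] c(2)]
          fr[OF c(1)] lhom_id dual_lhom[OF r] gcoact_closed[OF M c n']] by simp
  qed
  note hom = graded_module_rhom[OF F3_product[OF M] F3_product[OF N], of f]
  have "dsum_map (carrier G) (gmod M) f \<in> rhom R (fob (F3 G A C) M) (fob (F3 G A C) N)"
    unfolding F3_fob by (rule hom(1)[OF rhom_ahom[OF fr] comm])
  moreover have "dsum_map (carrier G) (gmod M) f ` grade (fob (F3 G A C) M) \<alpha> \<subseteq> grade (fob (F3 G A C) N) \<alpha>"
    if "\<alpha> \<in> carrier G" for \<alpha>
    unfolding F3_fob by (rule hom(2)[OF rhom_ahom[OF fr] comm that])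
  ultimately show "far (F3 G A C) M N f \<in> Hom (grmod_cat G R (dual_part G A C)) (fob (F3 G A C) M) (fob (F3 G A C) N)"
    using dsum_map_extensional by (simp add: F3_fob)
next
  fix L M N f g assume "L \<in> Ob GC" "M \<in> Ob GC" "f \<in> Hom GC L M"
  then show "far (F3 G A C) L N (Comp GC L M N g f) = Comp (grmod_cat G R (dual_part G A C)) (fob (F3 G A C) L)
      (fob (F3 G A C) M) (fob (F3 G A C) N) (far (F3 G A C) M N g) (far (F3 G A C) L M f)"
    using dsum_map_GC_Comp[of L M f N g] by (simp add: F3_fob del: GC_Comp)
qed (simp_all add: F3_graded_right_module, simp add: F3_fob dsum_map_Ident[OF gmod_family])

lemma G1_far: "far (G1 G A C) M N f = (\<lambda>\<alpha>\<in>carrier G. \<lambda>x\<in>carrier (mu \<alpha> M). (\<alpha>, f (snd x)))"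
  by (simp add: G1_def)

lemma G1_functor: "is_functor CC GC (G1 G A C)"
proof (rule is_functorI[OF comod_cat_category gcomod_cat_category])
  fix M N f assume MN: "M \<in> Ob CC" "N \<in> Ob CC" and f: "f \<in> Hom CC M N"
  then have M: "comodule G A C M" and N: "comodule G A C N" by simp_all
  note Mm = comodule_right_module[OF M] and Nm = comodule_right_module[OF N]
  have fr: "f \<in> rhom A M N" using f by (simp add: CC_Hom)
  let ?F = "far (G1 G A C) M N f"
  note F = G1_far[of M N f]
  have h: "(\<lambda>x. (\<alpha>, f (snd x))) \<in> rhom A (mu \<alpha> M) (mu \<alpha> N)" for \<alpha>
    by (rule rhom_comp[OF Pair_rhom rhom_comp[OF fr snd_rhom]])
  have hr: "(\<lambda>x\<in>carrier (mu \<alpha> M). (\<alpha>, f (snd x))) \<in> rhom A (mu \<alpha> M) (mu \<alpha> N)" for \<alpha>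
    by (rule rhom_cong[OF h _ mu_right_module[OF Mm]]) simp
  have "tmap A (mu \<alpha> N) (cmod C \<beta>) (?F \<alpha>) (\<lambda>z. z) (gcoact (fob (G1 G A C) M) \<alpha> \<beta> x) =
      gcoact (fob (G1 G A C) N) \<alpha> \<beta> (?F (\<alpha> \<cdot> \<beta>) x)"
    if ab: "\<alpha> \<in> carrier G" "\<beta> \<in> carrier G" and x: "x \<in> carrier (mu (\<alpha> \<cdot> \<beta>) M)" for \<alpha> \<beta> x
  proof -
    obtain m where m: "x = (\<alpha> \<cdot> \<beta>, m)" "m \<in> carrier M" using x by auto
    note tp = tensor_pair_cmod[OF Mm ab(2)] tensor_pair_cmod[OF mu_right_module[OF Mm] ab(2), of \<alpha>]
      tensor_pair_cmod[OF Nm ab(2)] tensor_pair_cmod[OF mu_right_module[OF Nm] ab(2), of \<alpha>]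
    note t = coact_closed[OF M ab(2) m(2)]
    have Fa: "?F \<alpha> \<in> rhom A (mu \<alpha> M) (mu \<alpha> N)" using hr ab by (simp add: F del: mu_simps)
    have "tmap A (mu \<alpha> N) (cmod C \<beta>) (?F \<alpha>) (\<lambda>z. z) (gcoact (fob (G1 G A C) M) \<alpha> \<beta> x) =
        tmap A (mu \<alpha> N) (cmod C \<beta>) (\<lambda>n. ?F \<alpha> (\<alpha>, n)) (\<lambda>z. z) (coact M \<beta> m)"
      using tmap_tmap[OF tp(1,2,4) Pair_rhom lhom_id Fa lhom_id t] by (simp add: m)
    also have "\<dots> = tmap A (mu \<alpha> N) (cmod C \<beta>) (\<lambda>n. (\<alpha>, f n)) (\<lambda>z. z) (coact M \<beta> m)"
      by (rule tmap_cong_fun[OF tp(1,4) rhom_comp[OF Fa Pair_rhom] lhom_id _ _ t]) (simp_all add: F ab)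
    also have "\<dots> = tmap A (mu \<alpha> N) (cmod C \<beta>) (Pair \<alpha>) (\<lambda>z. z) (tmap A N (cmod C \<beta>) f (\<lambda>z. z) (coact M \<beta> m))"
      by (rule tmap_tmap[OF tp(1,3,4) fr lhom_id Pair_rhom lhom_id t, symmetric])
    also have "\<dots> = gcoact (fob (G1 G A C) N) \<alpha> \<beta> (?F (\<alpha> \<cdot> \<beta>) x)"
      using f ab m by (simp add: CC_Hom F)
    finally show ?thesis .
  qed
  moreover have "?F \<in> extensional (carrier G)" by (simp add: F)
  moreover have "?F \<alpha> \<in> rhom A (mu \<alpha> M) (mu \<alpha> N)" "?F \<alpha> \<in> extensional (carrier (mu \<alpha> M))"
    if "\<alpha> \<in> carrier G" for \<alpha> using hr that by (simp_all add: F del: mu_simps)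
  ultimately show "?F \<in> Hom GC (fob (G1 G A C) M) (fob (G1 G A C) N)"
    unfolding GC_Hom G1_simps(1) by blast
next
  fix L M N f g assume "L \<in> Ob CC" "f \<in> Hom CC L M"
  then have "f \<in> rhom A L M" by (simp add: CC_Hom)
  then have "f m \<in> carrier M" if "m \<in> carrier L" for m using ahom_closed[OF rhom_ahom] that by metis
  then show "far (G1 G A C) L N (Comp CC L M N g f) = Comp GC (fob (G1 G A C) L) (fob (G1 G A C) M)
      (fob (G1 G A C) N) (far (G1 G A C) M N g) (far (G1 G A C) L M f)"
    unfolding CC_Comp GC_Comp G1_far G1_simps(1) by (intro restrict_ext) (auto simp: compose_def intro!: restrict_ext)
qed (simp_all add: G1_gcomodule, auto simp: G1_def fun_eq_iff)

lemma F4_far: "far (F4 G A C) M N f = f"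
  by (simp add: F4_def)

lemma F4_functor: "is_functor CC (rmod_cat R) (F4 G A C)"
proof (rule is_functorI[OF comod_cat_category rmod_cat_category])
  fix M N f assume MN: "M \<in> Ob CC" "N \<in> Ob CC" and f: "f \<in> Hom CC M N"
  then have M: "comodule G A C M" and N: "comodule G A C N" by simp_all
  note Mm = comodule_right_module[OF M] and Nm = comodule_right_module[OF N]
  have fr: "f \<in> rhom A M N" using f by (simp add: CC_Hom)
  note fa = rhom_ahom[OF fr]
  have "f (F4_act M m r) = F4_act N (f m) r" if m: "m \<in> carrier M" and r: "r \<in> carrier (dsum (carrier G) Q)" for m r
  proof (rule dsum_family.dsum_eqI[OF dual_family right_module_abelian_group[OF Nm] ahom_comp[OF fa F4_act_ahom[OF M m]]
        F4_act_ahom[OF N ahom_closed[OF fa m]] r])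
    fix \<beta> q assume b: "\<beta> \<in> carrier G" and q: "q \<in> carrier (Q \<beta>)"
    have i: "\<iota> \<beta> \<in> carrier G" using b by simp
    show "f (F4_act M m (dinj (carrier G) Q \<beta> q)) = F4_act N (f m) (dinj (carrier G) Q \<beta> q)"
      using contract_tmap[OF tensor_pair_cmod[OF Mm i] tensor_pair_cmod[OF Nm i] fr lhom_id dual_lhom[OF q] coact_closed[OF M i m]]
        f i m by (simp add: F4_act_dinj[OF M m b q] F4_act_dinj[OF N ahom_closed[OF fa m] b q] CC_Hom)
  qed
  moreover have "f \<in> ahom (fob (F4 G A C) M) (fob (F4 G A C) N)" using fa by (simp add: ahom_def)
  ultimately have "f \<in> rhom R (fob (F4 G A C) M) (fob (F4 G A C) N)"
    using ahom_closed[OF fa] by (intro rhomI) simp_all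
  then show "far (F4 G A C) M N f \<in> Hom (rmod_cat R) (fob (F4 G A C) M) (fob (F4 G A C) N)"
    using f by (simp add: rmod_cat_def F4_far CC_Hom)
qed (simp_all add: rmod_cat_def F4_right_module F4_far)

abbreviation G5_op where
  "G5_op M \<equiv> (\<lambda>\<alpha> \<beta> m f. (\<alpha> \<cdot> \<beta>, snd m \<triangleleft>\<^bsub>M\<^esub> dinj (carrier G) Q \<beta> f))"

lemma G5_fob: "fob (G5 G A C) M = graded_module (\<lambda>\<alpha>. mu \<alpha> M) (G5_op M)"
  by (simp add: G5_def graded_module_def Let_def)

lemma mu_family: "right_module S M \<Longrightarrow> dsum_family (carrier G) (\<lambda>\<alpha>. mu \<alpha> M)"
  by (rule dsum_family.intro[OF right_module_abelian_group[OF mu_right_module]])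

lemma G5_product:
  assumes M: "right_module R M"
  shows "graded_product G (\<lambda>\<alpha>. mu \<alpha> M) Q (\<lambda>\<alpha>. mu \<alpha> M) (G5_op M)"
proof -
  interpret right_module R M by (rule M)
  interpret D: dsum_family "carrier G" Q by (rule dual_family)
  have "biadditive (mu \<alpha> M) (Q \<beta>) (mu (\<alpha> \<cdot> \<beta>) M) (G5_op M \<alpha> \<beta>)" if b: "\<beta> \<in> carrier G" for \<alpha> \<beta>
    unfolding biadditive_def
    using D.dinj_closed[OF b] ahom_add[OF D.dinj_ahom[OF b]]
    by (auto intro!: ahomI simp: ract_closed ract_add_left ract_add_right[simplified])
  then show ?thesis
    using mu_family[OF M] dual_family G.group_axioms by (simp add: graded_product_def graded_product_axioms_def)
qed

lemma G5_graded_right_module: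
  assumes M: "right_module R M"
  shows "graded_right_module G R (dual_part G A C) (fob (G5 G A C) M)"
  unfolding G5_fob
proof (rule graded_module_graded_right_module[OF G5_product[OF M]])
  interpret right_module R M by (rule M)
  interpret P: graded_product G Q Q Q "dual_mult G A C" by (rule dual_product)
  show "G5_op M (\<alpha> \<cdot> \<beta>) \<gamma> (G5_op M \<alpha> \<beta> n f) g = G5_op M \<alpha> (\<beta> \<cdot> \<gamma>) n (dual_mult G A C \<beta> \<gamma> f g)"
    if "\<alpha> \<in> carrier G" "\<beta> \<in> carrier G" "\<gamma> \<in> carrier G" "n \<in> carrier (mu \<alpha> M)" "f \<in> carrier (Q \<beta>)" "g \<in> carrier (Q \<gamma>)"
    for \<alpha> \<beta> \<gamma> n f g
  proof -
    have "snd n \<in> carrier M" using that by auto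
    then show ?thesis
      using that ract_mult[of "snd n" "dinj (carrier G) Q \<beta> f" "dinj (carrier G) Q \<gamma> g"]
      by (simp add: G.m_assoc P.M.dinj_closed P.dext_dinj)
  qed
  show "G5_op M \<alpha> \<one>\<^bsub>G\<^esub> n eps = n" if "\<alpha> \<in> carrier G" "n \<in> carrier (mu \<alpha> M)" for \<alpha> n
    using that ract_one by auto
qed

lemma G5_functor: "is_functor (rmod_cat R) (grmod_cat G R (dual_part G A C)) (G5 G A C)"
proof (rule is_functorI[OF rmod_cat_category grmod_cat_category])
  fix M N f assume "M \<in> Ob (rmod_cat R)" "N \<in> Ob (rmod_cat R)" and f: "f \<in> Hom (rmod_cat R) M N"
  then have M: "right_module R M" and N: "right_module R N" by (simp_all add: rmod_cat_def)
  have fr: "f \<in> rhom R M N" using f by (simp add: rmod_cat_def)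
  have h: "(\<lambda>x. (\<alpha>, f (snd x))) \<in> ahom (mu \<alpha> M) (mu \<alpha> N)" for \<alpha>
    by (rule rhom_ahom[OF rhom_comp[OF Pair_rhom rhom_comp[OF fr snd_rhom]]])
  have comm: "((\<alpha> \<cdot> \<beta>), f (snd (G5_op M \<alpha> \<beta> n r))) = G5_op N \<alpha> \<beta> (\<alpha>, f (snd n)) r"
    if "\<beta> \<in> carrier G" "n \<in> carrier (mu \<alpha> M)" "r \<in> carrier (Q \<beta>)" for \<alpha> \<beta> n r
    using that rhom_ract[OF fr, of "snd n" "dinj (carrier G) Q \<beta> r"] dsum_family.dinj_closed[OF dual_family] by auto
  let ?f = "dsum_map (carrier G) (\<lambda>\<alpha>. mu \<alpha> M) (\<lambda>\<alpha> x. (\<alpha>, f (snd x)))"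
  note hom = graded_module_rhom[OF G5_product[OF M] G5_product[OF N], of "\<lambda>\<alpha> x. (\<alpha>, f (snd x))"]
  have "?f \<in> rhom R (fob (G5 G A C) M) (fob (G5 G A C) N)"
    unfolding G5_fob by (rule hom(1)[OF h comm])
  moreover have "?f ` grade (fob (G5 G A C) M) \<alpha> \<subseteq> grade (fob (G5 G A C) N) \<alpha>" if "\<alpha> \<in> carrier G" for \<alpha>
    unfolding G5_fob by (rule hom(2)[OF h comm that])
  moreover have "far (G5 G A C) M N f = ?f" by (simp add: G5_def)
  ultimately show "far (G5 G A C) M N f \<in> Hom (grmod_cat G R (dual_part G A C)) (fob (G5 G A C) M) (fob (G5 G A C) N)"
    using dsum_map_extensional by (simp add: G5_fob)
next
  fix M assume "M \<in> Ob (rmod_cat R)"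
  then have M: "right_module R M" by (simp add: rmod_cat_def)
  interpret dsum_family "carrier G" "\<lambda>\<alpha>. mu \<alpha> M" by (rule mu_family[OF M])
  show "far (G5 G A C) M M (Ident (rmod_cat R) M) = Ident (grmod_cat G R (dual_part G A C)) (fob (G5 G A C) M)"
  proof -
    have "dsum_map (carrier G) (\<lambda>\<alpha>. mu \<alpha> M) (\<lambda>\<alpha> x. (\<alpha>, (\<lambda>m\<in>carrier M. m) (snd x))) =
        dsum_map (carrier G) (\<lambda>\<alpha>. mu \<alpha> M) (\<lambda>\<alpha>\<in>carrier G. \<lambda>m\<in>carrier (mu \<alpha> M). m)"
      unfolding dsum_map_def using S_apply by (intro restrict_ext) fastforce
    then show ?thesis
      using dsum_map_Ident[OF dsum_family_axioms] by (simp add: rmod_cat_def grmod_cat_def G5_fob) (simp add: G5_def)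
  qed
next
  fix L M N f g
  assume "L \<in> Ob (rmod_cat R)" "M \<in> Ob (rmod_cat R)" and f: "f \<in> Hom (rmod_cat R) L M" and "g \<in> Hom (rmod_cat R) M N"
  then have L: "right_module R L" and M: "right_module R M" by (simp_all add: rmod_cat_def)
  have fr: "f \<in> rhom R L M" using f by (simp add: rmod_cat_def)
  have h: "(\<lambda>x. (\<alpha>, f (snd x))) \<in> ahom (mu \<alpha> L) (mu \<alpha> M)" for \<alpha>
    by (rule rhom_ahom[OF rhom_comp[OF Pair_rhom rhom_comp[OF fr snd_rhom]]])
  interpret dsum_family "carrier G" "\<lambda>\<alpha>. mu \<alpha> L" by (rule mu_family[OF L])
  have "dsum_map (carrier G) (\<lambda>\<alpha>. mu \<alpha> L) (\<lambda>\<alpha> x. (\<alpha>, compose (carrier L) g f (snd x))) =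
      dsum_map (carrier G) (\<lambda>\<alpha>. mu \<alpha> L) (\<lambda>\<alpha>\<in>carrier G. compose (carrier (mu \<alpha> L)) (\<lambda>x. (\<alpha>, g (snd x))) (\<lambda>x. (\<alpha>, f (snd x))))"
    unfolding dsum_map_def using S_apply by (intro restrict_ext) (fastforce simp: compose_def)
  also have "\<dots> = compose (carrier S) (dsum_map (carrier G) (\<lambda>\<alpha>. mu \<alpha> M) (\<lambda>\<alpha> x. (\<alpha>, g (snd x))))
      (dsum_map (carrier G) (\<lambda>\<alpha>. mu \<alpha> L) (\<lambda>\<alpha> x. (\<alpha>, f (snd x))))"
    by (rule dsum_map_compose[OF mu_family[OF L] mu_family[OF M] h])
  finally show "far (G5 G A C) L N (Comp (rmod_cat R) L M N g f) = Comp (grmod_cat G R (dual_part G A C)) (fob (G5 G A C) L)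
      (fob (G5 G A C) M) (fob (G5 G A C) N) (far (G5 G A C) M N g) (far (G5 G A C) L M f)"
    by (simp add: rmod_cat_def G5_fob) (simp add: G5_def)
qed (simp_all add: rmod_cat_def G5_graded_right_module)

section \<open>The square commutes\<close>

text \<open>
  The two records have the same additive fields, and their actions are restricted to the same carriers,
  so only the biadditive maps underneath have to be compared, on homogeneous elements.
\<close>

lemma F5_F3_eq_F4_F1:
  "functors_equal GC (rmod_cat R) (F5 \<circ>\<^sub>F F3 G A C) (F4 G A C \<circ>\<^sub>F F1 G A C)"
  unfolding functors_equal_def
proof (intro conjI ballI)
  show "is_functor GC (rmod_cat R) (F5 \<circ>\<^sub>F F3 G A C)" by (rule is_functor_comp[OF F3_functor F5_functor])
  show "is_functor GC (rmod_cat R) (F4 G A C \<circ>\<^sub>F F1 G A C)" by (rule is_functor_comp[OF F1_functor F4_functor])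
  show "far (F5 \<circ>\<^sub>F F3 G A C) M N f = far (F4 G A C \<circ>\<^sub>F F1 G A C) M N f" for M N f
    by (simp add: fcomp_def F1_def F3_def F4_def F5_def)
  fix M assume "M \<in> Ob GC"
  then have M: "gcomodule G A C M" by simp
  interpret gcomodule G A C M by (rule M)
  interpret P: graded_product G "gmod M" Q "gmod M" "F3_op M" by (rule F3_product[OF M])
  let ?X = "fob (F1 G A C) M"
  note X = F1_comodule[OF M] and Xm = F1_right_module[OF M]
  have "dext G (gmod M) Q (gmod M) (F3_op M) x r = F4_act ?X x r" if x: "x \<in> carrier P.M.S" and r: "r \<in> carrier P.N.S" for x r
  proof (rule P.dext_eqI[OF P.M.abelian_group_S P.dext_biadditive _ _ x r])
    show "biadditive P.M.S P.N.S P.M.S (F4_act ?X)"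
      using F4_act_biadditive[OF X] by (simp add: biadditive_def ahom_def)
    fix \<alpha> \<beta> m q assume ab: "\<alpha> \<in> carrier G" "\<beta> \<in> carrier G" and m: "m \<in> carrier (gmod M \<alpha>)" and q: "q \<in> carrier (Q \<beta>)"
    have i: "\<iota> \<beta> \<in> carrier G" and c: "\<alpha> \<cdot> \<beta> \<in> carrier G" and e: "\<alpha> \<cdot> \<beta> \<cdot> \<iota> \<beta> = \<alpha>"
      using ab by (auto simp: G.m_assoc)
    have t: "gcoact M (\<alpha> \<cdot> \<beta>) (\<iota> \<beta>) m \<in> carrier (tensor_group A (gmod M (\<alpha> \<cdot> \<beta>)) (D \<beta>))"
      by (rule gcoact_closed[OF M c i]) (simp add: e m)
    have "F4_act ?X (dinj (carrier G) (gmod M) \<alpha> m) (dinj (carrier G) Q \<beta> q) =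
        contract ?X q (coact ?X (\<iota> \<beta>) (dinj (carrier G) (gmod M) \<alpha> m))"
      by (rule F4_act_dinj[OF X _ ab(2) q]) (simp add: P.M.dinj_closed ab m)
    also have "\<dots> = dinj (carrier G) (gmod M) (\<alpha> \<cdot> \<beta>) (F3_op M \<alpha> \<beta> m q)"
      using F1_coact_dinj[OF M i ab(1) m] ab
        contract_tmap[OF tensor_pair_cmod[OF gmod_module[OF c] i] tensor_pair_cmod[OF Xm i] F1_dinj_rhom[OF M c] lhom_id
          dual_lhom[OF q] t] by simp
    finally show "dext G (gmod M) Q (gmod M) (F3_op M) (dinj (carrier G) (gmod M) \<alpha> m) (dinj (carrier G) Q \<beta> q) =
        F4_act ?X (dinj (carrier G) (gmod M) \<alpha> m) (dinj (carrier G) Q \<beta> q)"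
      using P.dext_dinj[OF ab m q] by simp
  qed
  then have "(\<lambda>x\<in>carrier P.M.S. \<lambda>r\<in>carrier R. dext G (gmod M) Q (gmod M) (F3_op M) x r) =
      (\<lambda>x\<in>carrier ?X. \<lambda>r\<in>carrier R. F4_act ?X x r)"
    by (simp cong: restrict_cong)
  then show "fob (F5 \<circ>\<^sub>F F3 G A C) M = fob (F4 G A C \<circ>\<^sub>F F1 G A C) M"
    by (simp add: fcomp_def F3_fob F5_def F4_def graded_module_def with_ract_def rmod.defs)
qed

text \<open>
  Families whose members agree in their additive fields have equal direct sums, although the types of
  the two families may differ.
\<close>

lemma
  assumes "\<And>i. carrier (N i) = carrier (M i)" "\<And>i. add (N i) = add (M i)" "\<And>i. zero (N i) = zero (M i)"
  shows dsum_transfer: "dsum I N = dsum I M" and dsupp_transfer: "dsupp I N = dsupp I M"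
    and dinj_transfer: "dinj I N = dinj I M" and dpart_transfer: "dpart I N = dpart I M"
    and dsum_map_transfer: "dsum_map I N f = dsum_map I M f"
proof -
  show s: "dsum I N = dsum I M" by (simp add: dsum_def sum_group_def product_group_def assms)
  show d: "dsupp I N = dsupp I M" by (simp add: fun_eq_iff dsupp_def assms)
  show "dinj I N = dinj I M" by (simp add: fun_eq_iff dinj_def assms)
  show "dpart I N = dpart I M" by (simp add: fun_eq_iff dpart_def s d)
  show "dsum_map I N f = dsum_map I M f" by (simp add: dsum_map_def s)
qed

text \<open>
  The copies \<open>\<mu>\<^sub>\<alpha>\<close> are taken of two records here, the comodule and the \<open>R\<close>-module that \<open>F4\<close> makes of
  it.  They share their additive fields, hence have the same direct sums, and their homogeneous actions
  agree because \<open>\<mu>\<^sub>\<alpha>\<close> is \<open>A\<close>-linear.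
\<close>

lemma F3_G1_eq_G5_F4:
  "functors_equal CC (grmod_cat G R (dual_part G A C)) (F3 G A C \<circ>\<^sub>F G1 G A C) (G5 G A C \<circ>\<^sub>F F4 G A C)"
  unfolding functors_equal_def
proof (intro conjI ballI)
  show "is_functor CC (grmod_cat G R (dual_part G A C)) (F3 G A C \<circ>\<^sub>F G1 G A C)" by (rule is_functor_comp[OF G1_functor F3_functor])
  show "is_functor CC (grmod_cat G R (dual_part G A C)) (G5 G A C \<circ>\<^sub>F F4 G A C)" by (rule is_functor_comp[OF F4_functor G5_functor])
  fix M assume "M \<in> Ob CC"
  then have M: "comodule G A C M" by simp
  note Mm = comodule_right_module[OF M]
  let ?Y = "fob (F4 G A C) M" and ?Z = "fob (G1 G A C) M"
  let ?N = "\<lambda>\<alpha>. mu \<alpha> M" and ?N' = "\<lambda>\<alpha>. mu \<alpha> ?Y"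
  have mu: "carrier (?N' \<alpha>) = carrier (?N \<alpha>)" "add (?N' \<alpha>) = add (?N \<alpha>)" "zero (?N' \<alpha>) = zero (?N \<alpha>)" for \<alpha>
    by (simp_all add: mu_def)
  note tr = dsum_transfer[of ?N' ?N, OF mu] dsupp_transfer[of ?N' ?N, OF mu] dinj_transfer[of ?N' ?N, OF mu]
    dpart_transfer[of ?N' ?N, OF mu]
  interpret P: graded_product G ?N Q ?N "F3_op ?Z" using F3_product[OF G1_gcomodule[OF M]] by simp
  interpret P': graded_product G ?N' Q ?N' "G5_op ?Y" by (rule G5_product[OF F4_right_module[OF M]])
  have op: "F3_op ?Z \<alpha> \<beta> x q = G5_op ?Y \<alpha> \<beta> x q"
    if ab: "\<alpha> \<in> carrier G" "\<beta> \<in> carrier G" and x: "x \<in> carrier (?N \<alpha>)" and q: "q \<in> carrier (Q \<beta>)" for \<alpha> \<beta> x q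
  proof -
    have m: "snd x \<in> carrier M" using x by auto
    have i: "\<iota> \<beta> \<in> carrier G" using ab by simp
    show ?thesis
      using contract_tmap[OF tensor_pair_cmod[OF Mm i] tensor_pair_cmod[OF mu_right_module[OF Mm] i] Pair_rhom lhom_id
          dual_lhom[OF q] coact_closed[OF M i m], of "\<alpha> \<cdot> \<beta>"]
        F4_act_dinj[OF M m ab(2) q] m P.N.dinj_closed[OF ab(2) q] by simp
  qed
  have "dext G ?N Q ?N (F3_op ?Z) x r = dext G ?N' Q ?N' (G5_op ?Y) x r"
    if x: "x \<in> carrier P.M.S" and r: "r \<in> carrier P.N.S" for x r
  proof (rule P.dext_eqI[OF P.M.abelian_group_S P.dext_biadditive _ _ x r])
    show "biadditive P.M.S P.N.S P.M.S (dext G ?N' Q ?N' (G5_op ?Y))"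
      using P'.dext_biadditive by (simp add: tr(1))
    fix \<alpha> \<beta> m q assume *: "\<alpha> \<in> carrier G" "\<beta> \<in> carrier G" "m \<in> carrier (?N \<alpha>)" "q \<in> carrier (Q \<beta>)"
    show "dext G ?N Q ?N (F3_op ?Z) (dinj (carrier G) ?N \<alpha> m) (dinj (carrier G) Q \<beta> q) =
        dext G ?N' Q ?N' (G5_op ?Y) (dinj (carrier G) ?N \<alpha> m) (dinj (carrier G) Q \<beta> q)"
      using P.dext_dinj[OF *] P'.dext_dinj[OF *(1,2) _ *(4), of m] op[OF *] *(3) by (simp add: tr(3) mu(1) del: mu_simps(1))
  qed
  then have "(\<lambda>x\<in>carrier P.M.S. \<lambda>r\<in>carrier R. dext G ?N Q ?N (F3_op ?Z) x r) =
      (\<lambda>x\<in>carrier P.M.S. \<lambda>r\<in>carrier R. dext G ?N' Q ?N' (G5_op ?Y) x r)"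
    by (simp cong: restrict_cong)
  then show "fob (F3 G A C \<circ>\<^sub>F G1 G A C) M = fob (G5 G A C \<circ>\<^sub>F F4 G A C) M"
    by (simp add: fcomp_def F3_fob G5_fob graded_module_def tr(1,4))
  fix N f assume "f \<in> Hom CC M N"
  have "dsum_map (carrier G) ?N (\<lambda>\<alpha>\<in>carrier G. \<lambda>x\<in>carrier (mu \<alpha> M). (\<alpha>, f (snd x))) =
      dsum_map (carrier G) ?N (\<lambda>\<alpha> x. (\<alpha>, f (snd x)))"
    unfolding dsum_map_def using P.M.S_apply by (intro restrict_ext) (fastforce simp del: mu_simps)
  then show "far (F3 G A C \<circ>\<^sub>F G1 G A C) M N f = far (G5 G A C \<circ>\<^sub>F F4 G A C) M N f"
    using dsum_map_transfer[of ?N' ?N, OF mu, of "carrier G" "\<lambda>\<alpha> x. (\<alpha>, f (snd x))"] by (simp add: fcomp_def) (simp add: F3_def G5_def F4_def G1_def)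
qed

end

theorem proposition4p5:
  fixes G :: "('g, 'x) monoid_scheme" and A :: "('a, 'y) ring_scheme"
    and C :: "('g, 'a, 'c) coring"
  assumes "group_coring G A C"
  shows "is_functor (gcomod_cat G A C) (comod_cat G A C)
       (F1 G A C :: (('g, 'a, 'm, 'c) gcomod, _, _, _) ftor) \<and>
    is_functor (comod_cat G A C) (gcomod_cat G A C)
       (G1 G A C :: (('g, 'a, 'n, 'c) comod, _, _, _) ftor) \<and>
    is_functor (gcomod_cat G A C) (grmod_cat G (dual_ring G A C) (dual_part G A C))
       (F3 G A C :: (('g, 'a, 'm, 'c) gcomod, _, _, _) ftor) \<and>
    is_functor (comod_cat G A C) (rmod_cat (dual_ring G A C))
       (F4 G A C :: (('g, 'a, 'n, 'c) comod, _, _, _) ftor) \<and>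
    is_functor (grmod_cat G (dual_ring G A C) (dual_part G A C)) (rmod_cat (dual_ring G A C))
       (F5 :: (('g, 'g \<Rightarrow> 'c \<Rightarrow> 'a, 'k) grmod, _, _, _) ftor) \<and>
    is_functor (rmod_cat (dual_ring G A C)) (grmod_cat G (dual_ring G A C) (dual_part G A C))
       (G5 G A C :: (('g \<Rightarrow> 'c \<Rightarrow> 'a, 'k) rmod, _, _, _) ftor) \<and>
    functors_equal (gcomod_cat G A C) (rmod_cat (dual_ring G A C))
       (F5 \<circ>\<^sub>F F3 G A C)
       (F4 G A C \<circ>\<^sub>F F1 G A C :: (('g, 'a, 'm, 'c) gcomod, _, _, _) ftor) \<and>
    functors_equal (comod_cat G A C) (grmod_cat G (dual_ring G A C) (dual_part G A C))
       (F3 G A C \<circ>\<^sub>F G1 G A C)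
       (G5 G A C \<circ>\<^sub>F F4 G A C :: (('g, 'a, 'n, 'c) comod, _, _, _) ftor)"
proof -
  interpret group_coring G A C by (rule assms)
  show ?thesis
    by (intro conjI F1_functor G1_functor F3_functor F4_functor F5_functor G5_functor
        F5_F3_eq_F4_F1 F3_G1_eq_G5_F4)
qed

end
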